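(* Let $\varphi=(\varphi_1,\varphi_2,\varphi_3)$ be generic, let $F_\varphi$ be the elliptic curve of the characteristic variety of $C_{\rm alg}(\mathbb R^4_\varphi)$ with its automorphism $\sigma$, and let $K\subset F_\varphi$ be a compact $\sigma$-invariant subset. Then the map $\theta$ determined by $\sqrt2\,\theta(Y)=Y\,W+W^*\,\bar Y^*$, for $Y$ in the linear span $V$ of the generators $x^\mu$, is a unital $*$-homomorphism from $C_{\rm alg}(S^3_\varphi)$ to the crossed product $C^\infty(K)\times_{\sigma,\mathcal L}\mathbb Z$.
   Context: For $\varphi\in(\mathbb R/\pi\mathbb Z)^3$, $C_{\rm alg}(\mathbb R^4_\varphi)$ is the unital $*$-algebra generated by self-adjoint $x^0,\dots,x^3$ with relations, for $(k,\ell,m)$ cyclic permutations of $(1,2,3)$, $$\sin(\varphi_k)(x^0x^k+x^kx^0)=i\cos(\varphi_\ell-\varphi_m)(x^\ell x^m-x^mx^\ell),\quad \cos(\varphi_k)(x^0x^k-x^kx^0)=i\sin(\varphi_\ell-\varphi_m)(x^\ell x^m+x^mx^\ell),$$ and $C_{\rm alg}(S^3_\varphi)$ is its quotient by the additional relation $\sum_\mu(x^\mu)^2=1$. "Generic" means $\varphi_j\notin\frac\pi2\mathbb Z$ and $\varphi_k-\varphi_\ell\notin\frac\pi2\mathbb Z$ for all $j$ and $k\neq\ell$. Let $R\subset V\otimes V$ be the space of relations of $C_{\rm alg}(\mathbb R^4_\varphi)$. The set of pairs $(Z,Z')\in P(V^* )^2$ with $\omega(Z,Z')=0$ for all $\omega\in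 R$ is the graph of an automorphism $\sigma$ of a variety $E\subset P(V^* )$ (the characteristic variety), which is the union of four points and of the elliptic curve $F_\varphi$ given, in the homogeneous coordinates $X^\mu$ dual to the $x^\mu$ and with $\varphi_0=0$, by $\sum_\mu e^{2i\varphi_\mu}(X^\mu)^2=\sum_\mu e^{-2i\varphi_\mu}(X^\mu)^2=0$; $\sigma$ preserves $F_\varphi$. $\mathcal L$ is the restriction to $K$ of the dual of the tautological line bundle of $P(V^* )$, with the hermitian metric $\langle fL,gL'\rangle(Z)=f(Z)\overline{g(Z)}\,\frac{L(Z)\overline{L'(Z)}}{Q(Z,\bar Z)}$ ($L,L'\in V$), where $Q(X,X')=\sum_\mu X^\mu X'^\mu$ and $Z\mapsto\bar Z$ is complex conjugation in the coordinates $X^\mu$; for $Y\in V$, $\bar Y=Y^*$ denotes the adjoint in the $*$-algebra. Twisted crossed product: with $\mathcal L_n=\mathcal L\otimes\mathcal L^{\sigma}\otimes\cdots\otimes\mathcal L^{\sigma^{n-1}}$, it is built from the monomials $\xi W^n$, $W^{*n}\eta^*$, with $\xi,\eta$ (smooth) sections of $\mathcal L_n$ over $K$, $n\ge0$, and product determined by $(\xi_1W^{n_1})(\xi_2W^{n_2})=(\xi_1\otimes(\xi_2\circ\sigma^{n_1}))W^{n_1+n_2}$, $(W^{*k}\eta^* )(\xi W^k)=\langle\xi,\eta\rangle\circ\sigma^{-k}$, $(\xi W^k)(W^{*k}\eta^* )=\langle\xi,\eta\rangle$, and involution $(\xi W^n)^*=W^{*n}\xi^*$. The notation $C^\infty(K)\times_{\sigma,\mathcal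 L}\mathbb Z$ means that smooth sections are used. *)

theory Defs
  imports "HOL-Analysis.Analysis" "HOL-Library.Poly_Mapping" "HOL-Algebra.Module"
begin

section \<open>Unital \<open>*\<close>-algebras over the complex numbers\<close>

record 'a star_algebra = "(complex, 'a) module" +
  adj :: "'a \<Rightarrow> 'a"

locale unital_star_algebra = ring A for A (structure) +
  assumes smult_closed: "x \<in> carrier A \<Longrightarrow> c \<odot> x \<in> carrier A"
    and smult_l_distr: "x \<in> carrier A \<Longrightarrow> (c + d) \<odot> x = c \<odot> x \<oplus> d \<odot> x"
    and smult_r_distr: "x \<in> carrier A \<Longrightarrow> y \<in> carrier A \<Longrightarrow> c \<odot> (x \<oplus> y) = c \<odot> x \<oplus> c \<odot> y"
    and smult_assoc: "x \<in> carrier A \<Longrightarrow> (c * d) \<odot> x = c \<odot> (d \<odot> x)"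
    and smult_one: "x \<in> carrier A \<Longrightarrow> 1 \<odot> x = x"
    and smult_mult_left: "x \<in> carrier A \<Longrightarrow> y \<in> carrier A \<Longrightarrow> (c \<odot> x) \<otimes> y = c \<odot> (x \<otimes> y)"
    and smult_mult_right: "x \<in> carrier A \<Longrightarrow> y \<in> carrier A \<Longrightarrow> x \<otimes> (c \<odot> y) = c \<odot> (x \<otimes> y)"
    and adj_closed: "x \<in> carrier A \<Longrightarrow> adj A x \<in> carrier A"
    and adj_add: "x \<in> carrier A \<Longrightarrow> y \<in> carrier A \<Longrightarrow> adj A (x \<oplus> y) = adj A x \<oplus> adj A y"
    and adj_smult: "x \<in> carrier A \<Longrightarrow> adj A (c \<odot> x) = cnj c \<odot> adj A x"
    and adj_mult: "x \<in> carrier A \<Longrightarrow> y \<in> carrier A \<Longrightarrow> adj A (x \<otimes> y) = adj A y \<otimes> adj A x"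
    and adj_adj: "x \<in> carrier A \<Longrightarrow> adj A (adj A x) = x"

locale unital_star_hom =
  A: unital_star_algebra A + B: unital_star_algebra B
  for A :: "('a, 'c) star_algebra_scheme" and B :: "('b, 'd) star_algebra_scheme" and h +
  assumes hom_ring: "h \<in> ring_hom A B"
    and hom_smult: "x \<in> carrier A \<Longrightarrow> h (c \<odot>\<^bsub>A\<^esub> x) = c \<odot>\<^bsub>B\<^esub> h x"
    and hom_adj: "x \<in> carrier A \<Longrightarrow> h (adj A x) = adj B (h x)"


section \<open>Presented \<open>*\<close>-algebras on four self-adjoint generators\<close>

text \<open>Words in the generators form the free monoid under concatenation, so that the type
  \<open>4 list \<Rightarrow>\<^sub>0 complex\<close> carries the product of the free algebra on four generators.
  Its index type has the elements 0, 1, 2, 3.\<close>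

instantiation list :: (type) monoid_add
begin

definition zero_list :: "'a list" where "zero_list = []"

definition plus_list :: "'a list \<Rightarrow> 'a list \<Rightarrow> 'a list" where "plus_list = (@)"

instance by standard (simp_all add: zero_list_def plus_list_def)

end

type_synonym free_alg = "4 list \<Rightarrow>\<^sub>0 complex"

definition gen :: "4 \<Rightarrow> free_alg" where
  "gen \<mu> = Poly_Mapping.single [\<mu>] 1"

definition scl :: "complex \<Rightarrow> free_alg \<Rightarrow> free_alg" where
  "scl c a = Poly_Mapping.map ((*) c) a"

definition free_adj :: "free_alg \<Rightarrow> free_alg" where
  "free_adj a = (\<Sum>w\<in>Poly_Mapping.keys a.
     Poly_Mapping.single (rev w) (cnj (Poly_Mapping.lookup a w)))"

inductive_set star_ideal :: "free_alg set \<Rightarrow> free_alg set" for S where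
  zero: "0 \<in> star_ideal S"
| base: "s \<in> S \<Longrightarrow> s \<in> star_ideal S"
| add: "a \<in> star_ideal S \<Longrightarrow> b \<in> star_ideal S \<Longrightarrow> a + b \<in> star_ideal S"
| mult: "a \<in> star_ideal S \<Longrightarrow> b * a * c \<in> star_ideal S"
| adj: "a \<in> star_ideal S \<Longrightarrow> free_adj a \<in> star_ideal S"

definition cls :: "free_alg set \<Rightarrow> free_alg \<Rightarrow> free_alg set" where
  "cls S a = {b. b - a \<in> star_ideal S}"

definition presented_alg :: "free_alg set \<Rightarrow> free_alg set star_algebra" where
  "presented_alg S = \<lparr>
     carrier = range (cls S),
     monoid.mult = (\<lambda>X Y. \<Union>a\<in>X. \<Union>b\<in>Y. cls S (a * b)),
     one = cls S 1,
     ring.zero = cls S 0,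
     ring.add = (\<lambda>X Y. \<Union>a\<in>X. \<Union>b\<in>Y. cls S (a + b)),
     smult = (\<lambda>c X. \<Union>a\<in>X. cls S (scl c a)),
     adj = (\<lambda>X. \<Union>a\<in>X. cls S (free_adj a))\<rparr>"


section \<open>The noncommutative 3-spheres\<close>

text \<open>Replacing one angle \<open>\<phi> k\<close> (\<open>k \<noteq> 0\<close>) by \<open>\<phi> k + pi\<close> changes the relations below by the
  sign change of the generator with index 0; the angles are therefore taken as arbitrary real
  representatives. The convention \<open>\<phi> 0 = 0\<close> is an assumption wherever it matters.\<close>

definition generic :: "(4 \<Rightarrow> real) \<Rightarrow> bool" where
  "generic \<phi> \<longleftrightarrow>
     (\<forall>j\<in>{1, 2, 3}. \<forall>n::int. \<phi> j \<noteq> of_int n * (pi / 2)) \<and>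
     (\<forall>k\<in>{1, 2, 3}. \<forall>l\<in>{1, 2, 3}. k \<noteq> l \<longrightarrow> (\<forall>n::int. \<phi> k - \<phi> l \<noteq> of_int n * (pi / 2)))"

definition R4_relators :: "(4 \<Rightarrow> real) \<Rightarrow> free_alg set" where
  "R4_relators \<phi> = (\<Union>(k, l, m)\<in>{(1, 2, 3), (2, 3, 1), (3, 1, 2)}.
     {scl (of_real (sin (\<phi> k))) (gen 0 * gen k + gen k * gen 0)
        - scl (\<i> * of_real (cos (\<phi> l - \<phi> m))) (gen l * gen m - gen m * gen l),
      scl (of_real (cos (\<phi> k))) (gen 0 * gen k - gen k * gen 0)
        - scl (\<i> * of_real (sin (\<phi> l - \<phi> m))) (gen l * gen m + gen m * gen l)})"

definition S3_relators :: "(4 \<Rightarrow> real) \<Rightarrow> free_alg set" where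
  "S3_relators \<phi> = insert ((\<Sum>\<mu>\<in>UNIV. gen \<mu> ^ 2) - 1) (R4_relators \<phi>)"

definition C_alg_S3 :: "(4 \<Rightarrow> real) \<Rightarrow> free_alg set star_algebra" where
  "C_alg_S3 \<phi> = presented_alg (S3_relators \<phi>)"

definition gen_span :: "free_alg set" where
  "gen_span = range (\<lambda>c::4 \<Rightarrow> complex. \<Sum>\<mu>\<in>UNIV. scl (c \<mu>) (gen \<mu>))"


section \<open>The projective space \<open>P(V\<^sup>*)\<close> and the characteristic variety\<close>

text \<open>\<open>V\<^sup>*\<close> is \<open>complex^4\<close>, with the generators as coordinates; a point of the projective space
  is a line through the origin, regarded as a set of vectors.\<close>

definition line :: "complex^4 \<Rightarrow> (complex^4) set" where
  "line z = range (\<lambda>c. c *s z)"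

definition proj_space :: "(complex^4) set set" where
  "proj_space = line ` (UNIV - {0})"

definition proj_topology :: "(complex^4) set topology" where
  "proj_topology = topology (\<lambda>U. U \<subseteq> proj_space \<and> open {z. z \<noteq> 0 \<and> line z \<in> U})"

lemma openin_proj_topology:
  "openin proj_topology U \<longleftrightarrow> U \<subseteq> proj_space \<and> open {z. z \<noteq> 0 \<and> line z \<in> U}"
proof -
  have "istopology (\<lambda>U. U \<subseteq> proj_space \<and> open {z. z \<noteq> 0 \<and> line z \<in> U})"
    unfolding istopology_def
  proof (intro conjI allI impI; (elim conjE)?)
    fix S T :: "(complex^4) set set"
    assume "open {z. z \<noteq> 0 \<and> line z \<in> S}" "open {z. z \<noteq> 0 \<and> line z \<in> T}"
    then have "open ({z. z \<noteq> 0 \<and> line z \<in> S} \<inter> {z. z \<noteq> 0 \<and> line z \<in> T})"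
      by (rule open_Int)
    moreover have "{z. z \<noteq> 0 \<and> line z \<in> S} \<inter> {z. z \<noteq> 0 \<and> line z \<in> T}
        = {z. z \<noteq> 0 \<and> line z \<in> S \<inter> T}"
      by auto
    ultimately show "open {z. z \<noteq> 0 \<and> line z \<in> S \<inter> T}" by simp
  next
    fix \<K> :: "(complex^4) set set set"
    assume *: "\<forall>S\<in>\<K>. S \<subseteq> proj_space \<and> open {z. z \<noteq> 0 \<and> line z \<in> S}"
    then have "open (\<Union>S\<in>\<K>. {z. z \<noteq> 0 \<and> line z \<in> S})"
      by (intro open_UN) auto
    moreover have "(\<Union>S\<in>\<K>. {z. z \<noteq> 0 \<and> line z \<in> S}) = {z. z \<noteq> 0 \<and> line z \<in> \<Union>\<K>}"
      by auto
    ultimately show "open {z. z \<noteq> 0 \<and> line z \<in> \<Union>\<K>}" by simp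
    from * show "\<Union>\<K> \<subseteq> proj_space" by auto
  qed auto
  then show ?thesis
    unfolding proj_topology_def by (simp add: topology_inverse')
qed

definition relation_space :: "(4 \<Rightarrow> real) \<Rightarrow> free_alg set" where
  "relation_space \<phi> = range (\<lambda>c::free_alg \<Rightarrow> complex. \<Sum>r\<in>R4_relators \<phi>. scl (c r) r)"

definition pairing :: "free_alg \<Rightarrow> complex^4 \<Rightarrow> complex^4 \<Rightarrow> complex" where
  "pairing \<omega> z z' = (\<Sum>\<mu>\<in>UNIV. \<Sum>\<nu>\<in>UNIV. Poly_Mapping.lookup \<omega> [\<mu>, \<nu>] * z $ \<mu> * z' $ \<nu>)"

definition char_graph :: "(4 \<Rightarrow> real) \<Rightarrow> ((complex^4) set \<times> (complex^4) set) set" where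
  "char_graph \<phi> = {(p, p'). p \<in> proj_space \<and> p' \<in> proj_space \<and>
     (\<forall>\<omega>\<in>relation_space \<phi>. \<forall>z\<in>p. \<forall>z'\<in>p'. pairing \<omega> z z' = 0)}"

text \<open>Only the values on the characteristic variety, the domain of \<open>char_graph\<close>, are
  meaningful.\<close>

definition char_aut :: "(4 \<Rightarrow> real) \<Rightarrow> (complex^4) set \<Rightarrow> (complex^4) set" where
  "char_aut \<phi> p = (THE p'. (p, p') \<in> char_graph \<phi>)"

definition F_curve :: "(4 \<Rightarrow> real) \<Rightarrow> (complex^4) set set" where
  "F_curve \<phi> = {line z | z. z \<noteq> 0 \<and>
     (\<Sum>\<mu>\<in>UNIV. exp (2 * \<i> * of_real (\<phi> \<mu>)) * (z $ \<mu>)\<^sup>2) = 0 \<and>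
     (\<Sum>\<mu>\<in>UNIV. exp (- 2 * \<i> * of_real (\<phi> \<mu>)) * (z $ \<mu>)\<^sup>2) = 0}"


section \<open>The line bundles \<open>L\<^sub>n\<close> over \<open>K\<close>\<close>

text \<open>The fibre at \<open>p\<close> of the dual of the tautological bundle is the dual of the line \<open>p\<close>. Hence
  the fibre of \<open>L\<^sub>n\<close> at \<open>p\<close>, the tensor product of the duals of \<open>p, \<sigma> p, \<dots>, \<sigma>\<^sup>n\<^sup>-\<^sup>1 p\<close>, is the space
  of \<open>n\<close>-linear forms on the product of these lines. The lines being one-dimensional, such a form
  is \<open>n\<close>-linear as soon as it is homogeneous of degree 1 in each argument. Sections are extended
  by 0 outside their domain, so that equality of sections is equality of functions.\<close>

type_synonym bundle_section = "(complex^4) set \<Rightarrow> (complex^4) list \<Rightarrow> complex"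

definition orbit_tuples ::
    "((complex^4) set \<Rightarrow> (complex^4) set) \<Rightarrow> nat \<Rightarrow> (complex^4) set \<Rightarrow> (complex^4) list set" where
  "orbit_tuples \<sigma> n p = {vs. length vs = n \<and> (\<forall>j<n. vs ! j \<in> (\<sigma> ^^ j) p)}"

definition sections ::
    "(complex^4) set set \<Rightarrow> ((complex^4) set \<Rightarrow> (complex^4) set) \<Rightarrow> nat \<Rightarrow> bundle_section set" where
  "sections K \<sigma> n = {\<xi>.
     (\<forall>p vs. \<not> (p \<in> K \<and> vs \<in> orbit_tuples \<sigma> n p) \<longrightarrow> \<xi> p vs = 0) \<and>
     (\<forall>p\<in>K. \<forall>vs\<in>orbit_tuples \<sigma> n p. \<forall>j<n. \<forall>c. \<xi> p (vs[j := c *s vs ! j]) = c * \<xi> p vs)}"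

primrec C_k_on :: "nat \<Rightarrow> (complex^4) set \<Rightarrow> (complex^4 \<Rightarrow> complex) \<Rightarrow> bool" where
  "C_k_on 0 U g \<longleftrightarrow> continuous_on U g"
| "C_k_on (Suc k) U g \<longleftrightarrow> g differentiable_on U \<and>
     (\<forall>v. C_k_on k U (\<lambda>x. frechet_derivative g (at x) v))"

text \<open>Infinitely differentiable in the real sense; used for open \<open>U\<close> only.\<close>

definition smooth_on :: "(complex^4) set \<Rightarrow> (complex^4 \<Rightarrow> complex) \<Rightarrow> bool" where
  "smooth_on U g \<longleftrightarrow> (\<forall>k. C_k_on k U g)"

definition lin_form :: "free_alg \<Rightarrow> complex^4 \<Rightarrow> complex" where
  "lin_form Y z = (\<Sum>\<mu>\<in>UNIV. Poly_Mapping.lookup Y [\<mu>] * z $ \<mu>)"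

text \<open>Near each point of \<open>K\<close>, the coefficient of the section in a local frame
  \<open>Y 0 \<otimes> (Y 1 \<circ> \<sigma>) \<otimes> \<dots>\<close> with \<open>Y j \<in> V\<close> is the restriction of a smooth function. As \<open>K\<close> is merely
  compact, smooth means: locally the restriction of a smooth function on the ambient space. Such
  functions are described here by their lifts to \<open>complex^4 - {0}\<close>.\<close>

definition smooth_sections ::
    "(complex^4) set set \<Rightarrow> ((complex^4) set \<Rightarrow> (complex^4) set) \<Rightarrow> nat \<Rightarrow> bundle_section set" where
  "smooth_sections K \<sigma> n = {\<xi> \<in> sections K \<sigma> n.
     \<forall>z. z \<noteq> 0 \<and> line z \<in> K \<longrightarrow>
       (\<exists>U g Y. open U \<and> z \<in> U \<and> smooth_on U g \<and>
         (\<forall>j<n. Y j \<in> gen_span \<and> (\<exists>v\<in>(\<sigma> ^^ j) (line z). lin_form (Y j) v \<noteq> 0)) \<and>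
         (\<forall>y\<in>U. y \<noteq> 0 \<and> line y \<in> K \<longrightarrow>
           (\<forall>vs\<in>orbit_tuples \<sigma> n (line y).
             \<xi> (line y) vs = g y * (\<Prod>j<n. lin_form (Y j) (vs ! j)))))}"

definition form_section :: "(complex^4) set set \<Rightarrow> free_alg \<Rightarrow> bundle_section" where
  "form_section K Y p vs = (if p \<in> K \<and> (\<exists>v\<in>p. vs = [v]) then lin_form Y (hd vs) else 0)"

definition fun_section :: "(complex^4) set set \<Rightarrow> ((complex^4) set \<Rightarrow> complex) \<Rightarrow> bundle_section" where
  "fun_section K f p vs = (if p \<in> K \<and> vs = [] then f p else 0)"

definition tensor_section ::
    "((complex^4) set \<Rightarrow> (complex^4) set) \<Rightarrow> nat \<Rightarrow> bundle_section \<Rightarrow> bundle_section \<Rightarrow> bundle_section" where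
  "tensor_section \<sigma> n \<xi> \<xi>' p vs = \<xi> p (take n vs) * \<xi>' ((\<sigma> ^^ n) p) (drop n vs)"

definition Q :: "complex^4 \<Rightarrow> complex^4 \<Rightarrow> complex" where
  "Q z z' = (\<Sum>\<mu>\<in>UNIV. z $ \<mu> * z' $ \<mu>)"

definition conj_vec :: "complex^4 \<Rightarrow> complex^4" where
  "conj_vec z = (\<chi> \<mu>. cnj (z $ \<mu>))"

text \<open>The hermitian metric of \<open>L\<^sub>n\<close>, the tensor product of the metrics of its factors; the value
  does not depend on the nonzero vectors chosen on the lines.\<close>

definition herm ::
    "((complex^4) set \<Rightarrow> (complex^4) set) \<Rightarrow> nat \<Rightarrow> bundle_section \<Rightarrow> bundle_section
      \<Rightarrow> (complex^4) set \<Rightarrow> complex" where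
  "herm \<sigma> n \<xi> \<eta> p =
     (let vs = (SOME vs. vs \<in> orbit_tuples \<sigma> n p \<and> 0 \<notin> set vs)
      in \<xi> p vs * cnj (\<eta> p vs) / (\<Prod>j<n. Q (vs ! j) (conj_vec (vs ! j))))"


section \<open>The twisted crossed product\<close>

text \<open>A unit orbit is a two-sided \<open>\<sigma>\<close>-orbit in \<open>K\<close> together with a vector of length 1 on each of
  its lines, for the metric \<open>Q z (conj_vec z)\<close> on the tautological bundle, to which the metric
  of \<open>L\<close> is dual. A section of \<open>L\<^sub>n\<close> is determined by its values on unit vectors, and is
  thus a function of \<open>\<omega> 0, \<dots>, \<omega> (n - 1)\<close> on unit orbits. An element of the crossed product is
  encoded by its homogeneous components, indexed by the integers, each a function on unit orbits
  (and 0 elsewhere): \<open>\<xi> W\<^sup>n\<close> has degree \<open>n\<close> and component \<open>\<xi>(\<omega> 0, \<dots>, \<omega> (n - 1))\<close>, while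
  \<open>W\<^sup>*\<^sup>n \<eta>\<^sup>*\<close> has degree \<open>-n\<close> and component the conjugate of \<open>\<eta>(\<omega> (-n), \<dots>, \<omega> (-1))\<close>. In this
  picture \<open>W\<close> implements the shift of orbits. The lemmas at the end of the section show that
  the encoding is faithful and that the product is the one of the twisted crossed product.\<close>

type_synonym cp_elem = "int \<Rightarrow> (int \<Rightarrow> complex^4) \<Rightarrow> complex"

definition unit_orbits ::
    "(complex^4) set set \<Rightarrow> ((complex^4) set \<Rightarrow> (complex^4) set) \<Rightarrow> (int \<Rightarrow> complex^4) set" where
  "unit_orbits K \<sigma> = {\<omega>. \<forall>j. Q (\<omega> j) (conj_vec (\<omega> j)) = 1 \<and> line (\<omega> j) \<in> K \<and>
     line (\<omega> (j + 1)) = \<sigma> (line (\<omega> j))}"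

definition shift :: "int \<Rightarrow> (int \<Rightarrow> complex^4) \<Rightarrow> int \<Rightarrow> complex^4" where
  "shift k \<omega> = (\<lambda>j. \<omega> (j + k))"

definition mono_W ::
    "(complex^4) set set \<Rightarrow> ((complex^4) set \<Rightarrow> (complex^4) set) \<Rightarrow> nat \<Rightarrow> bundle_section \<Rightarrow> cp_elem" where
  "mono_W K \<sigma> n \<xi> = (\<lambda>d \<omega>. if d = int n \<and> \<omega> \<in> unit_orbits K \<sigma>
     then \<xi> (line (\<omega> 0)) (map (\<lambda>j. \<omega> (int j)) [0..<n]) else 0)"

definition mono_Wstar ::
    "(complex^4) set set \<Rightarrow> ((complex^4) set \<Rightarrow> (complex^4) set) \<Rightarrow> nat \<Rightarrow> bundle_section \<Rightarrow> cp_elem" where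
  "mono_Wstar K \<sigma> n \<eta> = (\<lambda>d \<omega>. if d = - int n \<and> \<omega> \<in> unit_orbits K \<sigma>
     then cnj (\<eta> (line (\<omega> (- int n))) (map (\<lambda>j. \<omega> (int j - int n)) [0..<n])) else 0)"

inductive_set cp_carrier ::
    "(complex^4) set set \<Rightarrow> ((complex^4) set \<Rightarrow> (complex^4) set) \<Rightarrow> cp_elem set" for K \<sigma> where
  zero: "(\<lambda>d \<omega>. 0) \<in> cp_carrier K \<sigma>"
| add_mono_W: "\<xi> \<in> smooth_sections K \<sigma> n \<Longrightarrow> a \<in> cp_carrier K \<sigma> \<Longrightarrow>
    (\<lambda>d \<omega>. mono_W K \<sigma> n \<xi> d \<omega> + a d \<omega>) \<in> cp_carrier K \<sigma>"
| add_mono_Wstar: "\<eta> \<in> smooth_sections K \<sigma> n \<Longrightarrow> a \<in> cp_carrier K \<sigma> \<Longrightarrow>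
    (\<lambda>d \<omega>. mono_Wstar K \<sigma> n \<eta> d \<omega> + a d \<omega>) \<in> cp_carrier K \<sigma>"

definition crossed_product ::
    "(complex^4) set set \<Rightarrow> ((complex^4) set \<Rightarrow> (complex^4) set) \<Rightarrow> cp_elem star_algebra" where
  "crossed_product K \<sigma> = \<lparr>
     carrier = cp_carrier K \<sigma>,
     monoid.mult = (\<lambda>a b d \<omega>. \<Sum>k | a k \<omega> \<noteq> 0. a k \<omega> * b (d - k) (shift k \<omega>)),
     one = mono_W K \<sigma> 0 (fun_section K (\<lambda>p. 1)),
     ring.zero = (\<lambda>d \<omega>. 0),
     ring.add = (\<lambda>a b d \<omega>. a d \<omega> + b d \<omega>),
     smult = (\<lambda>c a d \<omega>. c * a d \<omega>),
     adj = (\<lambda>a d \<omega>. cnj (a (- d) (shift d \<omega>)))\<rparr>"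


context
  fixes K :: "(complex^4) set set" and \<sigma> :: "(complex^4) set \<Rightarrow> (complex^4) set"
  assumes proj: "K \<subseteq> proj_space" and bij: "bij_betw \<sigma> K K"
begin

lemma shift_unit_orbits [simp]: "shift k \<omega> \<in> unit_orbits K \<sigma> \<longleftrightarrow> \<omega> \<in> unit_orbits K \<sigma>"
proof -
  have *: "shift i \<psi> \<in> unit_orbits K \<sigma>" if \<psi>: "\<psi> \<in> unit_orbits K \<sigma>" for i \<psi>
    unfolding unit_orbits_def shift_def
  proof (intro CollectI allI)
    fix j
    have "line (\<psi> (j + i + 1)) = \<sigma> (line (\<psi> (j + i)))"
      using \<psi> unfolding unit_orbits_def by blast
    then have "line (\<psi> (j + 1 + i)) = \<sigma> (line (\<psi> (j + i)))"
      by (simp add: add_ac)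
    then show "Q (\<psi> (j + i)) (conj_vec (\<psi> (j + i))) = 1 \<and> line (\<psi> (j + i)) \<in> K \<and>
        line (\<psi> (j + 1 + i)) = \<sigma> (line (\<psi> (j + i)))"
      using \<psi> unfolding unit_orbits_def by simp
  qed
  have "shift (- k) (shift k \<omega>) = \<omega>" by (simp add: shift_def)
  then show ?thesis using * by metis
qed

lemma shift_apply: "shift k \<omega> j = \<omega> (j + k)"
  by (simp add: shift_def)

lemma unit_orbits_funpow:
  assumes "\<omega> \<in> unit_orbits K \<sigma>"
  shows "line (\<omega> (j + int n)) = (\<sigma> ^^ n) (line (\<omega> j))"
proof (induction n)
  case (Suc n)
  have "line (\<omega> (j + int n + 1)) = \<sigma> (line (\<omega> (j + int n)))"
    using assms unfolding unit_orbits_def by blast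
  then show ?case using Suc by (simp add: add_ac)
qed simp

lemma line_self: "z \<in> line z"
  unfolding line_def using rangeI[of "\<lambda>c. c *s z" 1] by simp

lemma Q_conj: "Q z (conj_vec z) = of_real ((norm z)\<^sup>2)"
proof -
  have "(norm z)\<^sup>2 = (\<Sum>\<mu>\<in>UNIV. (norm (z $ \<mu>))\<^sup>2)"
    by (simp add: norm_vec_def L2_set_def sum_nonneg)
  then show ?thesis
    by (simp only: Q_def conj_vec_def vec_lambda_beta of_real_sum complex_norm_square)
qed

lemma herm_eq:
  assumes \<xi>: "\<xi> \<in> sections K \<sigma> n" and \<eta>: "\<eta> \<in> sections K \<sigma> n" and p: "p \<in> K"
    and lines: "\<And>j. j < n \<Longrightarrow> (\<sigma> ^^ j) p \<in> proj_space"
    and vs: "vs \<in> orbit_tuples \<sigma> n p" "0 \<notin> set vs"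
  shows "herm \<sigma> n \<xi> \<eta> p = \<xi> p vs * cnj (\<eta> p vs) / (\<Prod>j<n. Q (vs ! j) (conj_vec (vs ! j)))"
proof -
  define f where "f us = \<xi> p us * cnj (\<eta> p us) / (\<Prod>j<n. Q (us ! j) (conj_vec (us ! j)))" for us
  have len: "length us = n" if "us \<in> orbit_tuples \<sigma> n p" for us
    using that by (simp add: orbit_tuples_def)
  have step: "f (us[i := c *s us ! i]) = f us"
    if us: "us \<in> orbit_tuples \<sigma> n p" and i: "i < n" and c: "c \<noteq> 0" for us i c
  proof -
    have Qc: "Q (c *s z) (conj_vec (c *s z)) = c * cnj c * Q z (conj_vec z)" for z
      by (simp add: Q_def conj_vec_def sum_distrib_left mult_ac)
    have "(\<Prod>j<n. Q (us[i := c *s us ! i] ! j) (conj_vec (us[i := c *s us ! i] ! j)))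
        = (\<Prod>j<n. (if j = i then c * cnj c else 1) * Q (us ! j) (conj_vec (us ! j)))"
      using len[OF us] i by (intro prod.cong) (auto simp: Qc)
    also have "\<dots> = c * cnj c * (\<Prod>j<n. Q (us ! j) (conj_vec (us ! j)))"
      using i by (simp add: prod.distrib prod.delta)
    finally show ?thesis
      using \<xi> \<eta> p us i c unfolding f_def sections_def by simp
  qed
  have "f us = f vs" if us: "us \<in> orbit_tuples \<sigma> n p" "0 \<notin> set us" for us
  proof -
    have mix: "take i vs @ drop i us \<in> orbit_tuples \<sigma> n p \<and> f (take i vs @ drop i us) = f us"
      if "i \<le> n" for i
      using that
    proof (induction i)
      case (Suc i)
      let ?m = "take i vs @ drop i us"
      have i: "i < n" "length us = n" "length vs = n"
        using Suc.prems len[OF us(1)] len[OF vs(1)] by auto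
      have nth: "?m ! i = us ! i" using i by (simp add: nth_append)
      have "us ! i \<in> (\<sigma> ^^ i) p" "vs ! i \<in> (\<sigma> ^^ i) p" "us ! i \<noteq> 0" "vs ! i \<noteq> 0"
        using us vs i by (auto simp: orbit_tuples_def) (metis nth_mem)+
      moreover obtain z where "(\<sigma> ^^ i) p = line z"
        using lines[OF i(1)] by (auto simp: proj_space_def)
      ultimately obtain a b where "us ! i = a *s z" "vs ! i = b *s z" "a \<noteq> 0" "b \<noteq> 0"
        by (auto simp: line_def)
      then have c: "vs ! i = (b / a) *s us ! i" "b / a \<noteq> 0"
        by (simp_all add: vector_smult_assoc)
      have eq: "take (Suc i) vs @ drop (Suc i) us = ?m[i := (b / a) *s ?m ! i]"
        unfolding nth c(1)[symmetric] using i
        by (simp add: list_update_append take_Suc_conv_app_nth Cons_nth_drop_Suc[symmetric])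
      have m: "?m \<in> orbit_tuples \<sigma> n p" "f ?m = f us" using Suc by auto
      have "f (take (Suc i) vs @ drop (Suc i) us) = f us"
        unfolding eq using step[OF m(1) i(1) c(2)] m(2) by simp
      moreover have "take (Suc i) vs @ drop (Suc i) us \<in> orbit_tuples \<sigma> n p"
        using us(1) vs(1) i by (auto simp: orbit_tuples_def nth_append)
      ultimately show ?case by simp
    qed (use us in simp)
    from mix[of n] show ?thesis using len[OF us(1)] len[OF vs(1)] by simp
  qed
  moreover have "\<exists>us. us \<in> orbit_tuples \<sigma> n p \<and> 0 \<notin> set us" using vs by blast
  then have "(SOME us. us \<in> orbit_tuples \<sigma> n p \<and> 0 \<notin> set us) \<in> orbit_tuples \<sigma> n p"
    "0 \<notin> set (SOME us. us \<in> orbit_tuples \<sigma> n p \<and> 0 \<notin> set us)"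
    using someI_ex[where P = "\<lambda>us. us \<in> orbit_tuples \<sigma> n p \<and> 0 \<notin> set us"] by blast+
  ultimately have "f (SOME us. us \<in> orbit_tuples \<sigma> n p \<and> 0 \<notin> set us) = f vs" by blast
  then show ?thesis unfolding herm_def f_def Let_def .
qed

lemma orbit_line:
  assumes "p \<in> K"
  shows "(\<sigma> ^^ n) p \<in> K"
  by (induction n) (use assms bij in \<open>auto simp: bij_betw_def\<close>)

lemma sections_scaled_form: "(\<lambda>p vs. f p * form_section K Y p vs) \<in> sections K \<sigma> 1"
proof -
  have "lin_form Y (c *s z) = c * lin_form Y z" for c z
    by (simp add: lin_form_def sum_distrib_left mult_ac)
  moreover have "c *s v \<in> p" if "p \<in> K" "v \<in> p" for c v p
  proof -
    from that proj obtain z where "p = line z" by (auto simp: proj_space_def)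
    with that show ?thesis by (auto simp: line_def vector_smult_assoc)
  qed
  ultimately show ?thesis
    by (auto simp: sections_def orbit_tuples_def form_section_def length_Suc_conv)
qed

lemma herm_scaled_form:
  assumes "z \<noteq> 0" "line z \<in> K"
  shows "herm \<sigma> 1 (\<lambda>p vs. f p * form_section K Y p vs) (\<lambda>p vs. g p * form_section K Y' p vs) (line z)
     = f (line z) * cnj (g (line z)) * (lin_form Y z * cnj (lin_form Y' z) / Q z (conj_vec z))"
  by (subst herm_eq[OF sections_scaled_form sections_scaled_form, where vs = "[z]"])
     (use assms proj in \<open>auto simp: orbit_tuples_def line_self form_section_def\<close>)

lemma herm_unit_orbit:
  assumes "\<xi> \<in> sections K \<sigma> n" "\<eta> \<in> sections K \<sigma> n" "\<omega> \<in> unit_orbits K \<sigma>"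
  shows "herm \<sigma> n \<xi> \<eta> (line (\<omega> i)) = \<xi> (line (\<omega> i)) (map (\<lambda>j. \<omega> (i + int j)) [0..<n])
     * cnj (\<eta> (line (\<omega> i)) (map (\<lambda>j. \<omega> (i + int j)) [0..<n]))"
proof -
  have Q1: "Q (\<omega> j) (conj_vec (\<omega> j)) = 1" and K: "line (\<omega> j) \<in> K" for j
    using assms(3) by (auto simp: unit_orbits_def)
  have "\<omega> j \<noteq> 0" for j
    using Q1[of j] by (auto simp: Q_def)
  moreover have "\<omega> (i + int j) \<in> (\<sigma> ^^ j) (line (\<omega> i))" for j
    using line_self[of "\<omega> (i + int j)"] by (simp add: unit_orbits_funpow[OF assms(3)])
  moreover have "(\<sigma> ^^ j) (line (\<omega> i)) \<in> proj_space" for j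
    using orbit_line[OF K] proj by blast
  moreover have "(\<Prod>j<n. Q (map (\<lambda>j. \<omega> (i + int j)) [0..<n] ! j)
      (conj_vec (map (\<lambda>j. \<omega> (i + int j)) [0..<n] ! j))) = 1"
    by (intro prod.neutral) (simp add: Q1)
  ultimately show ?thesis
    by (subst herm_eq[OF assms(1,2) K, where vs = "map (\<lambda>j. \<omega> (i + int j)) [0..<n]"])
       (auto simp: orbit_tuples_def)
qed

lemma mult_homogeneous:
  assumes "\<And>k. k \<noteq> e \<Longrightarrow> a k \<omega> = 0"
  shows "(a \<otimes>\<^bsub>crossed_product K \<sigma>\<^esub> b) d \<omega> = a e \<omega> * b (d - e) (shift e \<omega>)"
proof (cases "a e \<omega> = 0")
  case True
  have "a k \<omega> = 0" for k by (cases "k = e") (use True assms in auto)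
  then have "{k. a k \<omega> \<noteq> 0} = {}" by simp
  then show ?thesis using True by (simp add: crossed_product_def)
next
  case False
  then have "{k. a k \<omega> \<noteq> 0} = {e}" using assms by auto
  then show ?thesis by (simp add: crossed_product_def)
qed

lemma mono_W_mult:
  "mono_W K \<sigma> n \<xi> \<otimes>\<^bsub>crossed_product K \<sigma>\<^esub> mono_W K \<sigma> m \<xi>'
     = mono_W K \<sigma> (n + m) (tensor_section \<sigma> n \<xi> \<xi>')"
proof (intro ext)
  fix d and \<omega> :: "int \<Rightarrow> complex^4"
  have "[0..<n + m] = [0..<n] @ map (\<lambda>j. j + n) [0..<m]"
    by (simp add: map_add_upt upt_add_eq_append[of 0 n m] add.commute[of m n])
  then have "map (\<lambda>j. \<omega> (int j)) [0..<n + m]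
      = map (\<lambda>j. \<omega> (int j)) [0..<n] @ map (\<lambda>j. \<omega> (int j + int n)) [0..<m]"
    by simp
  then show "(mono_W K \<sigma> n \<xi> \<otimes>\<^bsub>crossed_product K \<sigma>\<^esub> mono_W K \<sigma> m \<xi>') d \<omega>
      = mono_W K \<sigma> (n + m) (tensor_section \<sigma> n \<xi> \<xi>') d \<omega>"
    using unit_orbits_funpow[of \<omega> 0 n]
    by (subst mult_homogeneous[where e = "int n"])
       (auto simp: mono_W_def tensor_section_def shift_apply)
qed

lemma mono_Wstar_mult_mono_W:
  assumes "\<xi> \<in> sections K \<sigma> n" "\<eta> \<in> sections K \<sigma> n"
  shows "mono_Wstar K \<sigma> n \<eta> \<otimes>\<^bsub>crossed_product K \<sigma>\<^esub> mono_W K \<sigma> n \<xi>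
     = mono_W K \<sigma> 0 (fun_section K (\<lambda>p. herm \<sigma> n \<xi> \<eta> ((inv_into K \<sigma> ^^ n) p)))"
proof (intro ext)
  fix d and \<omega> :: "int \<Rightarrow> complex^4"
  have inv: "(inv_into K \<sigma> ^^ n) (line (\<omega> 0)) = line (\<omega> (- int n))" if "\<omega> \<in> unit_orbits K \<sigma>"
  proof (induction n)
    case (Suc n)
    have *: "line (\<omega> (- int n)) = \<sigma> (line (\<omega> (- int (Suc n))))" "line (\<omega> (- int (Suc n))) \<in> K"
      using that unfolding unit_orbits_def by (auto dest!: spec[of _ "- int (Suc n)"])
    then show ?case using Suc bij by (simp add: bij_betw_def)
  qed simp
  show "(mono_Wstar K \<sigma> n \<eta> \<otimes>\<^bsub>crossed_product K \<sigma>\<^esub> mono_W K \<sigma> n \<xi>) d \<omega>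
      = mono_W K \<sigma> 0 (fun_section K (\<lambda>p. herm \<sigma> n \<xi> \<eta> ((inv_into K \<sigma> ^^ n) p))) d \<omega>"
  proof (cases "\<omega> \<in> unit_orbits K \<sigma>")
    case True
    have K: "line (\<omega> 0) \<in> K" using True by (simp add: unit_orbits_def)
    have "shift (- int n) \<omega> \<in> unit_orbits K \<sigma>" using True by simp
    then show ?thesis
      using herm_unit_orbit[OF assms True, of "- int n"] K
      by (subst mult_homogeneous[where e = "- int n"])
         (auto simp: mono_W_def mono_Wstar_def fun_section_def inv True shift_apply)
  next
    case False
    then show ?thesis
      by (subst mult_homogeneous[where e = "- int n"]) (auto simp: mono_W_def mono_Wstar_def)
  qed
qed

lemma mono_W_mult_mono_Wstar:
  assumes "\<xi> \<in> sections K \<sigma> n" "\<eta> \<in> sections K \<sigma> n"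
  shows "mono_W K \<sigma> n \<xi> \<otimes>\<^bsub>crossed_product K \<sigma>\<^esub> mono_Wstar K \<sigma> n \<eta>
     = mono_W K \<sigma> 0 (fun_section K (herm \<sigma> n \<xi> \<eta>))"
proof (intro ext)
  fix d and \<omega> :: "int \<Rightarrow> complex^4"
  show "(mono_W K \<sigma> n \<xi> \<otimes>\<^bsub>crossed_product K \<sigma>\<^esub> mono_Wstar K \<sigma> n \<eta>) d \<omega>
      = mono_W K \<sigma> 0 (fun_section K (herm \<sigma> n \<xi> \<eta>)) d \<omega>"
  proof (cases "\<omega> \<in> unit_orbits K \<sigma>")
    case True
    have K: "line (\<omega> 0) \<in> K" using True by (simp add: unit_orbits_def)
    have "shift (int n) \<omega> \<in> unit_orbits K \<sigma>" using True by simp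
    then show ?thesis
      using herm_unit_orbit[OF assms True, of 0] K
      by (subst mult_homogeneous[where e = "int n"])
         (auto simp: mono_W_def mono_Wstar_def fun_section_def True shift_apply)
  next
    case False
    then show ?thesis
      by (subst mult_homogeneous[where e = "int n"]) (auto simp: mono_W_def mono_Wstar_def)
  qed
qed

lemma adj_mono_W: "adj (crossed_product K \<sigma>) (mono_W K \<sigma> n \<xi>) = mono_Wstar K \<sigma> n \<xi>"
proof (intro ext)
  fix d and \<omega> :: "int \<Rightarrow> complex^4"
  show "adj (crossed_product K \<sigma>) (mono_W K \<sigma> n \<xi>) d \<omega> = mono_Wstar K \<sigma> n \<xi> d \<omega>"
    by (cases "d = - int n") (auto simp: crossed_product_def mono_W_def mono_Wstar_def shift_apply)
qed

lemma unit_orbit_exists: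
  assumes "p \<in> K"
  shows "\<exists>\<omega>\<in>unit_orbits K \<sigma>. line (\<omega> 0) = p"
proof -
  have unit: "\<exists>z. Q z (conj_vec z) = 1 \<and> line z = q" if "q \<in> K" for q
  proof -
    from that proj obtain z where z: "z \<noteq> 0" "q = line z" by (auto simp: proj_space_def)
    define r where "r = complex_of_real (norm z)"
    have r: "r \<noteq> 0" using z by (simp add: r_def)
    have Q: "Q (inverse r *s z) (conj_vec (inverse r *s z)) = inverse r * inverse r * Q z (conj_vec z)"
      by (simp add: Q_def conj_vec_def sum_distrib_left mult_ac r_def)
    have "Q z (conj_vec z) = r * r"
      by (simp add: Q_conj r_def power2_eq_square)
    then have "Q (inverse r *s z) (conj_vec (inverse r *s z)) = 1"
      using Q r by (simp add: field_simps)
    moreover have "line (inverse r *s z) = line z"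
    proof -
      have "c *s z = (c * r) *s (inverse r *s z)" "c *s (inverse r *s z) = (c * inverse r) *s z" for c
        using r by (simp_all add: vector_smult_assoc)
      then show ?thesis unfolding line_def by (metis (no_types, lifting) image_subsetI rangeI subset_antisym)
    qed
    ultimately show ?thesis using z by metis
  qed
  define q where "q j = (if 0 \<le> j then (\<sigma> ^^ nat j) p else (inv_into K \<sigma> ^^ nat (- j)) p)" for j :: int
  have inv: "inv_into K \<sigma> x \<in> K \<and> \<sigma> (inv_into K \<sigma> x) = x" if "x \<in> K" for x
    using that bij by (auto simp: bij_betw_def inv_into_into f_inv_into_f)
  have invn: "(inv_into K \<sigma> ^^ n) p \<in> K" for n
    by (induction n) (use assms inv in auto)
  have qK: "q j \<in> K" for j
    by (simp add: q_def orbit_line assms invn)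
  have q_step: "q (j + 1) = \<sigma> (q j)" for j
  proof (cases "0 \<le> j")
    case True
    then have "nat (j + 1) = Suc (nat j)" by simp
    then show ?thesis using True by (simp add: q_def)
  next
    case False
    then have j: "nat (- j) = Suc (nat (- (j + 1)))" by simp
    have "q j = inv_into K \<sigma> ((inv_into K \<sigma> ^^ nat (- (j + 1))) p)"
      unfolding q_def j using False by simp
    moreover have "q (j + 1) = (inv_into K \<sigma> ^^ nat (- (j + 1))) p"
      using False by (cases "j = -1") (auto simp: q_def)
    ultimately show ?thesis using inv invn by simp
  qed
  obtain \<omega> where \<omega>: "\<And>j. Q (\<omega> j) (conj_vec (\<omega> j)) = 1 \<and> line (\<omega> j) = q j"
    using unit[OF qK] by metis
  then have "\<omega> \<in> unit_orbits K \<sigma>" using qK q_step by (simp add: unit_orbits_def)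
  moreover have "line (\<omega> 0) = p" using \<omega> by (simp add: q_def)
  ultimately show ?thesis by blast
qed

text \<open>The encoding of sections as functions on unit orbits is injective.\<close>

lemma mono_W_inj: "inj_on (mono_W K \<sigma> n) (sections K \<sigma> n)"
proof (rule inj_onI, intro ext)
  fix \<xi> \<xi>' p vs
  assume \<xi>: "\<xi> \<in> sections K \<sigma> n" "\<xi>' \<in> sections K \<sigma> n" and eq: "mono_W K \<sigma> n \<xi> = mono_W K \<sigma> n \<xi>'"
  show "\<xi> p vs = \<xi>' p vs"
  proof (cases "p \<in> K \<and> vs \<in> orbit_tuples \<sigma> n p")
    case False
    then show ?thesis using \<xi> by (simp add: sections_def)
  next
    case True
    then obtain \<omega> where \<omega>: "\<omega> \<in> unit_orbits K \<sigma>" "line (\<omega> 0) = p"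
      using unit_orbit_exists by blast
    define us where "us = map (\<lambda>j. \<omega> (int j)) [0..<n]"
    have us: "\<xi> p us = \<xi>' p us"
      using fun_cong[OF fun_cong[OF eq], of "int n" \<omega>] \<omega> by (simp add: mono_W_def us_def)
    have len: "length vs = n" "length us = n" using True by (auto simp: orbit_tuples_def us_def)
    have us_line: "us ! j \<in> (\<sigma> ^^ j) p" "(\<sigma> ^^ j) p = line (us ! j)" if "j < n" for j
      using unit_orbits_funpow[OF \<omega>(1), of 0 j] \<omega>(2) that line_self[of "us ! j"]
      by (simp_all add: us_def)
    have "take i vs @ drop i us \<in> orbit_tuples \<sigma> n p \<and>
        \<xi> p (take i vs @ drop i us) = \<xi>' p (take i vs @ drop i us)" if "i \<le> n" for i
      using that
    proof (induction i)
      case 0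
      then show ?case using us us_line len by (simp add: orbit_tuples_def)
    next
      case (Suc i)
      let ?m = "take i vs @ drop i us"
      have i: "i < n" using Suc.prems by simp
      have "vs ! i \<in> line (us ! i)"
        using True i us_line(2)[OF i, symmetric] by (simp add: orbit_tuples_def)
      then obtain c where c: "vs ! i = c *s us ! i" by (auto simp: line_def)
      have nth: "?m ! i = us ! i" using i len by (simp add: nth_append)
      have step: "take (Suc i) vs @ drop (Suc i) us = ?m[i := c *s ?m ! i]"
        unfolding nth c[symmetric] using i len
        by (simp add: list_update_append take_Suc_conv_app_nth Cons_nth_drop_Suc[symmetric])
      have m: "?m \<in> orbit_tuples \<sigma> n p" "\<xi> p ?m = \<xi>' p ?m" using Suc by auto
      have "\<xi> p (?m[i := c *s ?m ! i]) = c * \<xi> p ?m" "\<xi>' p (?m[i := c *s ?m ! i]) = c * \<xi>' p ?m"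
        using \<xi> True m(1) i unfolding sections_def by blast+
      then have "\<xi> p (take (Suc i) vs @ drop (Suc i) us) = \<xi>' p (take (Suc i) vs @ drop (Suc i) us)"
        unfolding step using m(2) by simp
      moreover have "take (Suc i) vs @ drop (Suc i) us \<in> orbit_tuples \<sigma> n p"
        using True us_line(1) i len by (auto simp: orbit_tuples_def nth_append)
      ultimately show ?case by simp
    qed
    from this[of n] len show ?thesis by simp
  qed
qed

end

end

theory Submission
  imports Defs
begin

text \<open>Solving the relations of the algebra for \<open>x\<^sup>0x\<^sup>k\<close> and \<open>x\<^sup>kx\<^sup>0\<close> makes them linear conditions on
  matrices \<open>t\<close>, with coefficients \<open>sin (2\<phi>\<^sub>k)\<close> and \<open>cos (\<phi>\<^sub>1 + \<phi>\<^sub>2 + \<phi>\<^sub>3 - 2\<phi>\<^sub>k)\<close>. For \<open>y\<close> on the curve, the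
  vectors \<open>z\<close> whose matrix \<open>y z\<^sup>T\<close> satisfies them form a line, spanned locally by quadratic
  polynomials in \<open>y\<close>; moreover \<open>y\<close> and \<open>z\<close> are orthogonal for \<open>Q\<close>. Hence \<open>\<sigma>\<close> has local smooth lifts, and
  so has its inverse, since the relations for \<open>- \<phi>\<close> are the transposed ones. Therefore products
  and adjoints of smooth sections are smooth and the crossed product is a \<open>*\<close>-algebra.

  The images of the relations vanish in degrees 2 and -2 because consecutive points of an orbit
  are related by \<open>\<sigma>\<close>. In degree 0 they vanish because the Jordan product of two traceless solutions of the
  linear conditions satisfies the transposed conditions; this is applied to \<open>y z\<^sup>T\<close> and its
  conjugate transpose, for unit vectors \<open>y\<close> and \<open>z\<close> on consecutive lines.\<close>

section \<open>Smooth functions\<close>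

text \<open>The carrier of the crossed product consists of finite sums of monomials, and its closure
  under mixed products is not visible from that. It is therefore described intrinsically by
  functions on unit orbits: divided by suitable products of linear forms, a component must be a
  smooth function of the base line alone. A component of degree d involves |d| consecutive lines,
  after or before the base, so smooth lifts are needed in both directions. In degree 0 the products
  of the generators form half the matrix z z^* + conj(y) y^T, with y and z the unit vectors at the
  places -1 and 0. For t = y z^T one has t t^* = y y^* and t^* t = conj(z) z^T, so this is half the
  transpose of t t^* + t^* t: hence the Jordan product and the transposed conditions. The trace of t
  is Q(y, z) = 0, which also settles the sphere relator in degrees 2 and -2; in degree 0 the factor
  sqrt 2 makes each unit vector contribute 1/2. Genericity keeps the sines from vanishing but not
  every single cosine; this causes the case distinctions about the curve.\<close>

lemma C_k_on_differentiable:
  assumes "open U" "C_k_on (Suc k) U f" "x \<in> U"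
  shows "f differentiable at x"
proof -
  have "f differentiable_on U" using assms(2) by simp
  then show ?thesis
    using iffD1[OF differentiable_on_eq_differentiable_at[OF assms(1)]] assms(3) by blast
qed

lemma C_k_on_SucD:
  assumes "open U" "C_k_on (Suc k) U f" "x \<in> U"
  shows "(f has_derivative frechet_derivative f (at x)) (at x)"
  by (rule iffD1[OF frechet_derivative_works C_k_on_differentiable[OF assms]])

text \<open>\<open>frechet_derivative\<close> at a point of the open set \<open>U\<close> sees
  \<open>f\<close> only near that point, so the agreement passes to all derivatives.\<close>

lemma C_k_on_cong:
  assumes "open U" "\<And>x. x \<in> U \<Longrightarrow> f x = g x" "C_k_on k U f"
  shows "C_k_on k U g"
  using assms(2,3)
proof (induction k arbitrary: f g)
  case 0
  then show ?case by (simp cong: continuous_on_cong_simp)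
next
  case (Suc k)
  have f: "f differentiable at x" if "x \<in> U" for x
    by (rule C_k_on_differentiable[OF assms(1) Suc.prems(2) that])
  have "frechet_derivative f (at x) = frechet_derivative g (at x)" if "x \<in> U" for x
    by (rule frechet_derivative_transform_within_open[OF f[OF that] assms(1) that Suc.prems(1)])
  then have "C_k_on k U (\<lambda>x. frechet_derivative g (at x) v)" for v
    using Suc.prems(2) by (auto intro: Suc.IH[where f = "\<lambda>x. frechet_derivative f (at x) v"])
  moreover have "(g has_derivative frechet_derivative f (at x)) (at x)" if "x \<in> U" for x
    by (rule has_derivative_transform_within_open[OF
          iffD1[OF frechet_derivative_works f[OF that]] assms(1) that Suc.prems(1)])
  then have "g differentiable_on U"
    unfolding differentiable_on_eq_differentiable_at[OF assms(1)]
    by (auto intro: differentiableI)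
  ultimately show ?case by simp
qed

text \<open>Lets the rules of calculus supply the derivative \<open>f'\<close> in closed form: by
  uniqueness it is \<open>frechet_derivative\<close> on \<open>U\<close>, so regularity need only be
  checked for the formula.\<close>

lemma C_k_on_SucI:
  assumes "open U" "\<And>x. x \<in> U \<Longrightarrow> (f has_derivative f' x) (at x)"
    "\<And>v. C_k_on k U (\<lambda>x. f' x v)"
  shows "C_k_on (Suc k) U f"
proof -
  have "frechet_derivative f (at x) = f' x" if "x \<in> U" for x
    using frechet_derivative_at[OF assms(2)[OF that]] by simp
  then have "C_k_on k U (\<lambda>x. frechet_derivative f (at x) v)" for v
    using C_k_on_cong[OF assms(1) _ assms(3)[of v]] by simp
  moreover have "f differentiable_on U"
    unfolding differentiable_on_eq_differentiable_at[OF assms(1)]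
    by (intro ballI) (rule differentiableI[OF assms(2)])
  ultimately show ?thesis by simp
qed

lemma C_k_on_mono: "C_k_on (Suc k) U f \<Longrightarrow> C_k_on k U f"
proof (induction k arbitrary: f)
  case 0
  then show ?case by (simp add: differentiable_imp_continuous_on)
next
  case (Suc k)
  have "C_k_on k U (\<lambda>x. frechet_derivative f (at x) v)" for v
    by (rule Suc.IH) (use Suc.prems in \<open>subst (asm) C_k_on.simps(2), blast\<close>)
  then show ?case using Suc.prems by simp
qed

lemma C_k_on_subset:
  assumes "open U" "open V" "V \<subseteq> U"
  shows "C_k_on k U f \<Longrightarrow> C_k_on k V f"
proof (induction k arbitrary: f)
  case 0
  then show ?case using assms(3) by (simp add: continuous_on_subset)
next
  case (Suc k)
  have "C_k_on k V (\<lambda>x. frechet_derivative f (at x) v)" for v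
    by (rule Suc.IH) (use Suc.prems in simp)
  then show ?case
    using Suc.prems differentiable_on_subset[OF _ assms(3), of f] by simp
qed

lemma C_k_on_const:
  assumes "open U"
  shows "C_k_on k U (\<lambda>x. c)"
proof (induction k arbitrary: c)
  case (Suc k)
  show ?case
    by (rule C_k_on_SucI[OF assms has_derivative_const Suc.IH])
qed simp

lemma C_k_on_add:
  assumes "open U"
  shows "C_k_on k U f \<Longrightarrow> C_k_on k U g \<Longrightarrow> C_k_on k U (\<lambda>x. f x + g x)"
proof (induction k arbitrary: f g)
  case 0
  then show ?case by (auto intro: continuous_intros)
next
  case (Suc k)
  show ?case
    by (rule C_k_on_SucI[OF assms has_derivative_add[OF C_k_on_SucD C_k_on_SucD]])
       (use Suc assms in auto)
qed

lemma C_k_on_mult: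
  assumes "open U"
  shows "C_k_on k U f \<Longrightarrow> C_k_on k U g \<Longrightarrow> C_k_on k U (\<lambda>x. f x * g x)"
proof (induction k arbitrary: f g)
  case 0
  then show ?case by (auto intro: continuous_intros)
next
  case (Suc k)
  note f = C_k_on_SucD[OF assms Suc.prems(1)] and g = C_k_on_SucD[OF assms Suc.prems(2)]
  show ?case
    by (rule C_k_on_SucI[OF assms has_derivative_mult[OF f g]])
       (use Suc.prems in \<open>auto intro!: assms C_k_on_add Suc.IH C_k_on_mono[OF Suc.prems(1)]
          C_k_on_mono[OF Suc.prems(2)]\<close>)
qed

lemma C_k_on_bounded_linear:
  assumes "open U" "bounded_linear h"
  shows "C_k_on k U f \<Longrightarrow> C_k_on k U (\<lambda>x. h (f x))"
proof (induction k arbitrary: f)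
  case 0
  then show ?case using bounded_linear.continuous_on[OF assms(2)] by simp
next
  case (Suc k)
  note f = C_k_on_SucD[OF assms(1) Suc.prems]
  show ?case
    by (rule C_k_on_SucI[OF assms(1) bounded_linear.has_derivative[OF assms(2) f]])
       (use Suc in auto)
qed

text \<open>The derivative of 1/f is built from the derivative of f and from 1/f itself, and the
  induction hypothesis covers the latter; hence \<open>f\<close> stays fixed in the
  induction.\<close>

lemma C_k_on_inverse:
  assumes "open U" "\<And>x. x \<in> U \<Longrightarrow> f x \<noteq> 0"
  shows "C_k_on k U f \<Longrightarrow> C_k_on k U (\<lambda>x. inverse (f x))"
proof (induction k)
  case 0
  then show ?case using assms by (auto intro: continuous_intros)
next
  case (Suc k)
  note f = C_k_on_SucD[OF assms(1) Suc.prems]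
  show ?case
    by (rule C_k_on_SucI[OF assms(1) Deriv.has_derivative_inverse[OF assms(2) f]])
       (use Suc.prems in \<open>auto intro!: assms C_k_on_mult Suc.IH C_k_on_mono[OF Suc.prems]
          C_k_on_bounded_linear[where h = uminus] bounded_linear_minus bounded_linear_ident\<close>)
qed

lemma C_k_on_sum:
  assumes "open U" "\<And>i. i \<in> I \<Longrightarrow> C_k_on k U (f i)"
  shows "C_k_on k U (\<lambda>x. \<Sum>i\<in>I. f i x)"
  using assms(2)
  by (induction I rule: infinite_finite_induct)
     (auto intro: C_k_on_const C_k_on_add assms(1))

text \<open>Derivatives are only real linear here, so every complex coordinate is split into the
  real directions \<open>axis \<mu> 1\<close> and \<open>axis \<mu> \<i>\<close>. The chain rule
  below expands in this basis.\<close>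

lemma vec_nth_complex_decompose:
  "(v :: complex^4) = (\<Sum>\<mu>\<in>UNIV. Re (v $ \<mu>) *\<^sub>R axis \<mu> 1 + Im (v $ \<mu>) *\<^sub>R axis \<mu> \<i>)"
proof -
  have "Re (v $ \<mu>) *\<^sub>R axis \<mu> 1 + Im (v $ \<mu>) *\<^sub>R axis \<mu> \<i> = axis \<mu> (v $ \<mu>)" for \<mu>
    by (auto simp: vec_eq_iff axis_def intro!: complex_eqI)
  then have "(\<Sum>\<mu>\<in>UNIV. Re (v $ \<mu>) *\<^sub>R axis \<mu> 1 + Im (v $ \<mu>) *\<^sub>R axis \<mu> \<i>)
      = (\<Sum>\<mu>\<in>UNIV. axis \<mu> (v $ \<mu>))"
    by (intro sum.cong refl)
  then show ?thesis by (simp add: vec_eq_iff axis_def)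
qed

lemma has_derivative_vec:
  assumes "\<And>\<mu>. ((\<lambda>x. s x $ \<mu>) has_derivative s' \<mu>) F"
  shows "((s :: complex^4 \<Rightarrow> complex^4) has_derivative (\<lambda>v. \<chi> \<mu>. s' \<mu> v)) F"
proof -
  have "bounded_linear (axis \<mu> :: complex \<Rightarrow> complex^4)" for \<mu> :: 4
    by (intro iffD1[OF linear_conv_bounded_linear] linearI) (simp_all add: vec_eq_iff axis_def)
  then have "((\<lambda>x. \<Sum>\<mu>\<in>UNIV. axis \<mu> (s x $ \<mu>)) has_derivative (\<lambda>v. \<Sum>\<mu>\<in>UNIV. axis \<mu> (s' \<mu> v))) F"
    by (auto intro!: has_derivative_sum bounded_linear.has_derivative[OF _ assms])
  moreover have "(\<Sum>\<mu>\<in>UNIV. axis \<mu> (f \<mu>)) = (\<chi> \<mu>. f \<mu>)" for f :: "4 \<Rightarrow> complex"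
    by (simp add: vec_eq_iff axis_def)
  ultimately show ?thesis by simp
qed

text \<open>In the chain rule the direction in which \<open>g\<close> is differentiated moves with
  x, while the induction hypothesis concerns fixed directions. Expanding the direction in the real
  basis leaves derivatives of \<open>g\<close> in fixed directions times smooth coordinates.\<close>

lemma C_k_on_compose:
  assumes "open U" "open V" "\<And>x. x \<in> U \<Longrightarrow> s x \<in> V"
    and s: "\<And>k \<mu>. C_k_on k U (\<lambda>x. s x $ \<mu>)"
  shows "C_k_on k V g \<Longrightarrow> C_k_on k U (\<lambda>x. g (s x))"
proof (induction k arbitrary: g)
  case 0
  have "continuous_on U s"
    using continuous_on_vec_lambda[of U "\<lambda>\<mu> x. s x $ \<mu>"] s[of 0] by simp
  then show ?case using 0 assms(3) by (auto intro!: continuous_on_compose2[of V g])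
next
  case (Suc k)
  define s' where "s' x v = (\<chi> \<mu>. frechet_derivative (\<lambda>x. s x $ \<mu>) (at x) v)" for x v
  have s': "(s has_derivative s' x) (at x)" if "x \<in> U" for x
    using C_k_on_SucD[OF assms(1) s that] unfolding s'_def
    by (rule has_derivative_vec)
  let ?D = "\<lambda>x. frechet_derivative g (at x)"
  show ?case
  proof (rule C_k_on_SucI[OF assms(1), where f' = "\<lambda>x v. ?D (s x) (s' x v)"])
    fix x assume x: "x \<in> U"
    show "((\<lambda>x. g (s x)) has_derivative (\<lambda>v. ?D (s x) (s' x v))) (at x)"
      using diff_chain_at[OF s'[OF x] C_k_on_SucD[OF assms(2) Suc.prems assms(3)[OF x]]]
      by (simp add: o_def)
  next
    fix v
    have D: "C_k_on k U (\<lambda>x. ?D (s x) w)" for w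
      by (rule Suc.IH) (use Suc.prems in simp)
    have s'C: "C_k_on k U (\<lambda>x. s' x v $ \<mu>)" for \<mu>
      using s[of "Suc k"] by (simp add: s'_def)
    have "C_k_on k U (\<lambda>x. \<Sum>\<mu>\<in>UNIV. of_real (Re (s' x v $ \<mu>)) * ?D (s x) (axis \<mu> 1)
        + of_real (Im (s' x v $ \<mu>)) * ?D (s x) (axis \<mu> \<i>))"
      by (intro C_k_on_sum C_k_on_add C_k_on_mult assms(1) D C_k_on_bounded_linear[OF _ _ s'C,
            where h = "\<lambda>x. of_real (Re x)"] C_k_on_bounded_linear[OF _ _ s'C,
            where h = "\<lambda>x. of_real (Im x)"] bounded_linear_compose[OF bounded_linear_of_real]
            bounded_linear_Re bounded_linear_Im)
    then show "C_k_on k U (\<lambda>x. ?D (s x) (s' x v))"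
    proof (rule C_k_on_cong[OF assms(1), rotated])
      fix x assume x: "x \<in> U"
      interpret bounded_linear "?D (s x)"
        using C_k_on_SucD[OF assms(2) Suc.prems assms(3)[OF x]] by (rule has_derivative_bounded_linear)
      show "(\<Sum>\<mu>\<in>UNIV. of_real (Re (s' x v $ \<mu>)) * ?D (s x) (axis \<mu> 1)
        + of_real (Im (s' x v $ \<mu>)) * ?D (s x) (axis \<mu> \<i>)) = ?D (s x) (s' x v)"
        by (subst (3) vec_nth_complex_decompose[of "s' x v"])
           (simp add: sum add scaleR flip: scaleR_conv_of_real)
    qed
  qed
qed

section \<open>Closure properties of smooth functions\<close>

lemma smooth_on_subset: "open U \<Longrightarrow> open V \<Longrightarrow> V \<subseteq> U \<Longrightarrow> smooth_on U f \<Longrightarrow> smooth_on V f"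
  unfolding smooth_on_def using C_k_on_subset by blast

lemma smooth_on_const: "open U \<Longrightarrow> smooth_on U (\<lambda>x. c)"
  unfolding smooth_on_def using C_k_on_const by blast

lemma smooth_on_add: "open U \<Longrightarrow> smooth_on U f \<Longrightarrow> smooth_on U g \<Longrightarrow> smooth_on U (\<lambda>x. f x + g x)"
  unfolding smooth_on_def using C_k_on_add by blast

lemma smooth_on_mult: "open U \<Longrightarrow> smooth_on U f \<Longrightarrow> smooth_on U g \<Longrightarrow> smooth_on U (\<lambda>x. f x * g x)"
  unfolding smooth_on_def using C_k_on_mult by blast

lemma smooth_on_bounded_linear:
  "open U \<Longrightarrow> bounded_linear h \<Longrightarrow> smooth_on U f \<Longrightarrow> smooth_on U (\<lambda>x. h (f x))"
  unfolding smooth_on_def using C_k_on_bounded_linear by blast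

lemma smooth_on_cnj: "open U \<Longrightarrow> smooth_on U f \<Longrightarrow> smooth_on U (\<lambda>x. cnj (f x))"
  by (rule smooth_on_bounded_linear[OF _ bounded_linear_cnj])

lemma smooth_on_minus: "open U \<Longrightarrow> smooth_on U f \<Longrightarrow> smooth_on U (\<lambda>x. - f x)"
  by (rule smooth_on_bounded_linear[OF _ bounded_linear_minus[OF bounded_linear_ident]])

lemma smooth_on_diff: "open U \<Longrightarrow> smooth_on U f \<Longrightarrow> smooth_on U g \<Longrightarrow> smooth_on U (\<lambda>x. f x - g x)"
  using smooth_on_add[of U f "\<lambda>x. - g x"] smooth_on_minus[of U g] by simp

lemma smooth_on_divide:
  "open U \<Longrightarrow> smooth_on U f \<Longrightarrow> smooth_on U g \<Longrightarrow> (\<And>x. x \<in> U \<Longrightarrow> g x \<noteq> 0)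
    \<Longrightarrow> smooth_on U (\<lambda>x. f x / g x)"
  unfolding divide_inverse smooth_on_def by (simp add: C_k_on_mult C_k_on_inverse)

lemma smooth_on_sum:
  "open U \<Longrightarrow> (\<And>i. i \<in> I \<Longrightarrow> smooth_on U (f i)) \<Longrightarrow> smooth_on U (\<lambda>x. \<Sum>i\<in>I. f i x)"
  unfolding smooth_on_def by (simp add: C_k_on_sum)

lemma smooth_on_nth: "open U \<Longrightarrow> smooth_on U (\<lambda>x. x $ \<mu>)"
proof -
  assume U: "open U"
  have "C_k_on k U (\<lambda>x. x $ \<mu>)" for k
  proof (cases k)
    case 0
    then show ?thesis by (auto intro!: continuous_intros)
  next
    case (Suc k')
    show ?thesis unfolding Suc
      by (rule C_k_on_SucI[OF U bounded_linear_imp_has_derivative[OF bounded_linear_vec_nth]])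
         (rule C_k_on_const[OF U])
  qed
  then show ?thesis unfolding smooth_on_def by blast
qed

lemma smooth_on_compose:
  assumes "open U" "open V" "smooth_on V g" "\<And>x. x \<in> U \<Longrightarrow> s x \<in> V"
    "\<And>\<mu>. smooth_on U (\<lambda>x. s x $ \<mu>)"
  shows "smooth_on U (\<lambda>x. g (s x))"
  unfolding smooth_on_def
proof
  fix k
  show "C_k_on k U (\<lambda>x. g (s x))"
    by (rule C_k_on_compose[OF assms(1,2)]) (use assms(3-5) in \<open>auto simp: smooth_on_def\<close>)
qed

lemma smooth_on_continuous: "smooth_on U f \<Longrightarrow> continuous_on U f"
  unfolding smooth_on_def by (metis C_k_on.simps(1))

section \<open>The relations\<close>

lemma exhaust_4_from_0: "(\<mu> :: 4) = 0 \<or> \<mu> = 1 \<or> \<mu> = 2 \<or> \<mu> = 3"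
  using exhaust_4[of \<mu>] by auto

lemma sum_UNIV_4: "(\<Sum>\<mu>\<in>(UNIV :: 4 set). f \<mu>) = f 0 + f 1 + f 2 + (f 3 :: 'a :: comm_monoid_add)"
proof -
  have "(UNIV :: 4 set) = {0, 1, 2, 3}"
    using exhaust_4_from_0 by blast
  then have "sum f UNIV = sum f {0, 1, 2, 3}" by simp
  then show ?thesis by (simp add: add_ac)
qed

section \<open>The trigonometric coefficients and the solved relations\<close>

definition cyc :: "(4 \<times> 4 \<times> 4) set" where
  "cyc = {(1, 2, 3), (2, 3, 1), (3, 1, 2)}"

definition S_coef :: "(4 \<Rightarrow> real) \<Rightarrow> 4 \<Rightarrow> complex" where
  "S_coef \<phi> \<mu> = of_real (sin (2 * \<phi> \<mu>))"

text \<open>For a cyclic triple (k, l, m) the value at l is cos (\<phi> k - (\<phi> l - \<phi> m)),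
  the form in which it comes out of the relations. The value at 0 completes these to the
  coefficients of one quadric through the curve; see \<open>on_curve_C\<close>.\<close>

definition C_coef :: "(4 \<Rightarrow> real) \<Rightarrow> 4 \<Rightarrow> complex" where
  "C_coef \<phi> \<mu> = of_real (cos (\<phi> 1 + \<phi> 2 + \<phi> 3 - 2 * \<phi> \<mu>))"

text \<open>The coefficients of the combination of the two equations of the curve from which the
  coordinate \<nu> is eliminated; see \<open>on_curve_D\<close>.\<close>

definition D_coef :: "(4 \<Rightarrow> real) \<Rightarrow> 4 \<Rightarrow> 4 \<Rightarrow> complex" where
  "D_coef \<phi> \<mu> \<nu> = of_real (sin (2 * \<phi> \<mu> - 2 * \<phi> \<nu>))"

lemma cyc_rotate: "(k, l, m) \<in> cyc \<Longrightarrow> (l, m, k) \<in> cyc"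
  by (auto simp: cyc_def)

lemma cyc_distinct: "(k, l, m) \<in> cyc \<Longrightarrow> distinct [0, k, l, m]"
  by (auto simp: cyc_def)

lemma cyc_sum:
  "(k, l, m) \<in> cyc \<Longrightarrow> (\<Sum>\<mu>\<in>UNIV. f \<mu>) = f 0 + f k + f l + (f m :: 'a :: comm_monoid_add)"
  by (auto simp: cyc_def sum_UNIV_4 add_ac)

text \<open>In the variables x, y, z below the doubled angles are the sums y + z, x + z, x + y, and
  the cosines are those of x, y, z and x + y + z. All three identities are then consequences of the
  addition theorems.\<close>

lemma coef_identities:
  assumes "(k, l, m) \<in> cyc" "\<phi> 0 = 0"
  shows S_mult_S: "S_coef \<phi> k * S_coef \<phi> l = C_coef \<phi> k * C_coef \<phi> l - C_coef \<phi> 0 * C_coef \<phi> m"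
    and C_mult_D: "C_coef \<phi> k * D_coef \<phi> l m = C_coef \<phi> l * S_coef \<phi> l - C_coef \<phi> m * S_coef \<phi> m"
    and C_square_diff: "(C_coef \<phi> l)\<^sup>2 - (C_coef \<phi> m)\<^sup>2 = D_coef \<phi> l m * S_coef \<phi> k"
proof -
  define x y z where "x = \<phi> l + \<phi> m - \<phi> k" and "y = \<phi> k + \<phi> m - \<phi> l" and "z = \<phi> k + \<phi> l - \<phi> m"
  have s: "\<phi> 1 + \<phi> 2 + \<phi> 3 = \<phi> k + \<phi> l + \<phi> m"
    using assms(1) by (auto simp: cyc_def)
  have S: "S_coef \<phi> k = of_real (sin (y + z))" "S_coef \<phi> l = of_real (sin (x + z))"
    "S_coef \<phi> m = of_real (sin (x + y))"
    by (simp_all add: S_coef_def x_def y_def z_def algebra_simps)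
  have C: "C_coef \<phi> k = of_real (cos x)" "C_coef \<phi> l = of_real (cos y)"
    "C_coef \<phi> m = of_real (cos z)" "C_coef \<phi> 0 = of_real (cos (x + y + z))"
    unfolding C_coef_def s by (simp_all add: assms(2) x_def y_def z_def algebra_simps)
  have D: "D_coef \<phi> l m = of_real (sin (z - y))"
    by (simp add: D_coef_def y_def z_def algebra_simps)
  have "sin (y + z) * sin (x + z) = (sin z)\<^sup>2 * (cos x * cos y) + sin x * sin y * (cos z)\<^sup>2
      + cos x * cos z * sin y * sin z + sin x * cos y * sin z * cos z"
    unfolding sin_add by (simp add: algebra_simps power2_eq_square)
  also have "\<dots> = cos x * cos y - cos (x + y + z) * cos z"
    unfolding cos_add sin_add sin_squared_eq by (simp add: algebra_simps power2_eq_square)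
  finally have "sin (y + z) * sin (x + z) = cos x * cos y - cos (x + y + z) * cos z" .
  then show "S_coef \<phi> k * S_coef \<phi> l = C_coef \<phi> k * C_coef \<phi> l - C_coef \<phi> 0 * C_coef \<phi> m"
    unfolding S C by (metis of_real_diff of_real_mult)
  have "cos x * sin (z - y) = cos y * sin (x + z) - cos z * sin (x + y)"
    unfolding sin_diff sin_add by (simp add: algebra_simps)
  then show "C_coef \<phi> k * D_coef \<phi> l m = C_coef \<phi> l * S_coef \<phi> l - C_coef \<phi> m * S_coef \<phi> m"
    unfolding S C D by (metis of_real_diff of_real_mult)
  have "sin (z - y) * sin (y + z) = (sin z)\<^sup>2 * (cos y)\<^sup>2 - (cos z)\<^sup>2 * (sin y)\<^sup>2"
    unfolding sin_diff sin_add by (simp add: algebra_simps power2_eq_square)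
  also have "\<dots> = (cos y)\<^sup>2 - (cos z)\<^sup>2"
    unfolding sin_squared_eq by (simp add: algebra_simps)
  finally have "(cos y)\<^sup>2 - (cos z)\<^sup>2 = sin (z - y) * sin (y + z)" ..
  then show "(C_coef \<phi> l)\<^sup>2 - (C_coef \<phi> m)\<^sup>2 = D_coef \<phi> l m * S_coef \<phi> k"
    unfolding S C D by (metis of_real_diff of_real_mult of_real_power)
qed

text \<open>With \<open>\<phi> 0 = 0\<close> the two conditions of genericity become one: no
  difference of two of the four angles is an integer multiple of pi / 2.\<close>

lemma generic_D_nonzero:
  assumes "generic \<phi>" "\<phi> 0 = 0" "\<mu> \<noteq> \<nu>"
  shows "D_coef \<phi> \<mu> \<nu> \<noteq> 0"
proof -
  have *: "sin (2 * x) \<noteq> 0" if "\<And>n::int. x \<noteq> of_int n * (pi / 2)" for x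
  proof
    assume "sin (2 * x) = 0"
    then obtain n :: int where "2 * x = of_int n * pi"
      using sin_zero_iff_int2 by blast
    then have "x = of_int n * (pi / 2)" by simp
    with that show False by blast
  qed
  have mem: "\<mu> = 0 \<or> \<mu> \<in> {1, 2, 3}" for \<mu> :: 4
    using exhaust_4_from_0[of \<mu>] by auto
  have "\<phi> \<mu> - \<phi> \<nu> \<noteq> of_int n * (pi / 2)" for n :: int
  proof (cases "\<mu> = 0")
    case True
    then have "\<phi> \<nu> \<noteq> of_int (- n) * (pi / 2)"
      using assms mem[of \<nu>] unfolding generic_def by metis
    then show ?thesis using True assms(2) by auto
  next
    case False
    then show ?thesis
      using assms mem[of \<mu>] mem[of \<nu>] unfolding generic_def by (metis diff_zero)
  qed
  then have "sin (2 * (\<phi> \<mu> - \<phi> \<nu>)) \<noteq> 0" by (rule *)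
  then show ?thesis by (simp add: D_coef_def algebra_simps)
qed

lemma S_eq_D: "\<phi> 0 = 0 \<Longrightarrow> S_coef \<phi> \<mu> = D_coef \<phi> \<mu> 0"
  by (simp add: S_coef_def D_coef_def)

lemma generic_S_nonzero: "generic \<phi> \<Longrightarrow> \<phi> 0 = 0 \<Longrightarrow> \<mu> \<noteq> 0 \<Longrightarrow> S_coef \<phi> \<mu> \<noteq> 0"
  by (simp add: S_eq_D generic_D_nonzero)

text \<open>A single cosine may vanish for generic angles. The difference of the squares of two of
  them is a product of nonzero sines, so they do not vanish together.\<close>

lemma generic_C_nonzero:
  assumes "generic \<phi>" "\<phi> 0 = 0" "(k, l, m) \<in> cyc"
  shows "C_coef \<phi> l \<noteq> 0 \<or> C_coef \<phi> m \<noteq> 0"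
proof -
  have "l \<noteq> m" "k \<noteq> 0" using cyc_distinct[OF assms(3)] by auto
  then have "D_coef \<phi> l m * S_coef \<phi> k \<noteq> 0"
    using assms generic_D_nonzero generic_S_nonzero by simp
  then show ?thesis
    using C_square_diff[of k l m \<phi>, OF assms(3,2)] by auto
qed

text \<open>The matrices annihilated by the relations of the algebra: solving the two relations for
  \<open>x\<^sup>0x\<^sup>k\<close> and \<open>x\<^sup>kx\<^sup>0\<close> leaves the coefficients below.\<close>

definition annihilated :: "(4 \<Rightarrow> real) \<Rightarrow> (4 \<Rightarrow> 4 \<Rightarrow> complex) \<Rightarrow> bool" where
  "annihilated \<phi> t \<longleftrightarrow> (\<forall>(k, l, m)\<in>cyc.
     S_coef \<phi> k * t 0 k = \<i> * (C_coef \<phi> l * t l m - C_coef \<phi> m * t m l) \<and>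
     S_coef \<phi> k * t k 0 = \<i> * (C_coef \<phi> m * t l m - C_coef \<phi> l * t m l))"

lemma annihilatedD:
  assumes "annihilated \<phi> t" "(k, l, m) \<in> cyc"
  shows "S_coef \<phi> k * t 0 k = \<i> * (C_coef \<phi> l * t l m - C_coef \<phi> m * t m l)"
    "S_coef \<phi> k * t k 0 = \<i> * (C_coef \<phi> m * t l m - C_coef \<phi> l * t m l)"
  using assms unfolding annihilated_def by auto

lemma annihilatedI:
  assumes "\<And>k l m. (k, l, m) \<in> cyc \<Longrightarrow>
     S_coef \<phi> k * t 0 k = \<i> * (C_coef \<phi> l * t l m - C_coef \<phi> m * t m l) \<and>
     S_coef \<phi> k * t k 0 = \<i> * (C_coef \<phi> m * t l m - C_coef \<phi> l * t m l)"
  shows "annihilated \<phi> t"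
  using assms unfolding annihilated_def by auto

text \<open>Twice \<open>cos (\<phi> k)\<close> times the first relation is the sum of the two
  solved equations, and twice \<open>sin (\<phi> k)\<close> times the second is their difference.
  Recovering the relations divides by both, which is possible since \<open>S_coef \<phi> k\<close>
  is twice their product.\<close>

lemma annihilated_iff_relations:
  assumes "generic \<phi>" "\<phi> 0 = 0"
  shows "annihilated \<phi> t \<longleftrightarrow> (\<forall>(k, l, m)\<in>cyc.
     of_real (sin (\<phi> k)) * (t 0 k + t k 0) = \<i> * of_real (cos (\<phi> l - \<phi> m)) * (t l m - t m l) \<and>
     of_real (cos (\<phi> k)) * (t 0 k - t k 0) = \<i> * of_real (sin (\<phi> l - \<phi> m)) * (t l m + t m l))"
    (is "_ \<longleftrightarrow> (\<forall>(k, l, m)\<in>cyc. ?R k l m)")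
proof -
  have "(S_coef \<phi> k * t 0 k = \<i> * (C_coef \<phi> l * t l m - C_coef \<phi> m * t m l) \<and>
     S_coef \<phi> k * t k 0 = \<i> * (C_coef \<phi> m * t l m - C_coef \<phi> l * t m l)) \<longleftrightarrow> ?R k l m"
    if cyc: "(k, l, m) \<in> cyc" for k l m
  proof -
    define s c s' c' :: complex where "s = of_real (sin (\<phi> k))" and "c = of_real (cos (\<phi> k))"
      and "s' = of_real (sin (\<phi> l - \<phi> m))" and "c' = of_real (cos (\<phi> l - \<phi> m))"
    have sum: "\<phi> 1 + \<phi> 2 + \<phi> 3 - 2 * \<phi> l = \<phi> k - (\<phi> l - \<phi> m)"
      "\<phi> 1 + \<phi> 2 + \<phi> 3 - 2 * \<phi> m = \<phi> k + (\<phi> l - \<phi> m)"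
      using cyc by (auto simp: cyc_def)
    have S: "S_coef \<phi> k = 2 * s * c"
      by (simp add: S_coef_def s_def c_def sin_double)
    have C: "C_coef \<phi> l = c * c' + s * s'" "C_coef \<phi> m = c * c' - s * s'"
      unfolding C_coef_def sum cos_add[of "\<phi> k"] cos_diff[of "\<phi> k"] by (simp_all add: s_def c_def s'_def c'_def)
    have "k \<noteq> 0" using cyc_distinct[OF cyc] by auto
    then have nz: "s \<noteq> 0" "c \<noteq> 0"
      using generic_S_nonzero[OF assms] S by auto
    show ?thesis (is "?A \<longleftrightarrow> ?B")
    proof
      assume A: ?A
      have "2 * (c * (s * (t 0 k + t k 0) - \<i> * c' * (t l m - t m l)))
          = (S_coef \<phi> k * t 0 k - \<i> * (C_coef \<phi> l * t l m - C_coef \<phi> m * t m l))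
          + (S_coef \<phi> k * t k 0 - \<i> * (C_coef \<phi> m * t l m - C_coef \<phi> l * t m l))"
        unfolding S C by (simp add: algebra_simps)
      then have "c * (s * (t 0 k + t k 0) - \<i> * c' * (t l m - t m l)) = 0"
        using A by simp
      moreover have "2 * (s * (c * (t 0 k - t k 0) - \<i> * s' * (t l m + t m l)))
          = (S_coef \<phi> k * t 0 k - \<i> * (C_coef \<phi> l * t l m - C_coef \<phi> m * t m l))
          - (S_coef \<phi> k * t k 0 - \<i> * (C_coef \<phi> m * t l m - C_coef \<phi> l * t m l))"
        unfolding S C by (simp add: algebra_simps)
      then have "s * (c * (t 0 k - t k 0) - \<i> * s' * (t l m + t m l)) = 0"
        using A by simp
      ultimately show ?B
        using nz unfolding s_def[symmetric] c_def[symmetric] s'_def[symmetric] c'_def[symmetric]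
        by simp
    next
      assume ?B
      then have "s * (t 0 k + t k 0) = \<i> * c' * (t l m - t m l)"
        "c * (t 0 k - t k 0) = \<i> * s' * (t l m + t m l)"
        unfolding s_def c_def s'_def c'_def by auto
      then have B: "s * (t 0 k + t k 0) - \<i> * c' * (t l m - t m l) = 0"
        "c * (t 0 k - t k 0) - \<i> * s' * (t l m + t m l) = 0" by simp_all
      have "S_coef \<phi> k * t 0 k - \<i> * (C_coef \<phi> l * t l m - C_coef \<phi> m * t m l)
          = c * (s * (t 0 k + t k 0) - \<i> * c' * (t l m - t m l))
          + s * (c * (t 0 k - t k 0) - \<i> * s' * (t l m + t m l))"
        "S_coef \<phi> k * t k 0 - \<i> * (C_coef \<phi> m * t l m - C_coef \<phi> l * t m l)
          = c * (s * (t 0 k + t k 0) - \<i> * c' * (t l m - t m l))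
          - s * (c * (t 0 k - t k 0) - \<i> * s' * (t l m + t m l))"
        unfolding S C by (simp_all add: algebra_simps)
      then show ?A unfolding B by simp
    qed
  qed
  then show ?thesis unfolding annihilated_def by fast
qed

text \<open>In a Jordan product, the \<open>k\<close>-th and the \<open>l\<close>-th off-diagonal block contribute to the
  \<open>m\<close>-th one.\<close>

lemma jordan_block:
  fixes a b c d p q r s :: complex
  assumes cyc: "(k, l, m) \<in> cyc" and "generic \<phi>" "\<phi> 0 = 0"
    and p: "S_coef \<phi> k * p = \<i> * (C_coef \<phi> l * a - C_coef \<phi> m * b)"
    and q: "S_coef \<phi> k * q = \<i> * (C_coef \<phi> m * a - C_coef \<phi> l * b)"
    and r: "S_coef \<phi> l * r = \<i> * (C_coef \<phi> m * c - C_coef \<phi> k * d)"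
    and s: "S_coef \<phi> l * s = \<i> * (C_coef \<phi> k * c - C_coef \<phi> m * d)"
  shows "S_coef \<phi> m * (b * s + c * q)
      = \<i> * (C_coef \<phi> k * (a * c + s * p) - C_coef \<phi> l * (q * r + d * b))"
    and "S_coef \<phi> m * (p * d + r * a)
      = \<i> * (C_coef \<phi> l * (a * c + s * p) - C_coef \<phi> k * (q * r + d * b))"
proof -
  note cyc' = cyc_rotate[OF cyc] cyc_rotate[OF cyc_rotate[OF cyc]]
  define K L M Ck Cl Cm C0 D where "K = S_coef \<phi> k" and "L = S_coef \<phi> l" and "M = S_coef \<phi> m"
    and "Ck = C_coef \<phi> k" and "Cl = C_coef \<phi> l" and "Cm = C_coef \<phi> m"
    and "C0 = C_coef \<phi> 0" and "D = D_coef \<phi> k l"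
  note defs = K_def L_def M_def Ck_def Cl_def Cm_def C0_def D_def
  have nz: "K * L \<noteq> 0"
    using generic_S_nonzero[OF assms(2,3)] cyc_distinct[OF cyc] by (auto simp: defs)
  have KL: "K * L = Ck * Cl - C0 * Cm" and LM: "L * M = Cl * Cm - C0 * Ck"
    and MK: "M * K = Cm * Ck - C0 * Cl"
    using S_mult_S[of k l m \<phi>, OF cyc assms(3)] S_mult_S[of l m k \<phi>, OF cyc'(1) assms(3)] S_mult_S[of m k l \<phi>, OF cyc'(2) assms(3)]
    by (simp_all add: defs)
  have CD: "Cm * D = Ck * K - Cl * L" and CC: "Ck\<^sup>2 - Cl\<^sup>2 = D * M"
    using C_mult_D[of m k l \<phi>, OF cyc'(2) assms(3)] C_square_diff[of m k l \<phi>, OF cyc'(2) assms(3)] by (simp_all add: defs)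
  note pqrs = p[folded defs] q[folded defs] r[folded defs] s[folded defs]
  have ii: "(\<i> * x) * (\<i> * y) = - (x * y)" for x y :: complex
    by (simp add: algebra_simps)
  \<comment> \<open>Multiplication by the nonzero K L expresses every occurrence of p, q, r, s by a,
    b, c, d; the claims become polynomial identities.\<close>
  have "K * L * (s * p) = (L * s) * (K * p)" by simp
  then have sp: "K * L * (s * p) = - ((Ck * c - Cm * d) * (Cl * a - Cm * b))"
    unfolding pqrs ii .
  have "K * L * (q * r) = (K * q) * (L * r)" by simp
  then have qr: "K * L * (q * r) = - ((Cm * a - Cl * b) * (Cm * c - Ck * d))"
    unfolding pqrs ii .
  have "K * L * M * (b * s + c * q) = M * K * b * (L * s) + L * M * c * (K * q)"
    by (simp add: algebra_simps)
  then have bsq: "K * L * M * (b * s + c * q)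
      = \<i> * (M * K * b * (Ck * c - Cm * d) + L * M * c * (Cm * a - Cl * b))"
    unfolding pqrs by (simp add: algebra_simps)
  have "K * L * M * (p * d + r * a) = L * M * d * (K * p) + M * K * a * (L * r)"
    by (simp add: algebra_simps)
  then have pdr: "K * L * M * (p * d + r * a)
      = \<i> * (L * M * d * (Cl * a - Cm * b) + M * K * a * (Cm * c - Ck * d))"
    unfolding pqrs by (simp add: algebra_simps)
  \<comment> \<open>Both sides equal Cm D M. This disposes of the monomial b c in the first identity
    and of a d in the second; the others vanish by KL, LM and MK.\<close>
  have M: "M * (Ck * K - Cl * L) = Cm * (Ck\<^sup>2 - Cl\<^sup>2)"
    unfolding CD[symmetric] CC by simp
  have "K * L * (M * (b * s + c * q) - \<i> * (Ck * (a * c + s * p) - Cl * (q * r + d * b)))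
      = K * L * M * (b * s + c * q) - \<i> * (Ck * (K * L * (a * c) + K * L * (s * p))
          - Cl * (K * L * (q * r) + K * L * (d * b)))"
    by (simp add: algebra_simps)
  also have "\<dots> = \<i> * (b * c * (M * (Ck * K - Cl * L) - Cm * (Ck\<^sup>2 - Cl\<^sup>2)))
      + \<i> * (a * c) * (L * M * Cm - Ck * (K * L) + Ck\<^sup>2 * Cl - Cl * Cm\<^sup>2)
      - \<i> * (b * d) * (M * K * Cm - Cl * (K * L) + Ck * Cl\<^sup>2 - Ck * Cm\<^sup>2)"
    unfolding bsq sp qr by (simp add: algebra_simps power2_eq_square)
  also have "\<dots> = 0" unfolding KL LM MK M by (simp add: algebra_simps power2_eq_square)
  finally show "S_coef \<phi> m * (b * s + c * q)
      = \<i> * (C_coef \<phi> k * (a * c + s * p) - C_coef \<phi> l * (q * r + d * b))"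
    using nz by (simp add: defs)
  have "K * L * (M * (p * d + r * a) - \<i> * (Cl * (a * c + s * p) - Ck * (q * r + d * b)))
      = K * L * M * (p * d + r * a) - \<i> * (Cl * (K * L * (a * c) + K * L * (s * p))
          - Ck * (K * L * (q * r) + K * L * (d * b)))"
    by (simp add: algebra_simps)
  also have "\<dots> = - \<i> * (a * d * (M * (Ck * K - Cl * L) - Cm * (Ck\<^sup>2 - Cl\<^sup>2)))
      + \<i> * (a * c) * (M * K * Cm - Cl * (K * L) + Ck * Cl\<^sup>2 - Ck * Cm\<^sup>2)
      - \<i> * (b * d) * (L * M * Cm - Ck * (K * L) + Ck\<^sup>2 * Cl - Cl * Cm\<^sup>2)"
    unfolding pdr sp qr by (simp add: algebra_simps power2_eq_square)
  also have "\<dots> = 0" unfolding KL LM MK M by (simp add: algebra_simps power2_eq_square)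
  finally show "S_coef \<phi> m * (p * d + r * a)
      = \<i> * (C_coef \<phi> l * (a * c + s * p) - C_coef \<phi> k * (q * r + d * b))"
    using nz by (simp add: defs)
qed

text \<open>The diagonal enters the entries (0, k) and (k, 0) through \<delta> and \<delta>', and
  the entries (l, m) and (m, l), since the traces vanish, through their negatives. This sign is
  exactly the difference between the conditions and the transposed ones. The remaining terms come
  from the other two blocks and are covered by \<open>jordan_block\<close>, used once for each order
  of t and t'.\<close>

lemma annihilated_jordan_product:
  assumes "generic \<phi>" "\<phi> 0 = 0" and t: "annihilated \<phi> t" "annihilated \<phi> t'"
    and tr: "(\<Sum>\<mu>\<in>UNIV. t \<mu> \<mu>) = 0" "(\<Sum>\<mu>\<in>UNIV. t' \<mu> \<mu>) = 0"
  shows "annihilated \<phi> (\<lambda>\<mu> \<nu>. \<Sum>\<rho>\<in>UNIV. t \<nu> \<rho> * t' \<rho> \<mu> + t' \<nu> \<rho> * t \<rho> \<mu>)"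
proof (rule annihilatedI)
  fix k l m :: 4 assume klm: "(k, l, m) \<in> cyc"
  note lmk = cyc_rotate[OF klm]
  note mkl = cyc_rotate[OF lmk]
  define \<delta> \<delta>' where "\<delta> = t 0 0 + t k k" and "\<delta>' = t' 0 0 + t' k k"
  have \<delta>: "t l l + t m m = - \<delta>" "t' l l + t' m m = - \<delta>'"
    using tr by (simp_all add: cyc_sum[OF klm] \<delta>_def \<delta>'_def algebra_simps add_eq_0_iff)
  note b1 = jordan_block[OF lmk assms(1,2) annihilatedD[OF t(1) lmk] annihilatedD[OF t(2) mkl]]
  note b2 = jordan_block[OF lmk assms(1,2) annihilatedD[OF t(2) lmk] annihilatedD[OF t(1) mkl]]
  note d1 = annihilatedD[OF t(1) klm]
  note d2 = annihilatedD[OF t(2) klm]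
  let ?M = "\<lambda>\<nu> \<mu>. \<Sum>\<rho>\<in>UNIV. t \<nu> \<rho> * t' \<rho> \<mu> + t' \<nu> \<rho> * t \<rho> \<mu>"
  have M0: "?M 0 k = \<delta> * t' 0 k + \<delta>' * t 0 k
      + (t 0 l * t' l k + t' 0 m * t m k) + (t' 0 l * t l k + t 0 m * t' m k)"
    "?M k 0 = \<delta> * t' k 0 + \<delta>' * t k 0
      + (t k m * t' m 0 + t' k l * t l 0) + (t' k m * t m 0 + t k l * t' l 0)"
    by (simp_all add: cyc_sum[OF klm] \<delta>_def \<delta>'_def algebra_simps)
  have "?M l m = (t l l + t m m) * t' l m + (t' l l + t' m m) * t l m
      + (t l 0 * t' 0 m + t' l k * t k m) + (t' l 0 * t 0 m + t l k * t' k m)"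
    "?M m l = (t l l + t m m) * t' m l + (t' l l + t' m m) * t m l
      + (t m k * t' k l + t' m 0 * t 0 l) + (t' m k * t k l + t m 0 * t' 0 l)"
    by (simp_all add: cyc_sum[OF klm] algebra_simps)
  then have Ml: "?M l m = - \<delta> * t' l m - \<delta>' * t l m
      + (t l 0 * t' 0 m + t' l k * t k m) + (t' l 0 * t 0 m + t l k * t' k m)"
    "?M m l = - \<delta> * t' m l - \<delta>' * t m l
      + (t m k * t' k l + t' m 0 * t 0 l) + (t' m k * t k l + t m 0 * t' 0 l)"
    unfolding \<delta> by simp_all
  have "S_coef \<phi> k * ?M k 0 = \<delta> * (S_coef \<phi> k * t' k 0) + \<delta>' * (S_coef \<phi> k * t k 0)
      + S_coef \<phi> k * (t k m * t' m 0 + t' k l * t l 0)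
      + S_coef \<phi> k * (t' k m * t m 0 + t k l * t' l 0)"
    unfolding M0 by (simp add: algebra_simps)
  also have "\<dots> = \<i> * (C_coef \<phi> l * ?M m l - C_coef \<phi> m * ?M l m)"
    unfolding Ml b1(1) b2(1) d1(2) d2(2) by (simp add: algebra_simps)
  finally have "S_coef \<phi> k * ?M k 0 = \<i> * (C_coef \<phi> l * ?M m l - C_coef \<phi> m * ?M l m)" .
  moreover have "S_coef \<phi> k * ?M 0 k = \<delta> * (S_coef \<phi> k * t' 0 k) + \<delta>' * (S_coef \<phi> k * t 0 k)
      + S_coef \<phi> k * (t 0 l * t' l k + t' 0 m * t m k)
      + S_coef \<phi> k * (t' 0 l * t l k + t 0 m * t' m k)"
    unfolding M0 by (simp add: algebra_simps)
  then have "S_coef \<phi> k * ?M 0 k = \<i> * (C_coef \<phi> m * ?M m l - C_coef \<phi> l * ?M l m)"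
    unfolding Ml b1(2) b2(2) d1(1) d2(1) by (simp add: algebra_simps)
  ultimately show "S_coef \<phi> k * ?M k 0 = \<i> * (C_coef \<phi> l * ?M m l - C_coef \<phi> m * ?M l m) \<and>
      S_coef \<phi> k * ?M 0 k = \<i> * (C_coef \<phi> m * ?M m l - C_coef \<phi> l * ?M l m)" ..
qed

section \<open>The elliptic curve and its automorphism\<close>

definition on_curve :: "(4 \<Rightarrow> real) \<Rightarrow> complex^4 \<Rightarrow> bool" where
  "on_curve \<phi> y \<longleftrightarrow> y \<noteq> 0 \<and>
     (\<Sum>\<mu>\<in>UNIV. exp (2 * \<i> * of_real (\<phi> \<mu>)) * (y $ \<mu>)\<^sup>2) = 0 \<and>
     (\<Sum>\<mu>\<in>UNIV. exp (- 2 * \<i> * of_real (\<phi> \<mu>)) * (y $ \<mu>)\<^sup>2) = 0"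

lemma on_curve_uminus: "on_curve (\<lambda>\<mu>. - \<phi> \<mu>) y \<longleftrightarrow> on_curve \<phi> y"
  unfolding on_curve_def by (simp, blast)

text \<open>The cosine is a combination of the two exponentials, so each \<theta> selects one member
  of the pencil of quadrics spanned by the two equations of the curve.\<close>

lemma on_curve_cos:
  assumes "on_curve \<phi> y"
  shows "(\<Sum>\<mu>\<in>UNIV. of_real (cos (\<theta> - 2 * \<phi> \<mu>)) * (y $ \<mu>)\<^sup>2) = 0"
proof -
  have "of_real (cos (\<theta> - 2 * \<phi> \<mu>)) * (y $ \<mu>)\<^sup>2
      = exp (\<i> * of_real \<theta>) / 2 * (exp (- 2 * \<i> * of_real (\<phi> \<mu>)) * (y $ \<mu>)\<^sup>2)
      + exp (- \<i> * of_real \<theta>) / 2 * (exp (2 * \<i> * of_real (\<phi> \<mu>)) * (y $ \<mu>)\<^sup>2)" for \<mu>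
  proof -
    have "exp (\<i> * (of_real \<theta> - 2 * of_real (\<phi> \<mu>)))
        = exp (\<i> * of_real \<theta>) * exp (- 2 * \<i> * of_real (\<phi> \<mu>))"
      "exp (- (\<i> * (of_real \<theta> - 2 * of_real (\<phi> \<mu>))))
        = exp (- \<i> * of_real \<theta>) * exp (2 * \<i> * of_real (\<phi> \<mu>))"
      unfolding exp_add[symmetric] by (simp_all add: algebra_simps)
    then show ?thesis
      by (simp add: cos_of_real[symmetric] cos_exp_eq del: cos_of_real) (simp add: field_simps)
  qed
  then show ?thesis
    using assms by (simp only: sum.distrib flip: sum_distrib_left) (simp add: on_curve_def)
qed

lemma on_curve_C: "on_curve \<phi> y \<Longrightarrow> (\<Sum>\<mu>\<in>UNIV. C_coef \<phi> \<mu> * (y $ \<mu>)\<^sup>2) = 0"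
  unfolding C_coef_def by (rule on_curve_cos)

lemma on_curve_D: 
  assumes "on_curve \<phi> y"
  shows "(\<Sum>\<mu>\<in>UNIV. D_coef \<phi> \<mu> \<nu> * (y $ \<mu>)\<^sup>2) = 0"
proof -
  have "D_coef \<phi> \<mu> \<nu> = of_real (cos (pi / 2 + 2 * \<phi> \<nu> - 2 * \<phi> \<mu>))" for \<mu>
    unfolding D_coef_def sin_cos_eq by (simp add: algebra_simps)
  then show ?thesis using on_curve_cos[OF assms] by simp
qed

lemma D_coef_same [simp]: "D_coef \<phi> \<mu> \<mu> = 0"
  by (simp add: D_coef_def)

lemma D_coef_commute: "D_coef \<phi> \<mu> \<nu> = - D_coef \<phi> \<nu> \<mu>"
  unfolding D_coef_def sin_diff by simp

text \<open>If two coordinates vanish, let \<kappa> and b be the other two. The member of the pencil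
  that does not contain the coordinate b reduces to a nonzero multiple of the square of
  \<open>y $ \<kappa>\<close>.\<close>

lemma on_curve_two_coords:
  assumes "generic \<phi>" "\<phi> 0 = 0" and y: "on_curve \<phi> y" and "\<mu> \<noteq> \<nu>"
  shows "y $ \<mu> \<noteq> 0 \<or> y $ \<nu> \<noteq> 0"
proof (rule ccontr)
  assume "\<not> ?thesis"
  then have zero: "y $ \<mu> = 0" "y $ \<nu> = 0" by auto
  have "y $ \<kappa> = 0" for \<kappa>
  proof (cases "\<kappa> \<in> {\<mu>, \<nu>}")
    case False
    then have "card (UNIV - {\<mu>, \<nu>, \<kappa>}) = 1"
      using \<open>\<mu> \<noteq> \<nu>\<close> by (subst card_Diff_subset) (auto simp: card_insert_if)
    then obtain b where b: "UNIV - {\<mu>, \<nu>, \<kappa>} = {b}" by (rule card_1_singletonE)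
    then have "b \<noteq> \<kappa>" and mem: "\<rho> \<in> {\<mu>, \<nu>, \<kappa>, b}" for \<rho> by blast+
    have *: "D_coef \<phi> \<rho> b * (y $ \<rho>)\<^sup>2 = (if \<rho> = \<kappa> then D_coef \<phi> \<kappa> b * (y $ \<kappa>)\<^sup>2 else 0)" for \<rho>
      using mem[of \<rho>] zero False by (elim insertE) auto
    have "(\<Sum>\<rho>\<in>UNIV. if \<rho> = \<kappa> then D_coef \<phi> \<kappa> b * (y $ \<kappa>)\<^sup>2 else 0)
        = (\<Sum>\<rho>\<in>UNIV. D_coef \<phi> \<rho> b * (y $ \<rho>)\<^sup>2)"
      by (rule sum.cong[OF refl, OF *[symmetric]])
    then have "D_coef \<phi> \<kappa> b * (y $ \<kappa>)\<^sup>2 = 0"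
      using on_curve_D[OF y, of b] by simp
    moreover have "D_coef \<phi> \<kappa> b \<noteq> 0"
      by (rule generic_D_nonzero[OF assms(1,2)]) (use \<open>b \<noteq> \<kappa>\<close> in simp)
    ultimately show ?thesis by simp
  qed (use zero in auto)
  then have "y = 0" by (simp add: vec_eq_iff)
  then show False using y by (simp add: on_curve_def)
qed

lemma on_curve_S:
  assumes "on_curve \<phi> y" "\<phi> 0 = 0" "(k, l, m) \<in> cyc"
  shows "S_coef \<phi> k * (y $ k)\<^sup>2 + S_coef \<phi> l * (y $ l)\<^sup>2 + S_coef \<phi> m * (y $ m)\<^sup>2 = 0"
  using on_curve_D[OF assms(1), of 0] unfolding cyc_sum[OF assms(3)] S_eq_D[of \<phi>, OF assms(2)] by simp

lemma S_mult_G: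
  assumes "on_curve \<phi> y" "\<phi> 0 = 0" "(k, l, m) \<in> cyc"
  shows "S_coef \<phi> k * (y $ 0)\<^sup>2 = D_coef \<phi> l k * (y $ l)\<^sup>2 + D_coef \<phi> m k * (y $ m)\<^sup>2"
proof -
  have "D_coef \<phi> 0 k = - S_coef \<phi> k"
    using D_coef_commute[of \<phi> 0 k] assms(2) by (simp add: S_eq_D)
  then show ?thesis
    using on_curve_D[OF assms(1), of k] by (simp add: cyc_sum[OF assms(3)] algebra_simps)
qed

text \<open>Multiply \<open>S_mult_G\<close> by the other two sines: each product of a
  \<open>D_coef\<close> with a sine is a difference of squared cosines, and the terms with the
  squared cosine of k combine by \<open>on_curve_S\<close>. The symmetric form serves both for the
  lift of \<sigma> and for its nonvanishing.\<close>

lemma on_curve_SSS: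
  assumes "on_curve \<phi> y" "\<phi> 0 = 0" "(k, l, m) \<in> cyc"
  shows "S_coef \<phi> k * S_coef \<phi> l * S_coef \<phi> m * (y $ 0)\<^sup>2
    = S_coef \<phi> k * (C_coef \<phi> k)\<^sup>2 * (y $ k)\<^sup>2 + S_coef \<phi> l * (C_coef \<phi> l)\<^sup>2 * (y $ l)\<^sup>2
    + S_coef \<phi> m * (C_coef \<phi> m)\<^sup>2 * (y $ m)\<^sup>2"
proof -
  note lmk = cyc_rotate[OF assms(3)]
  note mkl = cyc_rotate[OF lmk]
  define K L M where "K = S_coef \<phi> k" and "L = S_coef \<phi> l" and "M = S_coef \<phi> m"
  have l: "D_coef \<phi> l k * M = (C_coef \<phi> l)\<^sup>2 - (C_coef \<phi> k)\<^sup>2"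
    using C_square_diff[of m k l \<phi>, OF mkl assms(2)] D_coef_commute[of \<phi> l k]
    by (simp add: M_def algebra_simps)
  have m: "D_coef \<phi> m k * L = (C_coef \<phi> m)\<^sup>2 - (C_coef \<phi> k)\<^sup>2"
    using C_square_diff[of l m k \<phi>, OF lmk assms(2)] by (simp add: L_def algebra_simps)
  have "K * L * M * (y $ 0)\<^sup>2 = L * M * (K * (y $ 0)\<^sup>2)" by simp
  also have "\<dots> = L * (y $ l)\<^sup>2 * (D_coef \<phi> l k * M) + M * (y $ m)\<^sup>2 * (D_coef \<phi> m k * L)"
    unfolding K_def S_mult_G[OF assms] by (simp add: algebra_simps)
  also have "\<dots> = L * (C_coef \<phi> l)\<^sup>2 * (y $ l)\<^sup>2 + M * (C_coef \<phi> m)\<^sup>2 * (y $ m)\<^sup>2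
      - (C_coef \<phi> k)\<^sup>2 * (L * (y $ l)\<^sup>2 + M * (y $ m)\<^sup>2)"
    unfolding l m by (simp add: algebra_simps)
  also have "L * (y $ l)\<^sup>2 + M * (y $ m)\<^sup>2 = - (K * (y $ k)\<^sup>2)"
    using on_curve_S[OF assms] by (simp add: K_def L_def M_def eq_neg_iff_add_eq_0 add_ac)
  finally show ?thesis by (simp add: K_def L_def M_def algebra_simps)
qed

text \<open>Where it does not vanish on the curve, this quadratic map represents \<open>\<sigma>\<close>.\<close>

definition sigma_lift :: "(4 \<Rightarrow> real) \<Rightarrow> 4 \<times> 4 \<times> 4 \<Rightarrow> complex^4 \<Rightarrow> complex^4" where
  "sigma_lift \<phi> = (\<lambda>(k, l, m) y. \<chi> \<mu>.
     if \<mu> = 0 then C_coef \<phi> k * D_coef \<phi> l m * (y $ l * y $ m)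
       + \<i> * C_coef \<phi> l * C_coef \<phi> m * (y $ 0 * y $ k)
     else if \<mu> = k then - \<i> * (S_coef \<phi> l * S_coef \<phi> m * (y $ 0 * y $ 0)
       - (C_coef \<phi> k)\<^sup>2 * (y $ k * y $ k))
     else if \<mu> = l then C_coef \<phi> m * S_coef \<phi> m * (y $ 0 * y $ m)
       + \<i> * C_coef \<phi> k * C_coef \<phi> l * (y $ k * y $ l)
     else - C_coef \<phi> l * S_coef \<phi> l * (y $ 0 * y $ l)
       + \<i> * C_coef \<phi> k * C_coef \<phi> m * (y $ k * y $ m))"

abbreviation related :: "(4 \<Rightarrow> real) \<Rightarrow> complex^4 \<Rightarrow> complex^4 \<Rightarrow> bool" where
  "related \<phi> y z \<equiv> annihilated \<phi> (\<lambda>\<mu> \<nu>. y $ \<mu> * z $ \<nu>)"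

text \<open>Allows one fixed but arbitrary cyclic triple to stand for the explicit indices, so that
  the verification below covers the three lifts at once.\<close>

lemma annihilated_cycI:
  assumes "(k, l, m) \<in> cyc"
    and "\<And>k' l' m'. (k', l', m') \<in> {(k, l, m), (l, m, k), (m, k, l)} \<Longrightarrow>
     S_coef \<phi> k' * t 0 k' = \<i> * (C_coef \<phi> l' * t l' m' - C_coef \<phi> m' * t m' l') \<and>
     S_coef \<phi> k' * t k' 0 = \<i> * (C_coef \<phi> m' * t l' m' - C_coef \<phi> l' * t m' l')"
  shows "annihilated \<phi> t"
proof (rule annihilatedI, rule assms(2))
  fix k' l' m' :: 4 assume "(k', l', m') \<in> cyc"
  then show "(k', l', m') \<in> {(k, l, m), (l, m, k), (m, k, l)}"
    using assms(1) unfolding cyc_def by auto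
qed

text \<open>Two of the six conditions hold identically in y. Each of the others is a multiple of an
  equation of the curve plus, except for the first, a multiple of an identity between squared
  cosines.\<close>

lemma related_sigma_lift:
  assumes "generic \<phi>" "\<phi> 0 = 0" "on_curve \<phi> y" "(k, l, m) \<in> cyc"
  shows "related \<phi> y (sigma_lift \<phi> (k, l, m) y)"
proof -
  note klm = assms(4)
  note lmk = cyc_rotate[OF klm]
  note mkl = cyc_rotate[OF lmk]
  define K L M Ck Cl Cm D where "K = S_coef \<phi> k" and "L = S_coef \<phi> l" and "M = S_coef \<phi> m"
    and "Ck = C_coef \<phi> k" and "Cl = C_coef \<phi> l" and "Cm = C_coef \<phi> m" and "D = D_coef \<phi> l m"
  define E F where "E = D_coef \<phi> m k" and "F = D_coef \<phi> k l"
  note defs = K_def L_def M_def Ck_def Cl_def Cm_def D_def E_def F_def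
  define y0 yk yl ym where "y0 = y $ 0" and "yk = y $ k" and "yl = y $ l" and "ym = y $ m"
  note ydefs = y0_def yk_def yl_def ym_def
  have CCk: "Cl\<^sup>2 - Cm\<^sup>2 = D * K" and CCl: "Cm\<^sup>2 - Ck\<^sup>2 = E * L" and CCm: "Ck\<^sup>2 - Cl\<^sup>2 = F * M"
    using C_square_diff[of k l m \<phi>, OF klm assms(2)] C_square_diff[of l m k \<phi>, OF lmk assms(2)]
      C_square_diff[of m k l \<phi>, OF mkl assms(2)] by (simp_all add: defs)
  have S: "K * yk\<^sup>2 + L * yl\<^sup>2 + M * ym\<^sup>2 = 0"
    using on_curve_S[OF assms(3,2) klm] by (simp add: defs ydefs)
  have SSS: "K * L * M * y0\<^sup>2 = K * Ck\<^sup>2 * yk\<^sup>2 + L * Cl\<^sup>2 * yl\<^sup>2 + M * Cm\<^sup>2 * ym\<^sup>2"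
    using on_curve_SSS[OF assms(3,2) klm] by (simp add: defs ydefs)
  have Gm: "M * y0\<^sup>2 = D * yl\<^sup>2 - E * yk\<^sup>2" and Gl: "L * y0\<^sup>2 = F * yk\<^sup>2 - D * ym\<^sup>2"
    using S_mult_G[OF assms(3,2) mkl] S_mult_G[OF assms(3,2) lmk] D_coef_commute[of \<phi> k m]
      D_coef_commute[of \<phi> m l] by (simp_all add: defs ydefs algebra_simps)
  define z0 zk zl zm where "z0 = Ck * D * (yl * ym) + \<i> * Cl * Cm * (y0 * yk)"
    and "zk = - \<i> * (L * M * (y0 * y0) - Ck\<^sup>2 * (yk * yk))"
    and "zl = Cm * M * (y0 * ym) + \<i> * Ck * Cl * (yk * yl)"
    and "zm = - Cl * L * (y0 * yl) + \<i> * Ck * Cm * (yk * ym)"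
  note zdefs = z0_def zk_def zl_def zm_def
  have dist: "distinct [0, k, l, m]" by (rule cyc_distinct[OF klm])
  have z: "sigma_lift \<phi> (k, l, m) y $ 0 = z0" "sigma_lift \<phi> (k, l, m) y $ k = zk"
    "sigma_lift \<phi> (k, l, m) y $ l = zl" "sigma_lift \<phi> (k, l, m) y $ m = zm"
    using dist by (auto simp: sigma_lift_def zdefs defs ydefs)
  have k1: "K * (y0 * zk) = \<i> * (Cl * (yl * zm) - Cm * (ym * zl))"
  proof -
    have "K * (y0 * zk) - \<i> * (Cl * (yl * zm) - Cm * (ym * zl))
        = - \<i> * y0 * (K * L * M * y0\<^sup>2 - (K * Ck\<^sup>2 * yk\<^sup>2 + L * Cl\<^sup>2 * yl\<^sup>2 + M * Cm\<^sup>2 * ym\<^sup>2))"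
      unfolding zdefs by (simp add: algebra_simps power2_eq_square)
    then show ?thesis unfolding SSS by simp
  qed
  have k2: "K * (yk * z0) = \<i> * (Cm * (yl * zm) - Cl * (ym * zl))"
  proof -
    have "K * (yk * z0) - \<i> * (Cm * (yl * zm) - Cl * (ym * zl))
        = \<i> * Cl * Cm * y0 * (K * yk\<^sup>2 + L * yl\<^sup>2 + M * ym\<^sup>2)
        + Ck * yk * yl * ym * (D * K - (Cl\<^sup>2 - Cm\<^sup>2))"
      unfolding zdefs by (simp add: algebra_simps power2_eq_square)
    then show ?thesis unfolding S CCk by simp
  qed
  \<comment> \<open>The next two hold for every y. Read as linear equations for zl and zm they have
    the determinant \<open>\<i> * zk\<close>, and Cramer's rule yields the formulas for zl and
    zm.\<close>
  have l1: "L * (y0 * zl) = \<i> * (Cm * (ym * zk) - Ck * (yk * zm))"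
    unfolding zdefs by (simp add: algebra_simps power2_eq_square)
  have m1: "M * (y0 * zm) = \<i> * (Ck * (yk * zl) - Cl * (yl * zk))"
    unfolding zdefs by (simp add: algebra_simps power2_eq_square)
  have l2: "L * (yl * z0) = \<i> * (Ck * (ym * zk) - Cm * (yk * zm))"
  proof -
    have "L * (yl * z0) - \<i> * (Ck * (ym * zk) - Cm * (yk * zm))
        = - (L * Ck * ym * (M * y0\<^sup>2 - (D * yl\<^sup>2 - E * yk\<^sup>2)))
        + Ck * ym * yk\<^sup>2 * (E * L - (Cm\<^sup>2 - Ck\<^sup>2))"
      unfolding zdefs by (simp add: algebra_simps power2_eq_square)
    then show ?thesis unfolding Gm CCl by simp
  qed
  have m2: "M * (ym * z0) = \<i> * (Cl * (yk * zl) - Ck * (yl * zk))"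
  proof -
    have "M * (ym * z0) - \<i> * (Cl * (yk * zl) - Ck * (yl * zk))
        = M * Ck * yl * (L * y0\<^sup>2 - (F * yk\<^sup>2 - D * ym\<^sup>2))
        + Ck * yl * yk\<^sup>2 * (F * M - (Ck\<^sup>2 - Cl\<^sup>2))"
      unfolding zdefs by (simp add: algebra_simps power2_eq_square)
    then show ?thesis unfolding Gl CCm by simp
  qed
  show ?thesis
    by (rule annihilated_cycI[OF klm])
       (use k1 k2 l1 l2 m1 m2 in \<open>auto simp: z simp flip: defs ydefs\<close>)
qed

text \<open>The sum regroups into three terms, which vanish by \<open>C_mult_D\<close>, by
  \<open>S_mult_S\<close> and by the cosine equation of the curve; the last two bring in
  \<open>C_coef \<phi> 0\<close>.\<close>

lemma Q_sigma_lift: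
  assumes "generic \<phi>" "\<phi> 0 = 0" "on_curve \<phi> y" "(k, l, m) \<in> cyc"
  shows "Q y (sigma_lift \<phi> (k, l, m) y) = 0"
proof -
  note klm = assms(4)
  have dist: "k \<noteq> 0" "l \<noteq> 0" "m \<noteq> 0" "l \<noteq> k" "m \<noteq> k" "m \<noteq> l"
    using cyc_distinct[OF klm] by auto
  have C: "C_coef \<phi> 0 * (y $ 0)\<^sup>2 + C_coef \<phi> k * (y $ k)\<^sup>2 + C_coef \<phi> l * (y $ l)\<^sup>2
      + C_coef \<phi> m * (y $ m)\<^sup>2 = 0"
    using on_curve_C[OF assms(3)] by (simp add: cyc_sum[OF klm])
  have "Q y (sigma_lift \<phi> (k, l, m) y)
      = y $ 0 * y $ l * y $ m * (C_coef \<phi> k * D_coef \<phi> l m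
          - (C_coef \<phi> l * S_coef \<phi> l - C_coef \<phi> m * S_coef \<phi> m))
      - \<i> * y $ k * (y $ 0)\<^sup>2 * (S_coef \<phi> l * S_coef \<phi> m
          - (C_coef \<phi> l * C_coef \<phi> m - C_coef \<phi> 0 * C_coef \<phi> k))
      + \<i> * C_coef \<phi> k * y $ k * (C_coef \<phi> 0 * (y $ 0)\<^sup>2 + C_coef \<phi> k * (y $ k)\<^sup>2
          + C_coef \<phi> l * (y $ l)\<^sup>2 + C_coef \<phi> m * (y $ m)\<^sup>2)"
    unfolding Q_def cyc_sum[OF klm] sigma_lift_def
    using dist by (simp add: algebra_simps power2_eq_square)
  then show ?thesis
    unfolding C C_mult_D[of k l m \<phi>, OF klm assms(2)]
      S_mult_S[of l m k \<phi>, OF cyc_rotate[OF klm] assms(2)] by simp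
qed

text \<open>If the lifts of all three cyclic triples vanished, their k-th components would make each
  of the three terms in \<open>on_curve_SSS\<close> equal to the left-hand side X. Then X = 3 X, so
  \<open>y $ 0\<close> is 0; a nonzero cosine kills a second coordinate, against
  \<open>on_curve_two_coords\<close>.\<close>

lemma sigma_lift_nonzero:
  assumes "generic \<phi>" "\<phi> 0 = 0" "on_curve \<phi> y"
  obtains k l m where "(k, l, m) \<in> cyc" "sigma_lift \<phi> (k, l, m) y \<noteq> 0"
proof (rule ccontr)
  note obt = that
  assume contr: "\<not> thesis"
  have zero: "sigma_lift \<phi> (k, l, m) y = 0" if "(k, l, m) \<in> cyc" for k l m
    using contr obt[OF that] by blast
  have sq: "S_coef \<phi> l * S_coef \<phi> m * (y $ 0)\<^sup>2 = (C_coef \<phi> k)\<^sup>2 * (y $ k)\<^sup>2"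
    if "(k, l, m) \<in> cyc" for k l m
  proof -
    have "sigma_lift \<phi> (k, l, m) y $ k = 0" using zero[OF that] by simp
    then show ?thesis
      using cyc_distinct[OF that] by (simp add: sigma_lift_def power2_eq_square)
  qed
  have c: "(1, 2, 3) \<in> cyc" "(2, 3, 1) \<in> cyc" "(3, 1, 2) \<in> cyc" by (auto simp: cyc_def)
  define X where "X = S_coef \<phi> 1 * S_coef \<phi> 2 * S_coef \<phi> 3 * (y $ 0)\<^sup>2"
  have "X = S_coef \<phi> 1 * (C_coef \<phi> 1)\<^sup>2 * (y $ 1)\<^sup>2 + S_coef \<phi> 2 * (C_coef \<phi> 2)\<^sup>2 * (y $ 2)\<^sup>2
      + S_coef \<phi> 3 * (C_coef \<phi> 3)\<^sup>2 * (y $ 3)\<^sup>2"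
    unfolding X_def by (rule on_curve_SSS[OF assms(3,2) c(1)])
  also have "\<dots> = X + X + X"
    unfolding mult.assoc sq[OF c(1), symmetric] sq[OF c(2), symmetric] sq[OF c(3), symmetric]
    by (simp add: X_def mult_ac)
  finally have "X = 0" by simp
  then have y0: "y $ 0 = 0"
    unfolding X_def using generic_S_nonzero[OF assms(1,2)] by simp
  have "y $ 2 = 0 \<or> y $ 3 = 0"
    using sq[OF c(2)] sq[OF c(3)] generic_C_nonzero[OF assms(1,2) c(1)] y0 by auto
  then show False
    using y0 on_curve_two_coords[OF assms, of 0 2] on_curve_two_coords[OF assms, of 0 3] by auto
qed

text \<open>For fixed \<nu> the vector of the minors \<open>W \<mu> \<nu>\<close> is a combination
  of z and z', hence again a solution. With \<nu> = l or \<nu> = m one minor on the right is zero,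
  so each condition becomes a relation between two minors; these are collected in
  \<open>e\<close>.\<close>

lemma related_minor:
  assumes "generic \<phi>" "\<phi> 0 = 0" "on_curve \<phi> y" "related \<phi> y z" "related \<phi> y z'"
  shows "z $ \<mu> * z' $ \<nu> = z $ \<nu> * z' $ \<mu>"
proof -
  define W where "W \<mu> \<nu> = z $ \<mu> * z' $ \<nu> - z $ \<nu> * z' $ \<mu>" for \<mu> \<nu>
  have W_self [simp]: "W \<mu> \<mu> = 0" and W_flip: "W \<mu> \<nu> = - W \<nu> \<mu>" for \<mu> \<nu>
    by (simp_all add: W_def)
  note coord = on_curve_two_coords[OF assms(1-3)]
  have r1: "S_coef \<phi> k * (y $ 0 * W k \<nu>)
      = \<i> * (C_coef \<phi> l * (y $ l * W m \<nu>) - C_coef \<phi> m * (y $ m * W l \<nu>))"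
    and r2: "S_coef \<phi> k * (y $ k * W 0 \<nu>)
      = \<i> * (C_coef \<phi> m * (y $ l * W m \<nu>) - C_coef \<phi> l * (y $ m * W l \<nu>))"
    if "(k, l, m) \<in> cyc" for k l m \<nu>
  proof -
    note d = annihilatedD[OF assms(4) that] annihilatedD[OF assms(5) that]
    have "S_coef \<phi> k * (y $ 0 * W k \<nu>)
        = S_coef \<phi> k * (y $ 0 * z $ k) * z' $ \<nu> - S_coef \<phi> k * (y $ 0 * z' $ k) * z $ \<nu>"
      "S_coef \<phi> k * (y $ k * W 0 \<nu>)
        = S_coef \<phi> k * (y $ k * z $ 0) * z' $ \<nu> - S_coef \<phi> k * (y $ k * z' $ 0) * z $ \<nu>"
      by (simp_all add: W_def algebra_simps)
    then show "S_coef \<phi> k * (y $ 0 * W k \<nu>)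
      = \<i> * (C_coef \<phi> l * (y $ l * W m \<nu>) - C_coef \<phi> m * (y $ m * W l \<nu>))"
      "S_coef \<phi> k * (y $ k * W 0 \<nu>)
      = \<i> * (C_coef \<phi> m * (y $ l * W m \<nu>) - C_coef \<phi> l * (y $ m * W l \<nu>))"
      unfolding d by (simp_all add: W_def algebra_simps)
  qed
  have e: "S_coef \<phi> k * (y $ 0 * W k l) = - (\<i> * (C_coef \<phi> l * (y $ l * W l m)))"
    "S_coef \<phi> k * (y $ 0 * W m k) = \<i> * (C_coef \<phi> m * (y $ m * W l m))"
    "S_coef \<phi> k * (y $ k * W 0 l) = - (\<i> * (C_coef \<phi> m * (y $ l * W l m)))"
    "S_coef \<phi> k * (y $ k * W 0 m) = - (\<i> * (C_coef \<phi> l * (y $ m * W l m)))"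
    if "(k, l, m) \<in> cyc" for k l m
    using r1[OF that, of l] r1[OF that, of m] r2[OF that, of l] r2[OF that, of m]
      W_flip[of m l] W_flip[of m k] by simp_all
  have Wkl: "W k l = 0" if klm: "(k, l, m) \<in> cyc" for k l m
  proof -
    note lmk = cyc_rotate[OF klm]
    note mkl = cyc_rotate[OF lmk]
    have dist: "distinct [0, k, l, m]" by (rule cyc_distinct[OF klm])
    have nz: "S_coef \<phi> k \<noteq> 0" "S_coef \<phi> l \<noteq> 0" "S_coef \<phi> m \<noteq> 0"
      using dist generic_S_nonzero[OF assms(1,2)] by auto
    \<comment> \<open>At most one coordinate of y vanishes, so in the first two cases the remaining
      coordinates are available for division.\<close>
    consider "y $ 0 = 0" | "y $ 0 \<noteq> 0" "y $ m = 0" | "y $ 0 \<noteq> 0" "y $ m \<noteq> 0" by blast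
    then show ?thesis
    proof cases
      case 1
      then have "y $ k \<noteq> 0" "y $ l \<noteq> 0" using coord[of 0 k] coord[of 0 l] dist by auto
      then show ?thesis
        using e(1)[OF mkl] e(2)[OF mkl] generic_C_nonzero[OF assms(1,2) mkl] 1 by auto
    next
      case 2
      then have "y $ k \<noteq> 0" "y $ l \<noteq> 0" using coord[of m k] coord[of m l] dist by auto
      then show ?thesis
        using e(3)[OF mkl] e(4)[OF mkl] generic_C_nonzero[OF assms(1,2) mkl] 2 by auto
    next
      case 3
      \<comment> \<open>\<open>W 0 m\<close> and \<open>W k l\<close> can each be computed in two
        ways, from the conditions of k and from those of l. The first comparison gives a = b, the
        second a = - b.\<close>
      define a b where "a = C_coef \<phi> l * y $ l * S_coef \<phi> l * W l m"
        and "b = C_coef \<phi> k * y $ k * S_coef \<phi> k * W m k"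
      have "\<i> * y $ m * a = - (S_coef \<phi> l * y $ l * (S_coef \<phi> k * (y $ k * W 0 m)))"
        unfolding e(4)[OF klm] a_def by (simp add: algebra_simps)
      moreover have "\<i> * y $ m * b = - (S_coef \<phi> k * y $ k * (S_coef \<phi> l * (y $ l * W 0 m)))"
        unfolding e(3)[OF lmk] b_def by (simp add: algebra_simps)
      ultimately have "\<i> * y $ m * a = \<i> * y $ m * b" by (simp add: algebra_simps)
      then have ab: "a = b" using 3 by simp
      have "- \<i> * a = S_coef \<phi> l * (S_coef \<phi> k * (y $ 0 * W k l))"
        unfolding e(1)[OF klm] a_def by (simp add: algebra_simps)
      moreover have "\<i> * b = S_coef \<phi> k * (S_coef \<phi> l * (y $ 0 * W k l))"
        unfolding e(2)[OF lmk] b_def by (simp add: algebra_simps)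
      ultimately have "S_coef \<phi> k * (S_coef \<phi> l * (y $ 0 * W k l)) = 0"
        using ab by (simp add: algebra_simps)
      then show ?thesis using 3 nz by simp
    qed
  qed
  have W0: "W 0 l = 0" if klm: "(k, l, m) \<in> cyc" for k l m
  proof -
    note lmk = cyc_rotate[OF klm]
    note mkl = cyc_rotate[OF lmk]
    have dist: "distinct [0, k, l, m]" by (rule cyc_distinct[OF klm])
    then have nz: "S_coef \<phi> k \<noteq> 0" "S_coef \<phi> m \<noteq> 0" "y $ k \<noteq> 0 \<or> y $ m \<noteq> 0"
      using generic_S_nonzero[OF assms(1,2)] coord[of k m] by auto
    have "S_coef \<phi> k * (y $ k * W 0 l) = 0" "S_coef \<phi> m * (y $ m * W 0 l) = 0"
      unfolding e(3)[OF klm] e(4)[OF mkl] using Wkl[OF lmk] Wkl[OF klm] by simp_all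
    then show ?thesis using nz by auto
  qed
  have c: "(1, 2, 3) \<in> cyc" "(2, 3, 1) \<in> cyc" "(3, 1, 2) \<in> cyc" by (auto simp: cyc_def)
  have "W 0 1 = 0" "W 0 2 = 0" "W 0 3 = 0" "W 1 2 = 0" "W 2 3 = 0" "W 3 1 = 0"
    using W0[OF c(3)] W0[OF c(1)] W0[OF c(2)] Wkl[OF c(1)] Wkl[OF c(2)] Wkl[OF c(3)] by simp_all
  then have "W \<mu> \<nu> = 0"
    using exhaust_4_from_0[of \<mu>] exhaust_4_from_0[of \<nu>] W_flip[of \<mu> \<nu>]
    by (elim disjE) simp_all
  then show ?thesis by (simp add: W_def)
qed

text \<open>Negating the angles changes the sign of the sines and keeps the cosines. Once the
  factors are exchanged, this sign turns the condition for \<open>x\<^sup>0x\<^sup>k\<close> into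
  the one for \<open>x\<^sup>kx\<^sup>0\<close>, and conversely.\<close>

lemma related_uminus: "related (\<lambda>\<mu>. - \<phi> \<mu>) z y \<longleftrightarrow> related \<phi> y z"
proof -
  have S: "S_coef (\<lambda>\<mu>. - \<phi> \<mu>) \<mu> = - S_coef \<phi> \<mu>" for \<mu>
    by (simp add: S_coef_def)
  have C: "C_coef (\<lambda>\<mu>. - \<phi> \<mu>) \<mu> = C_coef \<phi> \<mu>" for \<mu>
  proof -
    have *: "- \<phi> 1 + - \<phi> 2 + - \<phi> 3 - 2 * - \<phi> \<mu> = - (\<phi> 1 + \<phi> 2 + \<phi> 3 - 2 * \<phi> \<mu>)" by simp
    show ?thesis unfolding C_coef_def * cos_minus ..
  qed
  show ?thesis
    unfolding annihilated_def S C
    by (intro ball_cong refl) (auto simp: algebra_simps)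
qed

lemma generic_uminus:
  assumes "generic \<phi>"
  shows "generic (\<lambda>\<mu>. - \<phi> \<mu>)"
proof -
  have *: "- x \<noteq> of_int n * (pi / 2)" if "\<And>n::int. x \<noteq> of_int n * (pi / 2)" for x and n :: int
    using that[of "- n"] by auto
  have "- \<phi> j \<noteq> of_int n * (pi / 2)" if "j \<in> {1, 2, 3}" for j and n :: int
    using assms that unfolding generic_def by (intro *) blast
  moreover have "- (\<phi> k - \<phi> l) \<noteq> of_int n * (pi / 2)"
    if "k \<in> {1, 2, 3}" "l \<in> {1, 2, 3}" "k \<noteq> l" for k l and n :: int
    using assms that unfolding generic_def by (intro *) blast
  ultimately show ?thesis unfolding generic_def by simp
qed

section \<open>Lines, the pairing and the graph of the automorphism\<close>

lemma line_scale: "c \<noteq> 0 \<Longrightarrow> line (c *s z) = line z"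
proof -
  assume c: "c \<noteq> 0"
  have "d *s z \<in> line (c *s z)" for d
    unfolding line_def using c by (intro range_eqI[of _ _ "d / c"]) (simp add: vector_smult_assoc)
  moreover have "d *s (c *s z) \<in> line z" for d
    unfolding line_def by (intro range_eqI[of _ _ "d * c"]) (simp add: vector_smult_assoc)
  ultimately show ?thesis
    by (auto simp only: line_def[of z] line_def[of "c *s z"])
qed

lemma in_line_nonzero: "y \<in> line z \<Longrightarrow> y \<noteq> 0 \<Longrightarrow> \<exists>c. c \<noteq> 0 \<and> y = c *s z"
  by (auto simp: line_def)

lemma self_in_line: "z \<in> line z"
  unfolding line_def using rangeI[of "\<lambda>c. c *s z" 1] by simp

lemma line_eqD: "line y = line z \<Longrightarrow> y \<noteq> 0 \<Longrightarrow> \<exists>c. c \<noteq> 0 \<and> y = c *s z"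
  using in_line_nonzero self_in_line by blast

lemma line_eq_if_minors:
  assumes "z \<noteq> 0" "z' \<noteq> 0" "\<And>\<mu> \<nu>. z $ \<mu> * z' $ \<nu> = z $ \<nu> * z' $ \<mu>"
  shows "line z = line z'"
proof -
  obtain \<nu> where \<nu>: "z' $ \<nu> \<noteq> 0" using assms(2) by (auto simp: vec_eq_iff)
  define c where "c = z $ \<nu> / z' $ \<nu>"
  have z: "z = c *s z'"
    using assms(3)[of _ \<nu>] \<nu> by (simp add: vec_eq_iff field_simps c_def)
  then have "c \<noteq> 0" using assms(1) by auto
  then show ?thesis unfolding z by (rule line_scale)
qed

lemma lookup_scl: "Poly_Mapping.lookup (scl c a) w = c * Poly_Mapping.lookup a w"
  by (simp add: scl_def Poly_Mapping.map.rep_eq when_def)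

lemma scl_one [simp]: "scl 1 a = a" and scl_zero [simp]: "scl 0 a = 0"
  by (simp_all add: poly_mapping_eq_iff fun_eq_iff lookup_scl)

lemma pairing_add: "pairing (a + b) z z' = pairing a z z' + pairing b z z'"
  by (simp add: pairing_def lookup_add algebra_simps sum.distrib)

lemma pairing_diff: "pairing (a - b) z z' = pairing a z z' - pairing b z z'"
  by (simp add: pairing_def lookup_minus algebra_simps sum_subtractf)

lemma pairing_scl: "pairing (scl c a) z z' = c * pairing a z z'"
  by (simp add: pairing_def lookup_scl sum_distrib_left mult_ac)

lemma pairing_zero: "pairing 0 z z' = 0"
  by (simp add: pairing_def)

lemma pairing_sum: "pairing (\<Sum>r\<in>I. f r) z z' = (\<Sum>r\<in>I. pairing (f r) z z')"
  by (induction I rule: infinite_finite_induct) (simp_all add: pairing_add pairing_zero)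

lemma gen_mult_gen: "gen \<mu> * gen \<nu> = Poly_Mapping.single [\<mu>, \<nu>] 1"
  by (simp add: gen_def mult_single plus_list_def)

lemma pairing_gen_mult_gen: "pairing (gen \<mu> * gen \<nu>) z z' = z $ \<mu> * z' $ \<nu>"
proof -
  have "pairing (gen \<mu> * gen \<nu>) z z'
      = (\<Sum>\<mu>'\<in>UNIV. \<Sum>\<nu>'\<in>UNIV. if \<nu>' = \<nu> then if \<mu>' = \<mu> then z $ \<mu> * z' $ \<nu> else 0 else 0)"
    unfolding pairing_def gen_mult_gen
    by (intro sum.cong refl) (auto simp: lookup_single when_def)
  then show ?thesis by simp
qed

lemma pairing_homogeneous: "pairing a (c *s z) (d *s z') = c * d * pairing a z z'"
  by (simp add: pairing_def sum_distrib_left mult_ac)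

lemma R4_relators_cyc: "R4_relators \<phi> = (\<Union>(k, l, m)\<in>cyc.
     {scl (of_real (sin (\<phi> k))) (gen 0 * gen k + gen k * gen 0)
        - scl (\<i> * of_real (cos (\<phi> l - \<phi> m))) (gen l * gen m - gen m * gen l),
      scl (of_real (cos (\<phi> k))) (gen 0 * gen k - gen k * gen 0)
        - scl (\<i> * of_real (sin (\<phi> l - \<phi> m))) (gen l * gen m + gen m * gen l)})"
  unfolding R4_relators_def cyc_def ..

lemma finite_R4_relators: "finite (R4_relators \<phi>)"
  unfolding R4_relators_def split_beta
  by (intro finite_UN_I finite.insertI finite.emptyI)

lemma relator_in_relation_space: "r \<in> R4_relators \<phi> \<Longrightarrow> r \<in> relation_space \<phi>"
proof -
  assume r: "r \<in> R4_relators \<phi>"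
  have "(\<Sum>r'\<in>R4_relators \<phi>. scl (if r' = r then 1 else 0) r')
      = (\<Sum>r'\<in>R4_relators \<phi>. if r' = r then r else 0)"
    by (intro sum.cong refl) (auto split: if_split)
  also have "\<dots> = r" using r by (simp add: finite_R4_relators)
  finally show ?thesis
    unfolding relation_space_def by (intro range_eqI[of _ _ "\<lambda>r'. if r' = r then 1 else 0"]) simp
qed

lemma pairing_relation_space_iff:
  "(\<forall>\<omega>\<in>relation_space \<phi>. pairing \<omega> z z' = 0) \<longleftrightarrow> (\<forall>r\<in>R4_relators \<phi>. pairing r z z' = 0)"
proof
  show "\<forall>r\<in>R4_relators \<phi>. pairing r z z' = 0" if "\<forall>\<omega>\<in>relation_space \<phi>. pairing \<omega> z z' = 0"
    using that relator_in_relation_space by blast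
  show "\<forall>\<omega>\<in>relation_space \<phi>. pairing \<omega> z z' = 0" if "\<forall>r\<in>R4_relators \<phi>. pairing r z z' = 0"
    using that by (auto simp: relation_space_def pairing_sum pairing_scl)
qed

lemma pairing_relators_iff:
  assumes "generic \<phi>" "\<phi> 0 = 0"
  shows "(\<forall>r\<in>R4_relators \<phi>. pairing r z z' = 0) \<longleftrightarrow> related \<phi> z z'"
  unfolding annihilated_iff_relations[OF assms] R4_relators_cyc ball_UN
proof (rule ball_cong[OF refl])
  fix p :: "4 \<times> 4 \<times> 4"
  obtain k l m where "p = (k, l, m)" by (cases p)
  then show "(\<forall>r\<in>case p of (k, l, m) \<Rightarrow>
      {scl (of_real (sin (\<phi> k))) (gen 0 * gen k + gen k * gen 0)
        - scl (\<i> * of_real (cos (\<phi> l - \<phi> m))) (gen l * gen m - gen m * gen l),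
      scl (of_real (cos (\<phi> k))) (gen 0 * gen k - gen k * gen 0)
        - scl (\<i> * of_real (sin (\<phi> l - \<phi> m))) (gen l * gen m + gen m * gen l)}.
      pairing r z z' = 0) \<longleftrightarrow>
    (case p of (k, l, m) \<Rightarrow>
      of_real (sin (\<phi> k)) * (z $ 0 * z' $ k + z $ k * z' $ 0)
        = \<i> * of_real (cos (\<phi> l - \<phi> m)) * (z $ l * z' $ m - z $ m * z' $ l) \<and>
      of_real (cos (\<phi> k)) * (z $ 0 * z' $ k - z $ k * z' $ 0)
        = \<i> * of_real (sin (\<phi> l - \<phi> m)) * (z $ l * z' $ m + z $ m * z' $ l))"
    by (simp add: pairing_diff pairing_scl pairing_add pairing_gen_mult_gen)
qed

lemma char_graph_iff:
  assumes "generic \<phi>" "\<phi> 0 = 0" "z \<noteq> 0" "z' \<noteq> 0"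
  shows "(line z, line z') \<in> char_graph \<phi> \<longleftrightarrow> related \<phi> z z'"
proof -
  have "(\<forall>\<omega>\<in>relation_space \<phi>. \<forall>y\<in>line z. \<forall>y'\<in>line z'. pairing \<omega> y y' = 0)
      \<longleftrightarrow> (\<forall>\<omega>\<in>relation_space \<phi>. pairing \<omega> z z' = 0)"
  proof
    assume "\<forall>\<omega>\<in>relation_space \<phi>. pairing \<omega> z z' = 0"
    then show "\<forall>\<omega>\<in>relation_space \<phi>. \<forall>y\<in>line z. \<forall>y'\<in>line z'. pairing \<omega> y y' = 0"
      by (auto simp: line_def pairing_homogeneous)
  qed (use self_in_line in blast)
  moreover have "line z \<in> proj_space" "line z' \<in> proj_space"
    using assms by (auto simp: proj_space_def)
  ultimately show ?thesis
    unfolding char_graph_def mem_Collect_eq split_conv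
    by (simp only: pairing_relation_space_iff pairing_relators_iff[OF assms(1,2)] simp_thms)
qed

text \<open>\<open>F_curve\<close> speaks of some representative of the line; the equations are
  homogeneous of degree 2 and therefore hold for each.\<close>

lemma line_in_F_curve:
  assumes "line y \<in> F_curve \<phi>" "y \<noteq> 0"
  shows "on_curve \<phi> y"
proof -
  obtain z where z: "line y = line z" "on_curve \<phi> z"
    using assms(1) unfolding F_curve_def on_curve_def by blast
  obtain c where c: "y = c *s z" using line_eqD[OF z(1) assms(2)] by blast
  have "e \<mu> * (y $ \<mu>)\<^sup>2 = c\<^sup>2 * (e \<mu> * (z $ \<mu>)\<^sup>2)" for e :: "4 \<Rightarrow> complex" and \<mu>
    by (simp add: c power_mult_distrib)
  then have "(\<Sum>\<mu>\<in>UNIV. e \<mu> * (y $ \<mu>)\<^sup>2) = c\<^sup>2 * (\<Sum>\<mu>\<in>UNIV. e \<mu> * (z $ \<mu>)\<^sup>2)"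
    for e :: "4 \<Rightarrow> complex"
    unfolding sum_distrib_left by (intro sum.cong refl)
  then show ?thesis using z(2) assms(2) unfolding on_curve_def by simp
qed

lemma related_unique:
  assumes "generic \<phi>" "\<phi> 0 = 0" "on_curve \<phi> y" "related \<phi> y z" "related \<phi> y z'" "z \<noteq> 0" "z' \<noteq> 0"
  shows "line z = line z'"
  using line_eq_if_minors[OF assms(6,7)] related_minor[OF assms(1-5)] by blast

lemma char_aut_line:
  assumes "generic \<phi>" "\<phi> 0 = 0" "on_curve \<phi> y" "related \<phi> y z" "z \<noteq> 0"
  shows "char_aut \<phi> (line y) = line z"
  unfolding char_aut_def
proof (rule the_equality)
  have y: "y \<noteq> 0" using assms(3) by (simp add: on_curve_def)
  show "(line y, line z) \<in> char_graph \<phi>"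
    using char_graph_iff[OF assms(1,2) y assms(5)] assms(4) by simp
  fix p assume p: "(line y, p) \<in> char_graph \<phi>"
  then obtain z' where z': "p = line z'" "z' \<noteq> 0"
    unfolding char_graph_def proj_space_def by auto
  then have "related \<phi> y z'"
    using p char_graph_iff[OF assms(1,2) y z'(2)] by simp
  then show "p = line z" using related_unique[OF assms(1-4) _ assms(5)] z' by simp
qed

lemma related_scale: "related \<phi> y z \<Longrightarrow> related \<phi> y (c *s z)"
proof (rule annihilatedI)
  fix k l m assume "related \<phi> y z" "(k, l, m) \<in> cyc"
  note d = annihilatedD[OF this]
  have "S_coef \<phi> k * (y $ 0 * (c *s z) $ k) = c * (S_coef \<phi> k * (y $ 0 * z $ k))"
    "S_coef \<phi> k * (y $ k * (c *s z) $ 0) = c * (S_coef \<phi> k * (y $ k * z $ 0))"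
    by simp_all
  then show "S_coef \<phi> k * (y $ 0 * (c *s z) $ k)
      = \<i> * (C_coef \<phi> l * (y $ l * (c *s z) $ m) - C_coef \<phi> m * (y $ m * (c *s z) $ l)) \<and>
    S_coef \<phi> k * (y $ k * (c *s z) $ 0)
      = \<i> * (C_coef \<phi> m * (y $ l * (c *s z) $ m) - C_coef \<phi> l * (y $ m * (c *s z) $ l))"
    unfolding d by (simp add: algebra_simps)
qed

text \<open>Every nonzero vector of the image line is a multiple of a lift that does not vanish at
  y, so relation and orthogonality pass to it from \<open>sigma_lift\<close>.\<close>

lemma char_aut_related:
  assumes "generic \<phi>" "\<phi> 0 = 0" "on_curve \<phi> y" "char_aut \<phi> (line y) = line z" "z \<noteq> 0"
  shows "related \<phi> y z" "Q y z = 0"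
proof -
  obtain k l m where klm: "(k, l, m) \<in> cyc" and nz: "sigma_lift \<phi> (k, l, m) y \<noteq> 0"
    using sigma_lift_nonzero[OF assms(1-3)] by blast
  note rel = related_sigma_lift[OF assms(1-3) klm]
  have "line z = line (sigma_lift \<phi> (k, l, m) y)"
    using char_aut_line[OF assms(1-3) rel nz] assms(4) by simp
  then obtain c where c: "z = c *s sigma_lift \<phi> (k, l, m) y"
    using line_eqD assms(5) by blast
  show "related \<phi> y z" unfolding c by (rule related_scale[OF rel])
  have "Q y z = c * Q y (sigma_lift \<phi> (k, l, m) y)"
    unfolding c by (simp add: Q_def sum_distrib_left mult_ac)
  then show "Q y z = 0" using Q_sigma_lift[OF assms(1-3) klm] by simp
qed

lemma smooth_on_if:
  "smooth_on U f \<Longrightarrow> smooth_on U g \<Longrightarrow> smooth_on U (\<lambda>y. if b then f y else g y)"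
  by (cases b) simp_all

lemma smooth_on_sigma_lift:
  assumes "open U"
  shows "smooth_on U (\<lambda>y. sigma_lift \<phi> klm y $ \<mu>)"
proof -
  obtain k l m where klm: "klm = (k, l, m)" by (cases klm) auto
  show ?thesis
    unfolding klm sigma_lift_def split_conv vec_lambda_beta
    by (intro smooth_on_if smooth_on_nth smooth_on_const smooth_on_add smooth_on_diff
        smooth_on_mult assms)
qed

text \<open>Gathers what the crossed product requires of \<sigma>: a bijection of \<open>K\<close>
  with local smooth lifts in both directions. The lifts are constrained only at nonzero vectors
  whose line lies in \<open>K\<close>; elsewhere they may even vanish.\<close>

locale smooth_dynamics =
  fixes K :: "(complex^4) set set" and \<sigma> :: "(complex^4) set \<Rightarrow> (complex^4) set"
  assumes proj: "K \<subseteq> proj_space"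
    and bij: "bij_betw \<sigma> K K"
    and lift_forward: "z \<noteq> 0 \<Longrightarrow> line z \<in> K \<Longrightarrow> \<exists>U s. open U \<and> z \<in> U \<and>
      (\<forall>\<mu>. smooth_on U (\<lambda>y. s y $ \<mu>)) \<and>
      (\<forall>y\<in>U. y \<noteq> 0 \<longrightarrow> line y \<in> K \<longrightarrow> s y \<noteq> 0 \<and> line (s y) = \<sigma> (line y))"
    and lift_backward: "z \<noteq> 0 \<Longrightarrow> line z \<in> K \<Longrightarrow> \<exists>U s. open U \<and> z \<in> U \<and>
      (\<forall>\<mu>. smooth_on U (\<lambda>y. s y $ \<mu>)) \<and>
      (\<forall>y\<in>U. y \<noteq> 0 \<longrightarrow> line y \<in> K \<longrightarrow> s y \<noteq> 0 \<and> line (s y) \<in> K \<and> \<sigma> (line (s y)) = line y)"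

lemma sigma_lift_local:
  assumes "generic \<phi>" "\<phi> 0 = 0" "on_curve \<phi> z"
  obtains U k l m where "open U" "z \<in> U" "(k, l, m) \<in> cyc"
    "\<And>y. y \<in> U \<Longrightarrow> sigma_lift \<phi> (k, l, m) y \<noteq> 0"
proof -
  obtain k l m where klm: "(k, l, m) \<in> cyc" and nz: "sigma_lift \<phi> (k, l, m) z \<noteq> 0"
    using sigma_lift_nonzero[OF assms] by blast
  obtain \<mu> where \<mu>: "sigma_lift \<phi> (k, l, m) z $ \<mu> \<noteq> 0"
    using nz by (auto simp: vec_eq_iff)
  have "continuous_on UNIV (\<lambda>y. sigma_lift \<phi> (k, l, m) y $ \<mu>)"
    by (rule smooth_on_continuous[OF smooth_on_sigma_lift[OF open_UNIV]])
  then have "open ((\<lambda>y. sigma_lift \<phi> (k, l, m) y $ \<mu>) -` (- {0}))"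
    by (intro open_vimage) auto
  then show ?thesis
    by (rule that[OF _ _ klm]) (use \<mu> in auto)
qed

text \<open>Two points with the same image z are both related to z for the negated angles, so
  uniqueness there gives injectivity; surjectivity is the invariance of \<open>K\<close>. Likewise
  the lift for the negated angles represents the inverse.\<close>

lemma smooth_dynamics_char_aut:
  assumes gen: "generic \<phi>" "\<phi> 0 = 0" and K: "K \<subseteq> F_curve \<phi>" and inv: "char_aut \<phi> ` K = K"
  shows "smooth_dynamics K (char_aut \<phi>)"
proof -
  define \<psi> where "\<psi> = (\<lambda>\<mu>. - \<phi> \<mu>)"
  have gen': "generic \<psi>" "\<psi> 0 = 0"
    using generic_uminus[OF gen(1)] gen(2) by (simp_all add: \<psi>_def)
  have rel': "related \<psi> z y \<longleftrightarrow> related \<phi> y z" for y z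
    unfolding \<psi>_def by (rule related_uminus)
  have curve: "on_curve \<phi> y" "on_curve \<psi> y" if "line y \<in> K" "y \<noteq> 0" for y
    using line_in_F_curve[of y \<phi>] on_curve_uminus[of \<phi> y] that K by (auto simp: \<psi>_def)
  have proj: "K \<subseteq> proj_space"
    using K by (auto simp: F_curve_def proj_space_def)
  have rep: "\<exists>y. y \<noteq> 0 \<and> p = line y" if "p \<in> K" for p
    using that proj by (auto simp: proj_space_def)
  have preimage: "\<exists>x. x \<noteq> 0 \<and> line x \<in> K \<and> char_aut \<phi> (line x) = line y \<and> related \<psi> y x"
    if y: "line y \<in> K" "y \<noteq> 0" for y
  proof -
    obtain p where p: "p \<in> K" "char_aut \<phi> p = line y" using y inv by (metis imageE)
    obtain x where x: "x \<noteq> 0" "p = line x" using rep[OF p(1)] by blast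
    have "related \<phi> x y"
      by (rule char_aut_related[OF gen curve(1)]) (use x p y in auto)
    then show ?thesis using x p rel' by blast
  qed
  have "inj_on (char_aut \<phi>) K"
  proof (rule inj_onI)
    fix p q assume p: "p \<in> K" and q: "q \<in> K" and eq: "char_aut \<phi> p = char_aut \<phi> q"
    obtain x where x: "x \<noteq> 0" "p = line x" using rep[OF p] by blast
    obtain y where y: "y \<noteq> 0" "q = line y" using rep[OF q] by blast
    have "char_aut \<phi> p \<in> K" using p inv by blast
    then obtain z where z: "z \<noteq> 0" "char_aut \<phi> p = line z" "line z \<in> K" using rep by metis
    have "related \<phi> x z"
      by (rule char_aut_related[OF gen curve(1)]) (use x p z in auto)
    moreover have "related \<phi> y z"
      by (rule char_aut_related[OF gen curve(1)]) (use y q z eq in auto)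
    ultimately show "p = q"
      using related_unique[OF gen' curve(2)[OF z(3,1)]] x y rel' by blast
  qed
  then have bij: "bij_betw (char_aut \<phi>) K K"
    using inv by (simp add: bij_betw_def)
  show ?thesis
  proof
    fix z :: "complex^4" assume z: "z \<noteq> 0" "line z \<in> K"
    obtain U k l m where U: "open U" "z \<in> U" and klm: "(k, l, m) \<in> cyc"
      and nz: "\<And>y. y \<in> U \<Longrightarrow> sigma_lift \<phi> (k, l, m) y \<noteq> 0"
      by (rule sigma_lift_local[OF gen curve(1)[OF z(2,1)]]) (rule that)
    have "line (sigma_lift \<phi> (k, l, m) y) = char_aut \<phi> (line y)"
      if "y \<in> U" "y \<noteq> 0" "line y \<in> K" for y
      using char_aut_line[OF gen curve(1)[OF that(3,2)] related_sigma_lift[OF gen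
          curve(1)[OF that(3,2)] klm] nz[OF that(1)]] by simp
    then show "\<exists>U s. open U \<and> z \<in> U \<and> (\<forall>\<mu>. smooth_on U (\<lambda>y. s y $ \<mu>)) \<and>
      (\<forall>y\<in>U. y \<noteq> 0 \<longrightarrow> line y \<in> K \<longrightarrow> s y \<noteq> 0 \<and> line (s y) = char_aut \<phi> (line y))"
      using U nz smooth_on_sigma_lift[OF U(1), of \<phi> "(k, l, m)"]
      by (intro exI[of _ U] exI[of _ "sigma_lift \<phi> (k, l, m)"]) simp
  next
    fix z :: "complex^4" assume z: "z \<noteq> 0" "line z \<in> K"
    obtain U k l m where U: "open U" "z \<in> U" and klm: "(k, l, m) \<in> cyc"
      and nz: "\<And>y. y \<in> U \<Longrightarrow> sigma_lift \<psi> (k, l, m) y \<noteq> 0"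
      by (rule sigma_lift_local[OF gen' curve(2)[OF z(2,1)]]) (rule that)
    have "line (sigma_lift \<psi> (k, l, m) y) \<in> K \<and>
        char_aut \<phi> (line (sigma_lift \<psi> (k, l, m) y)) = line y"
      if y: "y \<in> U" "y \<noteq> 0" "line y \<in> K" for y
    proof -
      \<comment> \<open>That the line of the lift lies in \<open>K\<close> is seen by comparison
        with a preimage, which the invariance of \<open>K\<close> provides.\<close>
      obtain x where x: "x \<noteq> 0" "line x \<in> K" "char_aut \<phi> (line x) = line y" "related \<psi> y x"
        using preimage[OF y(3,2)] by blast
      have "line (sigma_lift \<psi> (k, l, m) y) = line x"
        by (rule related_unique[OF gen' curve(2)[OF y(3,2)] related_sigma_lift[OF gen'
          curve(2)[OF y(3,2)] klm] x(4) nz[OF y(1)] x(1)])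
      then show ?thesis using x by simp
    qed
    then show "\<exists>U s. open U \<and> z \<in> U \<and> (\<forall>\<mu>. smooth_on U (\<lambda>y. s y $ \<mu>)) \<and>
      (\<forall>y\<in>U. y \<noteq> 0 \<longrightarrow> line y \<in> K \<longrightarrow>
        s y \<noteq> 0 \<and> line (s y) \<in> K \<and> char_aut \<phi> (line (s y)) = line y)"
      using U nz smooth_on_sigma_lift[OF U(1), of \<psi> "(k, l, m)"]
      by (intro exI[of _ U] exI[of _ "sigma_lift \<psi> (k, l, m)"]) simp
  qed (use proj bij in auto)
qed

section \<open>Smooth homogeneous functions on unit orbits\<close>

lemma smooth_vec_continuous:
  assumes "\<And>\<mu>. smooth_on U (\<lambda>y. s y $ \<mu>)"
  shows "continuous_on U (s :: complex^4 \<Rightarrow> complex^4)"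
  using continuous_on_vec_lambda[of U "\<lambda>\<mu> y. s y $ \<mu>"] smooth_on_continuous[OF assms] by simp

lemma Q_scale_right: "Q a (c *s v) = c * Q a v"
  by (simp add: Q_def sum_distrib_left mult_ac)

lemma Q_commute: "Q a b = Q b a"
  by (simp add: Q_def mult_ac)

lemma Q_conj_vec_scale: "Q (c *s v) (conj_vec (c *s v)) = c * cnj c * Q v (conj_vec v)"
  by (simp add: Q_def conj_vec_def sum_distrib_left mult_ac)

lemma Q_conj_vec_nonzero:
  assumes "v \<noteq> 0"
  shows "Q v (conj_vec v) \<noteq> 0"
proof -
  have "Q v (conj_vec v) = of_real (\<Sum>\<mu>\<in>UNIV. (cmod (v $ \<mu>))\<^sup>2)"
    unfolding Q_def conj_vec_def by (simp add: complex_norm_square del: of_real_power)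
  moreover have "(\<Sum>\<mu>\<in>UNIV. (cmod (v $ \<mu>))\<^sup>2) \<noteq> 0"
    using assms by (auto simp: sum_nonneg_eq_0_iff vec_eq_iff)
  ultimately show ?thesis by (simp only: of_real_eq_0_iff not_False_eq_True)
qed

lemma smooth_on_Q:
  assumes "open U" "\<And>\<mu>. smooth_on U (\<lambda>y. s y $ \<mu>)"
  shows "smooth_on U (\<lambda>y. Q a (s y))"
  unfolding Q_def by (intro smooth_on_sum smooth_on_mult smooth_on_const assms)

lemma smooth_on_Q_conj_vec:
  assumes "open U" "\<And>\<mu>. smooth_on U (\<lambda>y. s y $ \<mu>)"
  shows "smooth_on U (\<lambda>y. Q (s y) (conj_vec (s y)))"
  unfolding Q_def conj_vec_def vec_lambda_beta
  by (intro smooth_on_sum smooth_on_mult smooth_on_cnj assms)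

lemma shift_shift: "shift k (shift l \<omega>) = shift (k + l) \<omega>"
  by (simp add: shift_def fun_eq_iff add_ac)

lemma shift_zero [simp]: "shift 0 \<omega> = \<omega>"
  by (simp add: shift_def)

lemma shift_at: "shift k \<omega> j = \<omega> (j + k)"
  by (simp add: shift_def)

section \<open>Unit orbits and local lifts of the iterates\<close>

context smooth_dynamics
begin

abbreviation orbits :: "(int \<Rightarrow> complex^4) set" where
  "orbits \<equiv> unit_orbits K \<sigma>"

lemma shift_in_orbits [simp]: "shift k \<omega> \<in> orbits \<longleftrightarrow> \<omega> \<in> orbits"
  by (rule shift_unit_orbits[OF proj bij])

lemma orbit_unit: "\<omega> \<in> orbits \<Longrightarrow> Q (\<omega> j) (conj_vec (\<omega> j)) = 1"
  and orbit_in_K: "\<omega> \<in> orbits \<Longrightarrow> line (\<omega> j) \<in> K"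
  and orbit_step: "\<omega> \<in> orbits \<Longrightarrow> line (\<omega> (j + 1)) = \<sigma> (line (\<omega> j))"
  by (simp_all add: unit_orbits_def)

lemma orbit_nonzero:
  assumes "\<omega> \<in> orbits"
  shows "\<omega> j \<noteq> 0"
proof
  assume "\<omega> j = 0"
  then show False using orbit_unit[OF assms, of j] by (simp add: Q_def)
qed

lemma orbit_funpow: "\<omega> \<in> orbits \<Longrightarrow> line (\<omega> (int n)) = (\<sigma> ^^ n) (line (\<omega> 0))"
  using unit_orbits_funpow[OF proj bij, of \<omega> 0 n] by simp

lemma orbit_base:
  assumes "\<omega> \<in> orbits" "line (\<omega> 0) = line y"
  shows "y \<noteq> 0" "line y \<in> K"
proof -
  show "line y \<in> K" using orbit_in_K[OF assms(1), of 0] assms(2) by simp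
  show "y \<noteq> 0"
  proof
    assume "y = 0"
    then have "\<omega> 0 \<in> line 0" using assms(2) self_in_line by metis
    then show False using orbit_nonzero[OF assms(1)] by (auto simp: line_def)
  qed
qed

text \<open>Local smooth lifts of the iterates of \<open>\<sigma>\<close>, phrased through unit orbits so that negative
  iterates need no separate treatment.\<close>

definition lifts :: "int \<Rightarrow> (complex^4) set \<Rightarrow> (complex^4 \<Rightarrow> complex^4) \<Rightarrow> bool" where
  "lifts k U s \<longleftrightarrow> open U \<and> (\<forall>\<mu>. smooth_on U (\<lambda>y. s y $ \<mu>)) \<and> (\<forall>y\<in>U. s y \<noteq> 0 \<and>
     (y \<noteq> 0 \<longrightarrow> line y \<in> K \<longrightarrow> line (s y) \<in> K) \<and>
     (\<forall>\<omega>\<in>orbits. line (\<omega> 0) = line y \<longrightarrow> line (\<omega> k) = line (s y)))"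

lemma liftsD:
  assumes "lifts k U s"
  shows "open U" "\<And>\<mu>. smooth_on U (\<lambda>y. s y $ \<mu>)" "\<And>y. y \<in> U \<Longrightarrow> s y \<noteq> 0"
    "\<And>y. y \<in> U \<Longrightarrow> y \<noteq> 0 \<Longrightarrow> line y \<in> K \<Longrightarrow> line (s y) \<in> K"
    "\<And>y \<omega>. y \<in> U \<Longrightarrow> \<omega> \<in> orbits \<Longrightarrow> line (\<omega> 0) = line y \<Longrightarrow> line (\<omega> k) = line (s y)"
  using assms unfolding lifts_def by simp_all

text \<open>One induction step for \<open>lift_exists\<close>, upwards or downwards:
  \<open>t\<close> is a lift of \<sigma> or of its inverse near \<open>s z\<close>.\<close>

lemma lifts_compose:
  assumes s: "lifts k U s" and z: "z \<in> U" "z \<noteq> 0" "line z \<in> K"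
    and t: "open V" "s z \<in> V" "\<And>\<mu>. smooth_on V (\<lambda>y. t y $ \<mu>)"
      "\<And>y. y \<in> V \<Longrightarrow> y \<noteq> 0 \<Longrightarrow> line y \<in> K \<Longrightarrow> t y \<noteq> 0 \<and> line (t y) \<in> K"
    and orb: "\<And>y \<omega>. y \<in> V \<Longrightarrow> y \<noteq> 0 \<Longrightarrow> line y \<in> K \<Longrightarrow> \<omega> \<in> orbits \<Longrightarrow> line (\<omega> k) = line y
      \<Longrightarrow> line (\<omega> k') = line (t y)"
  shows "\<exists>U s. z \<in> U \<and> lifts k' U s"
proof -
  note U = liftsD(1)[OF s] and smooth = liftsD(2)[OF s] and nz = liftsD(3)[OF s]
    and inK = liftsD(4)[OF s] and orb' = liftsD(5)[OF s]
  \<comment> \<open>\<open>lifts\<close> demands nonzero values on the whole open set, whereas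
    \<open>t\<close> is known to be nonzero only over \<open>K\<close>; its zeros are
    removed.\<close>
  define V' where "V' = V \<inter> t -` (- {0})"
  have V': "open V'"
    unfolding V'_def by (rule continuous_open_preimage[OF smooth_vec_continuous[OF t(3)] t(1)]) auto
  define U' where "U' = U \<inter> s -` V'"
  have U': "open U'"
    unfolding U'_def by (rule continuous_open_preimage[OF smooth_vec_continuous[OF smooth] U V'])
  have "s z \<in> V'"
    using t(2) t(4)[OF t(2) nz inK] z by (simp add: V'_def)
  then have zU': "z \<in> U'" using z by (simp add: U'_def)
  have smooth': "smooth_on U' (\<lambda>y. s y $ \<mu>)" for \<mu>
    by (rule smooth_on_subset[OF U U' _ smooth]) (auto simp: U'_def)
  have "smooth_on U' (\<lambda>y. t (s y) $ \<mu>)" for \<mu>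
    by (rule smooth_on_compose[OF U' t(1) t(3) _ smooth']) (auto simp: U'_def V'_def)
  moreover have "t (s y) \<noteq> 0" if "y \<in> U'" for y
    using that by (simp add: U'_def V'_def)
  moreover have "line (t (s y)) \<in> K" if "y \<in> U'" "y \<noteq> 0" "line y \<in> K" for y
  proof -
    have y: "y \<in> U" "s y \<in> V" using that(1) by (simp_all add: U'_def V'_def)
    show ?thesis using t(4)[OF y(2) nz[OF y(1)] inK[OF y(1) that(2,3)]] ..
  qed
  moreover have "line (\<omega> k') = line (t (s y))"
    if "y \<in> U'" "\<omega> \<in> orbits" "line (\<omega> 0) = line y" for y \<omega>
  proof -
    have y: "y \<in> U" "s y \<in> V" "y \<noteq> 0" "line y \<in> K"
      using that(1) orbit_base[OF that(2,3)] by (simp_all add: U'_def V'_def)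
    show ?thesis
      by (rule orb[OF y(2) nz[OF y(1)] inK[OF y(1,3,4)] that(2) orb'[OF y(1) that(2,3)]])
  qed
  ultimately have "lifts k' U' (\<lambda>y. t (s y))"
    unfolding lifts_def using U' by simp
  then show ?thesis using zU' by (intro exI conjI)
qed

text \<open>Induction away from 0 in both directions; downwards, injectivity of \<sigma> on
  \<open>K\<close> shows that the backward lift meets the line of the preceding vector of the
  orbit.\<close>

lemma lift_exists:
  assumes "z \<noteq> 0" "line z \<in> K"
  shows "\<exists>U s. z \<in> U \<and> lifts k U s"
proof (induction k rule: int_induct[where k = 0])
  case base
  have o: "open (- {0 :: complex^4})" by (rule open_Compl[OF closed_singleton])
  have "lifts 0 (- {0}) (\<lambda>y. y)"
    unfolding lifts_def by (intro conjI allI ballI impI o smooth_on_nth) simp_all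
  moreover have "z \<in> - {0}" using assms by simp
  ultimately show ?case
    by (intro exI[of _ "- {0}"] exI[of _ "\<lambda>y. y"] conjI)
next
  case (step1 k)
  then obtain U s where s: "z \<in> U" "lifts k U s" by (elim exE conjE)
  then have "s z \<noteq> 0" "line (s z) \<in> K" using assms liftsD(3,4)[OF s(2)] by simp_all
  from lift_forward[OF this] obtain V t
    where V: "open V" "s z \<in> V" and V3: "\<forall>\<mu>. smooth_on V (\<lambda>y. t y $ \<mu>)"
    and t: "\<forall>y\<in>V. y \<noteq> 0 \<longrightarrow> line y \<in> K \<longrightarrow> t y \<noteq> 0 \<and> line (t y) = \<sigma> (line y)"
    by (elim exE conjE) (rule that)
  show ?case
  proof (rule lifts_compose[OF s(2,1) assms V V3[rule_format]])
    fix y assume y: "y \<in> V" "y \<noteq> 0" "line y \<in> K"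
    then show "t y \<noteq> 0 \<and> line (t y) \<in> K"
      using t bij_betwE[OF bij] by simp
    fix \<omega> assume "\<omega> \<in> orbits" "line (\<omega> k) = line y"
    then show "line (\<omega> (k + 1)) = line (t y)"
      using orbit_step[of \<omega> k] t y by simp
  qed
next
  case (step2 k)
  then obtain U s where s: "z \<in> U" "lifts k U s" by (elim exE conjE)
  then have "s z \<noteq> 0" "line (s z) \<in> K" using assms liftsD(3,4)[OF s(2)] by simp_all
  from lift_backward[OF this] obtain V t
    where V: "open V" "s z \<in> V" and V3: "\<forall>\<mu>. smooth_on V (\<lambda>y. t y $ \<mu>)"
    and t: "\<forall>y\<in>V. y \<noteq> 0 \<longrightarrow> line y \<in> K
      \<longrightarrow> t y \<noteq> 0 \<and> line (t y) \<in> K \<and> \<sigma> (line (t y)) = line y"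
    by (elim exE conjE) (rule that)
  show ?case
  proof (rule lifts_compose[OF s(2,1) assms V V3[rule_format]])
    fix y assume y: "y \<in> V" "y \<noteq> 0" "line y \<in> K"
    then show "t y \<noteq> 0 \<and> line (t y) \<in> K" using t by simp
    fix \<omega> assume \<omega>: "\<omega> \<in> orbits" "line (\<omega> k) = line y"
    have "\<sigma> (line (\<omega> (k - 1))) = \<sigma> (line (t y))"
      using orbit_step[OF \<omega>(1), of "k - 1"] \<omega>(2) t y by simp
    then show "line (\<omega> (k - 1)) = line (t y)"
      using t y by (intro inj_onD[OF bij_betw_imp_inj_on[OF bij] _ orbit_in_K[OF \<omega>(1)]]) auto
  qed
qed

lemma lift_obtain:
  assumes "z \<noteq> 0" "line z \<in> K"
  obtains U s where "z \<in> U" "lifts k U s"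
  using lift_exists[OF assms, of k] by (elim exE conjE) (rule that)

text \<open>The neighbourhood consists of vectors, as for lifted functions, but only the line of
  \<open>\<omega> 0\<close> is compared with it: the property must hold for every choice of phases
  along the orbit.\<close>

definition near :: "complex^4 \<Rightarrow> ((int \<Rightarrow> complex^4) \<Rightarrow> bool) \<Rightarrow> bool" where
  "near z P \<longleftrightarrow> (\<exists>U. open U \<and> z \<in> U \<and>
     (\<forall>y\<in>U. \<forall>\<omega>\<in>orbits. line (\<omega> 0) = line y \<longrightarrow> P \<omega>))"

lemma nearI: "open U \<Longrightarrow> z \<in> U
  \<Longrightarrow> (\<And>y \<omega>. y \<in> U \<Longrightarrow> \<omega> \<in> orbits \<Longrightarrow> line (\<omega> 0) = line y \<Longrightarrow> P \<omega>) \<Longrightarrow> near z P"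
  unfolding near_def by blast

lemma near_conj:
  assumes "near z P" "near z P'"
  shows "near z (\<lambda>\<omega>. P \<omega> \<and> P' \<omega>)"
proof -
  obtain U where U: "open U" "z \<in> U" "\<forall>y\<in>U. \<forall>\<omega>\<in>orbits. line (\<omega> 0) = line y \<longrightarrow> P \<omega>"
    using assms(1) unfolding near_def by blast
  obtain V where V: "open V" "z \<in> V" "\<forall>y\<in>V. \<forall>\<omega>\<in>orbits. line (\<omega> 0) = line y \<longrightarrow> P' \<omega>"
    using assms(2) unfolding near_def by blast
  show ?thesis by (rule nearI[of "U \<inter> V"]) (use U V in auto)
qed

lemma near_mono: "near z P \<Longrightarrow> (\<And>\<omega>. \<omega> \<in> orbits \<Longrightarrow> P \<omega> \<Longrightarrow> P' \<omega>) \<Longrightarrow> near z P'"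
  unfolding near_def by blast

lemma near_ball:
  assumes "finite J" "\<And>j. j \<in> J \<Longrightarrow> near z (P j)"
  shows "near z (\<lambda>\<omega>. \<forall>j\<in>J. P j \<omega>)"
  using assms
proof (induction J rule: finite_induct)
  case empty
  show ?case by (rule nearI[of UNIV]) auto
next
  case (insert j J)
  have "near z (\<lambda>\<omega>. P j \<omega> \<and> (\<forall>j\<in>J. P j \<omega>))"
    using insert by (intro near_conj) auto
  then show ?case by (rule near_mono) simp
qed

lemma near_shift:
  assumes "lifts k U s" "z \<in> U" "near (s z) P"
  shows "near z (\<lambda>\<omega>. P (shift k \<omega>))"
proof -
  obtain V where V: "open V" "s z \<in> V"
    and P: "\<And>y \<omega>. y \<in> V \<Longrightarrow> \<omega> \<in> orbits \<Longrightarrow> line (\<omega> 0) = line y \<Longrightarrow> P \<omega>"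
    using assms(3) unfolding near_def by blast
  have U: "open U" "\<And>\<mu>. smooth_on U (\<lambda>y. s y $ \<mu>)"
    and orb: "\<And>y \<omega>. y \<in> U \<Longrightarrow> \<omega> \<in> orbits \<Longrightarrow> line (\<omega> 0) = line y \<Longrightarrow> line (\<omega> k) = line (s y)"
    using liftsD[OF assms(1)] by simp_all
  have "open (U \<inter> s -` V)"
    by (rule continuous_open_preimage[OF smooth_vec_continuous[OF U(2)] U(1) V(1)])
  then show ?thesis
  proof (rule nearI)
    show "z \<in> U \<inter> s -` V" using assms(2) V by simp
    fix y \<omega> assume y: "y \<in> U \<inter> s -` V" "\<omega> \<in> orbits" "line (\<omega> 0) = line y"
    then show "P (shift k \<omega>)" using orb by (intro P[of "s y"]) (auto simp: shift_at)
  qed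
qed

text \<open>The case of degree 0 of \<open>local_form\<close> below.\<close>

definition smooth0 :: "complex^4 \<Rightarrow> ((int \<Rightarrow> complex^4) \<Rightarrow> complex) \<Rightarrow> bool" where
  "smooth0 z h \<longleftrightarrow> (\<exists>U g. open U \<and> z \<in> U \<and> smooth_on U g \<and>
     (\<forall>y\<in>U. \<forall>\<omega>\<in>orbits. line (\<omega> 0) = line y \<longrightarrow> h \<omega> = g y))"

lemma smooth0I: "open U \<Longrightarrow> z \<in> U \<Longrightarrow> smooth_on U g
  \<Longrightarrow> (\<And>y \<omega>. y \<in> U \<Longrightarrow> \<omega> \<in> orbits \<Longrightarrow> line (\<omega> 0) = line y \<Longrightarrow> h \<omega> = g y) \<Longrightarrow> smooth0 z h"
  unfolding smooth0_def by blast

lemma smooth0_const: "smooth0 z (\<lambda>\<omega>. c)"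
  by (rule smooth0I[OF open_UNIV _ smooth_on_const]) auto

lemma smooth0_if: "smooth0 z h \<Longrightarrow> smooth0 z h' \<Longrightarrow> smooth0 z (\<lambda>\<omega>. if b then h \<omega> else h' \<omega>)"
  by (cases b) simp_all

lemma smooth0_binary:
  assumes "smooth0 z h" "smooth0 z h'"
    and op: "\<And>U g g'. open U \<Longrightarrow> smooth_on U g \<Longrightarrow> smooth_on U g' \<Longrightarrow> smooth_on U (\<lambda>y. f (g y) (g' y))"
  shows "smooth0 z (\<lambda>\<omega>. f (h \<omega>) (h' \<omega>))"
proof -
  obtain U g where U: "open U" "z \<in> U" "smooth_on U g"
    and h: "\<And>y \<omega>. y \<in> U \<Longrightarrow> \<omega> \<in> orbits \<Longrightarrow> line (\<omega> 0) = line y \<Longrightarrow> h \<omega> = g y"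
    using assms(1) unfolding smooth0_def by blast
  obtain V g' where V: "open V" "z \<in> V" "smooth_on V g'"
    and h': "\<And>y \<omega>. y \<in> V \<Longrightarrow> \<omega> \<in> orbits \<Longrightarrow> line (\<omega> 0) = line y \<Longrightarrow> h' \<omega> = g' y"
    using assms(2) unfolding smooth0_def by blast
  have UV: "open (U \<inter> V)" using U V by auto
  show ?thesis
  proof (rule smooth0I[OF UV])
    show "smooth_on (U \<inter> V) (\<lambda>y. f (g y) (g' y))"
      by (rule op[OF UV smooth_on_subset[OF U(1) UV _ U(3)] smooth_on_subset[OF V(1) UV _ V(3)]])
         auto
    fix y \<omega> assume y: "y \<in> U \<inter> V" "\<omega> \<in> orbits" "line (\<omega> 0) = line y"
    show "f (h \<omega>) (h' \<omega>) = f (g y) (g' y)"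
      using h[of y \<omega>] h'[of y \<omega>] y by simp
  qed (use U V in auto)
qed

lemma smooth0_add: "smooth0 z h \<Longrightarrow> smooth0 z h' \<Longrightarrow> smooth0 z (\<lambda>\<omega>. h \<omega> + h' \<omega>)"
  by (rule smooth0_binary[where f = "(+)"]) (auto intro: smooth_on_add)

lemma smooth0_mult: "smooth0 z h \<Longrightarrow> smooth0 z h' \<Longrightarrow> smooth0 z (\<lambda>\<omega>. h \<omega> * h' \<omega>)"
  by (rule smooth0_binary[where f = "(*)"]) (auto intro: smooth_on_mult)

lemma smooth0_cnj:
  assumes "smooth0 z h"
  shows "smooth0 z (\<lambda>\<omega>. cnj (h \<omega>))"
  by (rule smooth0_binary[where f = "\<lambda>x y. cnj x", OF assms assms]) (rule smooth_on_cnj)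

lemma smooth0_prod:
  assumes "\<And>j. j \<in> J \<Longrightarrow> smooth0 z (h j)"
  shows "smooth0 z (\<lambda>\<omega>. \<Prod>j\<in>J. h j \<omega>)"
  using assms
proof (induction J rule: infinite_finite_induct)
  case (insert j J)
  have "smooth0 z (\<lambda>\<omega>. h j \<omega> * (\<Prod>j\<in>J. h j \<omega>))"
    by (rule smooth0_mult) (use insert in auto)
  then show ?case using insert by simp
qed (simp_all add: smooth0_const)

text \<open>The base line of the shifted orbit is that of \<open>s y\<close>, so a smooth
  representative arises by composition with the local lift of the k-th iterate.\<close>

lemma smooth0_shift:
  assumes "lifts k U s" "z \<in> U" "smooth0 (s z) h"
  shows "smooth0 z (\<lambda>\<omega>. h (shift k \<omega>))"
proof -
  obtain V g where V: "open V" "s z \<in> V" "smooth_on V g"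
    and h: "\<And>y \<omega>. y \<in> V \<Longrightarrow> \<omega> \<in> orbits \<Longrightarrow> line (\<omega> 0) = line y \<Longrightarrow> h \<omega> = g y"
    using assms(3) unfolding smooth0_def by blast
  have U: "open U" "\<And>\<mu>. smooth_on U (\<lambda>y. s y $ \<mu>)"
    and orb: "\<And>y \<omega>. y \<in> U \<Longrightarrow> \<omega> \<in> orbits \<Longrightarrow> line (\<omega> 0) = line y \<Longrightarrow> line (\<omega> k) = line (s y)"
    using liftsD[OF assms(1)] by simp_all
  have U': "open (U \<inter> s -` V)"
    by (rule continuous_open_preimage[OF smooth_vec_continuous[OF U(2)] U(1) V(1)])
  show ?thesis
  proof (rule smooth0I[OF U'])
    show "z \<in> U \<inter> s -` V" using assms(2) V by simp
    show "smooth_on (U \<inter> s -` V) (\<lambda>y. g (s y))"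
      by (rule smooth_on_compose[OF U' V(1,3) _ smooth_on_subset[OF U(1) U' _ U(2)]]) auto
    fix y \<omega> assume y: "y \<in> U \<inter> s -` V" "\<omega> \<in> orbits" "line (\<omega> 0) = line y"
    then show "h (shift k \<omega>) = g (s y)" using orb by (intro h) (auto simp: shift_at)
  qed
qed

lemma unit_multiple:
  assumes "\<omega> \<in> orbits" "line (\<omega> j) = line v"
  obtains c where "\<omega> j = c *s v" "c \<noteq> 0" "c * cnj c * Q v (conj_vec v) = 1"
proof -
  obtain c where c: "c \<noteq> 0" "\<omega> j = c *s v"
    using line_eqD[OF assms(2) orbit_nonzero[OF assms(1)]] by blast
  have "c * cnj c * Q v (conj_vec v) = 1"
    using orbit_unit[OF assms(1), of j] unfolding c(2) Q_conj_vec_scale .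
  then show thesis using that c by blast
qed

text \<open>A phase of \<open>\<omega> j\<close> cancels between the two factors, so the value
  depends on the line only; at the vector \<open>s y\<close>, which need not be a unit vector, the
  squared norm has to be divided out.\<close>

lemma smooth0_sesquilinear:
  assumes "z \<noteq> 0" "line z \<in> K"
  shows "smooth0 z (\<lambda>\<omega>. Q a (\<omega> j) * cnj (Q b (\<omega> j)))"
proof -
  obtain U s where z: "z \<in> U" and s: "lifts j U s" by (rule lift_obtain[OF assms])
  have U: "open U" "z \<in> U" "\<And>\<mu>. smooth_on U (\<lambda>y. s y $ \<mu>)" and nz: "\<And>y. y \<in> U \<Longrightarrow> s y \<noteq> 0"
    and orb: "\<And>y \<omega>. y \<in> U \<Longrightarrow> \<omega> \<in> orbits \<Longrightarrow> line (\<omega> 0) = line y \<Longrightarrow> line (\<omega> j) = line (s y)"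
    using z liftsD[OF s] by simp_all
  show ?thesis
  proof (rule smooth0I[OF U(1,2)])
    show "smooth_on U (\<lambda>y. Q a (s y) * cnj (Q b (s y)) / Q (s y) (conj_vec (s y)))"
      by (intro smooth_on_divide smooth_on_mult smooth_on_cnj smooth_on_Q smooth_on_Q_conj_vec
          U Q_conj_vec_nonzero nz)
    fix y \<omega> assume y: "y \<in> U" "\<omega> \<in> orbits" "line (\<omega> 0) = line y"
    obtain c where c: "\<omega> j = c *s s y" "c * cnj c * Q (s y) (conj_vec (s y)) = 1"
      using unit_multiple[OF y(2) orb[OF y]] by metis
    have "Q (s y) (conj_vec (s y)) \<noteq> 0" by (rule Q_conj_vec_nonzero[OF nz[OF y(1)]])
    moreover have "Q a (\<omega> j) * cnj (Q b (\<omega> j)) * Q (s y) (conj_vec (s y))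
        = Q a (s y) * cnj (Q b (s y)) * (c * cnj c * Q (s y) (conj_vec (s y)))"
      unfolding c(1) Q_scale_right by simp
    ultimately show "Q a (\<omega> j) * cnj (Q b (\<omega> j))
        = Q a (s y) * cnj (Q b (s y)) / Q (s y) (conj_vec (s y))"
      unfolding c(2) by (simp add: field_simps)
  qed
qed

lemma near_Q_nonzero:
  assumes s: "lifts j U s" and z: "z \<in> U" "Q b (s z) \<noteq> 0"
  shows "near z (\<lambda>\<omega>. Q b (\<omega> j) \<noteq> 0)"
proof (rule nearI)
  let ?V = "U \<inter> (\<lambda>y. Q b (s y)) -` (- {0})"
  show "open ?V"
    by (rule continuous_open_preimage[OF smooth_on_continuous[OF smooth_on_Q[OF liftsD(1,2)[OF s]]]
          liftsD(1)[OF s]]) auto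
  show "z \<in> ?V" using z by simp
  fix y \<omega> assume y: "y \<in> ?V" "\<omega> \<in> orbits" "line (\<omega> 0) = line y"
  then have "line (\<omega> j) = line (s y)" using liftsD(5)[OF s] by simp
  then obtain c where "c \<noteq> 0" "\<omega> j = c *s s y"
    using line_eqD orbit_nonzero[OF y(2)] by blast
  then show "Q b (\<omega> j) \<noteq> 0" using y(1) by (simp add: Q_scale_right)
qed

text \<open>Scaling \<open>\<omega> j\<close> cancels in the quotient. The conjugate of
  \<open>s z\<close> serves as b because \<open>Q b (s z)\<close> is then the squared norm of
  \<open>s z\<close>.\<close>

lemma frame_exists:
  assumes "z \<noteq> 0" "line z \<in> K"
  shows "\<exists>b. near z (\<lambda>\<omega>. Q b (\<omega> j) \<noteq> 0) \<and> (\<forall>a. smooth0 z (\<lambda>\<omega>. Q a (\<omega> j) / Q b (\<omega> j)))"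
proof -
  obtain U s where z: "z \<in> U" and s: "lifts j U s" by (rule lift_obtain[OF assms])
  have U: "open U" "\<And>\<mu>. smooth_on U (\<lambda>y. s y $ \<mu>)" and nz: "\<And>y. y \<in> U \<Longrightarrow> s y \<noteq> 0"
    and orb: "\<And>y \<omega>. y \<in> U \<Longrightarrow> \<omega> \<in> orbits \<Longrightarrow> line (\<omega> 0) = line y \<Longrightarrow> line (\<omega> j) = line (s y)"
    using z liftsD[OF s] by simp_all
  define b where "b = conj_vec (s z)"
  define V where "V = U \<inter> (\<lambda>y. Q b (s y)) -` (- {0})"
  have V: "open V"
    unfolding V_def
    by (rule continuous_open_preimage[OF smooth_on_continuous[OF smooth_on_Q[OF U]] U(1)]) auto
  have zV: "z \<in> V"
    using z Q_conj_vec_nonzero[OF nz[OF z]] by (simp add: V_def b_def Q_commute)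
  have smooth: "smooth_on V (\<lambda>y. s y $ \<mu>)" for \<mu>
    by (rule smooth_on_subset[OF U(1) V _ U(2)]) (auto simp: V_def)
  have multiple: "\<exists>c. c \<noteq> 0 \<and> \<omega> j = c *s s y" if "y \<in> V" "\<omega> \<in> orbits" "line (\<omega> 0) = line y" for y \<omega>
    using unit_multiple[OF that(2) orb[OF _ that(2,3)]] that(1) unfolding V_def by blast
  have "near z (\<lambda>\<omega>. Q b (\<omega> j) \<noteq> 0)"
    by (rule near_Q_nonzero[OF s z]) (use zV in \<open>simp add: V_def\<close>)
  moreover have "smooth0 z (\<lambda>\<omega>. Q a (\<omega> j) / Q b (\<omega> j))" for a
  proof (rule smooth0I[OF V zV])
    show "smooth_on V (\<lambda>y. Q a (s y) / Q b (s y))"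
      by (intro smooth_on_divide smooth_on_Q V smooth) (simp add: V_def)
    fix y \<omega> assume y: "y \<in> V" "\<omega> \<in> orbits" "line (\<omega> 0) = line y"
    then obtain c where "c \<noteq> 0" "\<omega> j = c *s s y" using multiple by blast
    then show "Q a (\<omega> j) / Q b (\<omega> j) = Q a (s y) / Q b (s y)" by (simp add: Q_scale_right)
  qed
  ultimately show ?thesis by blast
qed

text \<open>One formula for both signs of the degree: for positive d the places 0, ..., d - 1
  contribute linear forms, as in \<open>\<xi> W\<^sup>n\<close>; for negative d the places d, ...,
  -1 contribute conjugated forms, as in \<open>W\<^sup>*\<^sup>n \<eta>\<^sup>*\<close>. The factor
  1 elsewhere permits products over any larger range.\<close>

definition fac :: "int \<Rightarrow> int \<Rightarrow> complex^4 \<Rightarrow> complex^4 \<Rightarrow> complex" where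
  "fac d j a v = (if 0 \<le> j \<and> j < d then Q a v else if d \<le> j \<and> j < 0 then cnj (Q a v) else 1)"

definition frame :: "int \<Rightarrow> (int \<Rightarrow> complex^4) \<Rightarrow> (int \<Rightarrow> complex^4) \<Rightarrow> complex" where
  "frame d Y \<omega> = (\<Prod>j\<in>{min 0 d..<max 0 d}. fac d j (Y j) (\<omega> j))"

text \<open>The forms in \<open>Y\<close> are allowed to vanish, so coordinates, products and
  adjoints have this shape at once; \<open>local_form_in_frame\<close> then passes to a nonvanishing
  frame.\<close>

definition local_form :: "int \<Rightarrow> complex^4 \<Rightarrow> ((int \<Rightarrow> complex^4) \<Rightarrow> complex) \<Rightarrow> bool" where
  "local_form d z f \<longleftrightarrow> (\<exists>h Y. smooth0 z h \<and> near z (\<lambda>\<omega>. f \<omega> = h \<omega> * frame d Y \<omega>))"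

lemma frame_superset:
  assumes "finite J" "{min 0 d..<max 0 d} \<subseteq> J"
  shows "frame d Y \<omega> = (\<Prod>j\<in>J. fac d j (Y j) (\<omega> j))"
  unfolding frame_def by (rule prod.mono_neutral_left[OF assms]) (auto simp: fac_def)

lemma frame_zero [simp]: "frame 0 Y \<omega> = 1"
  by (simp add: frame_def)

lemma local_formI: "smooth0 z h \<Longrightarrow> near z (\<lambda>\<omega>. f \<omega> = h \<omega> * frame d Y \<omega>) \<Longrightarrow> local_form d z f"
  unfolding local_form_def by blast

lemma local_form_cong:
  assumes "local_form d z f" "near z (\<lambda>\<omega>. f \<omega> = f' \<omega>)"
  shows "local_form d z f'"
proof -
  obtain h Y where h: "smooth0 z h" "near z (\<lambda>\<omega>. f \<omega> = h \<omega> * frame d Y \<omega>)"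
    using assms(1) unfolding local_form_def by blast
  show ?thesis
    by (rule local_formI[where Y = Y, OF h(1) near_mono[OF near_conj[OF h(2) assms(2)]]]) auto
qed

lemma local_form_mult0:
  assumes "smooth0 z h" "local_form d z f"
  shows "local_form d z (\<lambda>\<omega>. h \<omega> * f \<omega>)"
proof -
  obtain h' Y where h': "smooth0 z h'" "near z (\<lambda>\<omega>. f \<omega> = h' \<omega> * frame d Y \<omega>)"
    using assms(2) unfolding local_form_def by blast
  show ?thesis
    by (rule local_formI[where Y = Y, OF smooth0_mult[OF assms(1) h'(1)] near_mono[OF h'(2)]]) simp
qed

lemma good_frame_exists:
  assumes "z \<noteq> 0" "line z \<in> K"
  obtains Y where "\<And>j. near z (\<lambda>\<omega>. Q (Y j) (\<omega> j) \<noteq> 0)"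
    "\<And>j a. smooth0 z (\<lambda>\<omega>. Q a (\<omega> j) / Q (Y j) (\<omega> j))"
proof -
  have "\<forall>j. \<exists>b. near z (\<lambda>\<omega>. Q b (\<omega> j) \<noteq> 0) \<and> (\<forall>a. smooth0 z (\<lambda>\<omega>. Q a (\<omega> j) / Q b (\<omega> j)))"
    using frame_exists[OF assms] by (rule allI)
  from choice[OF this] obtain Y where "\<forall>j. near z (\<lambda>\<omega>. Q (Y j) (\<omega> j) \<noteq> 0) \<and>
      (\<forall>a. smooth0 z (\<lambda>\<omega>. Q a (\<omega> j) / Q (Y j) (\<omega> j)))"
    by (rule exE)
  then show thesis by (intro that[of Y]) simp_all
qed

text \<open>Change of frame: the quotients of corresponding factors are smooth functions of the base
  line, with a conjugate at negative places. A common frame is what makes sums possible.\<close>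

lemma local_form_in_frame:
  assumes Y: "\<And>j. near z (\<lambda>\<omega>. Q (Y j) (\<omega> j) \<noteq> 0)"
    "\<And>j a. smooth0 z (\<lambda>\<omega>. Q a (\<omega> j) / Q (Y j) (\<omega> j))"
    and "local_form d z f"
  shows "\<exists>h. smooth0 z h \<and> near z (\<lambda>\<omega>. f \<omega> = h \<omega> * frame d Y \<omega>)"
proof -
  obtain h X where h: "smooth0 z h" "near z (\<lambda>\<omega>. f \<omega> = h \<omega> * frame d X \<omega>)"
    using assms(3) unfolding local_form_def by blast
  let ?J = "{min 0 d..<max 0 d}"
  let ?r = "\<lambda>j \<omega>. fac d j (X j) (\<omega> j) / fac d j (Y j) (\<omega> j)"
  have "smooth0 z (?r j)" for j
    using smooth0_cnj[OF Y(2)[of "X j" j]] Y(2)[of "X j" j] smooth0_const[of z 1]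
    by (cases "0 \<le> j \<and> j < d"; cases "d \<le> j \<and> j < 0")
       (simp_all only: fac_def simp_thms if_True if_False complex_cnj_divide div_by_1)
  then have r: "smooth0 z (\<lambda>\<omega>. \<Prod>j\<in>?J. ?r j \<omega>)" by (rule smooth0_prod)
  have "near z (\<lambda>\<omega>. \<forall>j\<in>?J. Q (Y j) (\<omega> j) \<noteq> 0)"
    by (rule near_ball) (simp_all add: Y(1))
  then have "near z (\<lambda>\<omega>. f \<omega> = h \<omega> * frame d X \<omega> \<and> (\<forall>j\<in>?J. Q (Y j) (\<omega> j) \<noteq> 0))"
    by (rule near_conj[OF h(2)])
  then have "near z (\<lambda>\<omega>. f \<omega> = h \<omega> * (\<Prod>j\<in>?J. ?r j \<omega>) * frame d Y \<omega>)"
  proof (rule near_mono)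
    fix \<omega> assume f: "f \<omega> = h \<omega> * frame d X \<omega> \<and> (\<forall>j\<in>?J. Q (Y j) (\<omega> j) \<noteq> 0)"
    then have "(\<Prod>j\<in>?J. fac d j (Y j) (\<omega> j)) \<noteq> 0"
      by (simp add: fac_def)
    then show "f \<omega> = h \<omega> * (\<Prod>j\<in>?J. ?r j \<omega>) * frame d Y \<omega>"
      using f by (simp add: frame_def prod_dividef)
  qed
  with smooth0_mult[OF h(1) r] show ?thesis by (intro exI conjI)
qed

lemma local_form_add:
  assumes "z \<noteq> 0" "line z \<in> K" "local_form d z f" "local_form d z f'"
  shows "local_form d z (\<lambda>\<omega>. f \<omega> + f' \<omega>)"
proof -
  obtain Y where Y: "\<And>j. near z (\<lambda>\<omega>. Q (Y j) (\<omega> j) \<noteq> 0)"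
    "\<And>j a. smooth0 z (\<lambda>\<omega>. Q a (\<omega> j) / Q (Y j) (\<omega> j))"
    by (rule good_frame_exists[OF assms(1,2)]) (rule that)
  obtain h where h: "smooth0 z h" "near z (\<lambda>\<omega>. f \<omega> = h \<omega> * frame d Y \<omega>)"
    using local_form_in_frame[OF Y assms(3)] by blast
  obtain h' where h': "smooth0 z h'" "near z (\<lambda>\<omega>. f' \<omega> = h' \<omega> * frame d Y \<omega>)"
    using local_form_in_frame[OF Y assms(4)] by blast
  show ?thesis
    by (rule local_formI[where Y = Y, OF smooth0_add[OF h(1) h'(1)] near_mono[OF near_conj[OF h(2) h'(2)]]])
       (simp add: algebra_simps)
qed

text \<open>Degrees of equal sign concatenate the two frames. For opposite signs a place used by
  both carries a form times a conjugated form, which is smooth in the base line by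
  \<open>smooth0_sesquilinear\<close>; these places correspond to the metric in the product of
  \<open>W\<close> and \<open>W\<^sup>*\<close>.\<close>

lemma local_form_frame_mult:
  assumes "z \<noteq> 0" "line z \<in> K"
  shows "local_form (k + e) z (\<lambda>\<omega>. frame k Y \<omega> * frame e Y' (shift k \<omega>))"
proof -
  \<comment> \<open>Every place with a nontrivial factor in one of the three frames lies between -N
    and N, so all three become products over one range.\<close>
  define N where "N = \<bar>k\<bar> + \<bar>e\<bar>"
  define X where "X j = (if 0 \<le> j \<and> j < k \<or> k \<le> j \<and> j < 0 then Y j else Y' (j - k))" for j
  define r where "r j \<omega> = (if 0 \<le> j \<and> j < k \<and> e \<le> j - k \<and> j - k < 0
      then Q (Y j) (\<omega> j) * cnj (Q (Y' (j - k)) (\<omega> j))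
    else if k \<le> j \<and> j < 0 \<and> 0 \<le> j - k \<and> j - k < e
      then Q (Y' (j - k)) (\<omega> j) * cnj (Q (Y j) (\<omega> j)) else 1)" for j and \<omega> :: "int \<Rightarrow> complex^4"
  have r: "smooth0 z (r j)" for j
    unfolding r_def by (intro smooth0_if smooth0_sesquilinear[OF assms] smooth0_const)
  have fac: "fac k j (Y j) (\<omega> j) * fac e (j - k) (Y' (j - k)) (\<omega> j)
      = r j \<omega> * fac (k + e) j (X j) (\<omega> j)" for j \<omega>
    by (cases "0 \<le> j \<and> j < k"; cases "k \<le> j \<and> j < 0"; cases "0 \<le> j - k \<and> j - k < e";
        cases "e \<le> j - k \<and> j - k < 0") (auto simp: fac_def r_def X_def)
  have "frame k Y \<omega> * frame e Y' (shift k \<omega>) = (\<Prod>j\<in>{- N..N}. r j \<omega>) * frame (k + e) X \<omega>" for \<omega>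
  proof -
    have "frame e Y' (shift k \<omega>) = (\<Prod>j\<in>(\<lambda>j. j - k) ` {- N..N}. fac e j (Y' j) (shift k \<omega> j))"
      by (rule frame_superset)
         (auto simp: N_def image_iff intro!: bexI[of _ "x + k" for x])
    also have "\<dots> = (\<Prod>j\<in>{- N..N}. fac e (j - k) (Y' (j - k)) (\<omega> j))"
      by (subst prod.reindex) (auto simp: inj_on_def shift_at)
    finally have e: "frame e Y' (shift k \<omega>) = \<dots>" .
    have "frame k Y \<omega> = (\<Prod>j\<in>{- N..N}. fac k j (Y j) (\<omega> j))"
      "frame (k + e) X \<omega> = (\<Prod>j\<in>{- N..N}. fac (k + e) j (X j) (\<omega> j))"
      by (rule frame_superset; auto simp: N_def)+
    then show ?thesis
      unfolding e by (simp only: prod.distrib[symmetric] fac)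
  qed
  then show ?thesis
    by (intro local_formI[OF smooth0_prod[OF r]] nearI[OF open_UNIV]) auto
qed

text \<open>The second factor is evaluated at the shifted orbit, whose base line is near that of
  \<open>s z\<close> and not of z; hence the assumption on b at all points.\<close>

lemma local_form_mult:
  assumes z: "z \<noteq> 0" "line z \<in> K" and "local_form k z a"
    and b: "\<And>z. z \<noteq> 0 \<Longrightarrow> line z \<in> K \<Longrightarrow> local_form e z b"
  shows "local_form (k + e) z (\<lambda>\<omega>. a \<omega> * b (shift k \<omega>))"
proof -
  obtain U s where U: "z \<in> U" and s: "lifts k U s" by (rule lift_obtain[OF z])
  then have "s z \<noteq> 0" "line (s z) \<in> K" using z liftsD(3,4)[OF s] by simp_all
  then have "local_form e (s z) b" by (rule b)
  then obtain h' Y' where h': "smooth0 (s z) h'" "near (s z) (\<lambda>\<omega>. b \<omega> = h' \<omega> * frame e Y' \<omega>)"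
    unfolding local_form_def by blast
  obtain h Y where h: "smooth0 z h" "near z (\<lambda>\<omega>. a \<omega> = h \<omega> * frame k Y \<omega>)"
    using assms(3) unfolding local_form_def by blast
  have "local_form (k + e) z
      (\<lambda>\<omega>. (h \<omega> * h' (shift k \<omega>)) * (frame k Y \<omega> * frame e Y' (shift k \<omega>)))"
    by (intro local_form_mult0 smooth0_mult h(1) smooth0_shift[OF s U h'(1)]
        local_form_frame_mult z)
  then show ?thesis
    by (rule local_form_cong) (rule near_mono[OF near_conj[OF h(2) near_shift[OF s U h'(2)]]], simp)
qed

lemma local_form_adj:
  assumes z: "z \<noteq> 0" "line z \<in> K"
    and f: "\<And>z. z \<noteq> 0 \<Longrightarrow> line z \<in> K \<Longrightarrow> local_form d z f"
  shows "local_form (- d) z (\<lambda>\<omega>. cnj (f (shift (- d) \<omega>)))"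
proof -
  obtain U s where U: "z \<in> U" and s: "lifts (- d) U s" by (rule lift_obtain[OF z])
  then have "s z \<noteq> 0" "line (s z) \<in> K" using z liftsD(3,4)[OF s] by simp_all
  then have "local_form d (s z) f" by (rule f)
  then obtain h Y where h: "smooth0 (s z) h" "near (s z) (\<lambda>\<omega>. f \<omega> = h \<omega> * frame d Y \<omega>)"
    unfolding local_form_def by blast
  \<comment> \<open>For positive d the shift moves the places 0, ..., d - 1 to -d, ..., -1, for
    negative d the other way round; conjugation exchanges the two kinds of factors.\<close>
  have frame: "cnj (frame d Y (shift (- d) \<omega>)) = frame (- d) (\<lambda>j. Y (j + d)) \<omega>" for \<omega>
  proof -
    have "{min 0 d..<max 0 d} = (\<lambda>j. j + d) ` {min 0 (- d)..<max 0 (- d)}"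
      by (auto simp: image_iff intro!: bexI[of _ "x - d" for x])
    then have "frame d Y (shift (- d) \<omega>) = (\<Prod>j\<in>(\<lambda>j. j + d) ` {min 0 (- d)..<max 0 (- d)}.
        fac d j (Y j) (shift (- d) \<omega> j))"
      unfolding frame_def by (rule arg_cong)
    also have "\<dots> = (\<Prod>j\<in>{min 0 (- d)..<max 0 (- d)}. fac d (j + d) (Y (j + d)) (\<omega> j))"
      by (subst prod.reindex) (simp_all add: inj_on_def shift_at)
    finally show ?thesis
      by (simp only: frame_def[of "- d"] cnj_prod) (intro prod.cong refl, auto simp: fac_def)
  qed
  show ?thesis
    by (rule local_formI[where Y = "\<lambda>j. Y (j + d)", OF smooth0_cnj[OF smooth0_shift[OF s U h(1)]]
          near_mono[OF near_shift[OF s U h(2)]]]) (simp add: frame)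
qed

text \<open>Intrinsic description of the components of degree d of elements of the crossed product;
  \<open>cp_carrier_iff\<close> below shows that it is the right one.\<close>

definition homogeneous :: "int \<Rightarrow> ((int \<Rightarrow> complex^4) \<Rightarrow> complex) \<Rightarrow> bool" where
  "homogeneous d f \<longleftrightarrow> (\<forall>\<omega>. \<omega> \<notin> orbits \<longrightarrow> f \<omega> = 0) \<and>
     (\<forall>z. z \<noteq> 0 \<longrightarrow> line z \<in> K \<longrightarrow> local_form d z f)"

lemma homogeneous_zero: "homogeneous d (\<lambda>\<omega>. 0)"
  unfolding homogeneous_def
  by (auto intro!: local_formI[OF smooth0_const[of _ 0]] nearI[OF open_UNIV])

lemma homogeneous_add: "homogeneous d f \<Longrightarrow> homogeneous d f' \<Longrightarrow> homogeneous d (\<lambda>\<omega>. f \<omega> + f' \<omega>)"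
  unfolding homogeneous_def using local_form_add by simp

lemma homogeneous_sum:
  assumes "\<And>i. i \<in> I \<Longrightarrow> homogeneous d (f i)"
  shows "homogeneous d (\<lambda>\<omega>. \<Sum>i\<in>I. f i \<omega>)"
  using assms
  by (induction I rule: infinite_finite_induct) (simp_all add: homogeneous_zero homogeneous_add)

lemma homogeneous_scale: "homogeneous d f \<Longrightarrow> homogeneous d (\<lambda>\<omega>. c * f \<omega>)"
  unfolding homogeneous_def using local_form_mult0[OF smooth0_const] by simp

lemma homogeneous_mult:
  "homogeneous k a \<Longrightarrow> homogeneous e b \<Longrightarrow> homogeneous (k + e) (\<lambda>\<omega>. a \<omega> * b (shift k \<omega>))"
  unfolding homogeneous_def using local_form_mult[of _ k a e b] by simp

lemma homogeneous_adj: "homogeneous d f \<Longrightarrow> homogeneous (- d) (\<lambda>\<omega>. cnj (f (shift (- d) \<omega>)))"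
  unfolding homogeneous_def using local_form_adj[of _ d f] by simp

end

section \<open>The crossed product is a unital \<open>*\<close>-algebra\<close>

lemma lin_form_eq_Q: "lin_form Y v = Q (\<chi> \<mu>. Poly_Mapping.lookup Y [\<mu>]) v"
  by (simp add: lin_form_def Q_def)

definition form_of :: "complex^4 \<Rightarrow> free_alg" where
  "form_of a = (\<Sum>\<mu>\<in>UNIV. scl (a $ \<mu>) (gen \<mu>))"

lemma lookup_form_sum:
  "Poly_Mapping.lookup (\<Sum>\<mu>\<in>UNIV. scl (c \<mu>) (gen \<mu>)) [\<nu>] = (c :: 4 \<Rightarrow> complex) \<nu>"
proof -
  have "Poly_Mapping.lookup (\<Sum>\<mu>\<in>UNIV. scl (c \<mu>) (gen \<mu>)) [\<nu>]
      = (\<Sum>\<mu>\<in>UNIV. if \<mu> = \<nu> then c \<nu> else 0)"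
    unfolding lookup_sum by (intro sum.cong refl) (simp add: lookup_scl gen_def lookup_single when_def)
  then show ?thesis by simp
qed

lemma lin_form_form_of: "lin_form (form_of a) v = Q a v"
  by (simp add: lin_form_def form_of_def lookup_form_sum Q_def)

lemma form_of_in_gen_span: "form_of a \<in> gen_span"
  unfolding form_of_def gen_span_def by (rule rangeI)

context smooth_dynamics
begin

lemma orbit_exists:
  assumes "p \<in> K"
  obtains \<omega> where "\<omega> \<in> orbits" "line (\<omega> 0) = p"
  using unit_orbit_exists[OF proj bij assms] by blast

lemma frame_nat: "frame (int n) Y \<omega> = (\<Prod>j<n. Q (Y (int j)) (\<omega> (int j)))"
proof -
  have "{min 0 (int n)..<max 0 (int n)} = int ` {..<n}"
    using image_int_atLeastLessThan[of 0 n] by (simp add: lessThan_atLeast0)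
  then have "frame (int n) Y \<omega> = (\<Prod>j\<in>int ` {..<n}. fac (int n) j (Y j) (\<omega> j))"
    unfolding frame_def by (rule arg_cong)
  also have "\<dots> = (\<Prod>j<n. fac (int n) (int j) (Y (int j)) (\<omega> (int j)))"
    by (subst prod.reindex) (simp_all add: inj_on_def)
  also have "\<dots> = (\<Prod>j<n. Q (Y (int j)) (\<omega> (int j)))"
    by (intro prod.cong refl) (simp add: fac_def)
  finally show ?thesis .
qed

lemma orbit_segment:
  assumes "\<omega> \<in> orbits"
  shows "map (\<lambda>j. \<omega> (int j)) [0..<n] \<in> orbit_tuples \<sigma> n (line (\<omega> 0))"
  unfolding orbit_tuples_def using self_in_line by (auto simp flip: orbit_funpow[OF assms])

text \<open>The definition of smooth sections asks a form to be nonzero only on the line over z. A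
  unit orbit through z identifies that line with the one of the local lift, near which nonvanishing
  persists.\<close>

lemma near_form_nonzero:
  assumes z: "z \<noteq> 0" "line z \<in> K" and v: "v \<in> (\<sigma> ^^ j) (line z)" "Q b v \<noteq> 0"
  shows "near z (\<lambda>\<omega>. Q b (\<omega> (int j)) \<noteq> 0)"
proof -
  obtain U s where U: "z \<in> U" and s: "lifts (int j) U s" by (rule lift_obtain[OF z])
  obtain \<omega>' where "\<omega>' \<in> orbits" "line (\<omega>' 0) = line z" by (rule orbit_exists[OF z(2)])
  then have "(\<sigma> ^^ j) (line z) = line (s z)"
    using orbit_funpow[of \<omega>' j] liftsD(5)[OF s U, of \<omega>'] by simp
  then obtain c where "v = c *s s z" using v(1) by (auto simp: line_def)
  then have "Q b (s z) \<noteq> 0" using v(2) by (simp add: Q_scale_right)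
  then show ?thesis by (rule near_Q_nonzero[OF s U])
qed

text \<open>\<open>g\<close> is a function of the vector y, whereas \<open>smooth0\<close> needs a
  function of the orbit. The quotient of the component by the frame is one, and it equals
  \<open>g\<close> where the frame is nonzero; hence the restriction to
  \<open>U \<inter> V\<close>.\<close>

lemma homogeneous_mono_W:
  assumes "\<xi> \<in> smooth_sections K \<sigma> n"
  shows "homogeneous (int n) (mono_W K \<sigma> n \<xi> (int n))"
  unfolding homogeneous_def
proof (intro conjI allI impI)
  show "mono_W K \<sigma> n \<xi> (int n) \<omega> = 0" if "\<omega> \<notin> orbits" for \<omega>
    using that by (simp add: mono_W_def)
  fix z assume z: "z \<noteq> 0" "line z \<in> K"
  have "\<exists>U g Y. open U \<and> z \<in> U \<and> smooth_on U g \<and>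
         (\<forall>j<n. Y j \<in> gen_span \<and> (\<exists>v\<in>(\<sigma> ^^ j) (line z). lin_form (Y j) v \<noteq> 0)) \<and>
         (\<forall>y\<in>U. y \<noteq> 0 \<and> line y \<in> K \<longrightarrow>
           (\<forall>vs\<in>orbit_tuples \<sigma> n (line y).
             \<xi> (line y) vs = g y * (\<Prod>j<n. lin_form (Y j) (vs ! j))))"
    using assms z unfolding smooth_sections_def by simp
  then obtain U g Y where U: "open U" "z \<in> U" "smooth_on U g"
    and Y: "\<forall>j<n. Y j \<in> gen_span \<and> (\<exists>v\<in>(\<sigma> ^^ j) (line z). lin_form (Y j) v \<noteq> 0)"
    and \<xi>: "\<forall>y\<in>U. y \<noteq> 0 \<and> line y \<in> K \<longrightarrow> (\<forall>vs\<in>orbit_tuples \<sigma> n (line y).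
             \<xi> (line y) vs = g y * (\<Prod>j<n. lin_form (Y j) (vs ! j)))"
    by (elim exE conjE) (rule that)
  define Y' where "Y' j = (\<chi> \<mu>. Poly_Mapping.lookup (Y (nat j)) [\<mu>])" for j
  have frame: "frame (int n) Y' \<omega> = (\<Prod>j<n. lin_form (Y j) (\<omega> (int j)))" for \<omega>
    unfolding frame_nat by (simp add: Y'_def lin_form_eq_Q)
  have mono: "mono_W K \<sigma> n \<xi> (int n) \<omega> = g y * frame (int n) Y' \<omega>"
    if "y \<in> U" "\<omega> \<in> orbits" "line (\<omega> 0) = line y" for y \<omega>
  proof -
    have "mono_W K \<sigma> n \<xi> (int n) \<omega> = \<xi> (line y) (map (\<lambda>j. \<omega> (int j)) [0..<n])"
      using that by (simp add: mono_W_def)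
    also have "\<dots> = g y * (\<Prod>j<n. lin_form (Y j) (map (\<lambda>j. \<omega> (int j)) [0..<n] ! j))"
      using \<xi> that(1) orbit_base[OF that(2,3)] orbit_segment[OF that(2), of n] that(3) by simp
    finally show ?thesis by (simp add: frame)
  qed
  have "near z (\<lambda>\<omega>. \<forall>j\<in>{..<n}. lin_form (Y j) (\<omega> (int j)) \<noteq> 0)"
  proof (rule near_ball)
    fix j assume "j \<in> {..<n}"
    then obtain v where "v \<in> (\<sigma> ^^ j) (line z)" "lin_form (Y j) v \<noteq> 0" using Y by auto
    then show "near z (\<lambda>\<omega>. lin_form (Y j) (\<omega> (int j)) \<noteq> 0)"
      unfolding lin_form_eq_Q by (intro near_form_nonzero[OF z])
  qed simp
  then obtain V where V: "open V" "z \<in> V" and nz: "\<forall>y\<in>V. \<forall>\<omega>\<in>orbits. line (\<omega> 0) = line y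
      \<longrightarrow> (\<forall>j\<in>{..<n}. lin_form (Y j) (\<omega> (int j)) \<noteq> 0)"
    unfolding near_def by (elim exE conjE) (rule that)
  have UV: "open (U \<inter> V)" "z \<in> U \<inter> V" using U V by auto
  have nz: "frame (int n) Y' \<omega> \<noteq> 0" if "y \<in> U \<inter> V" "\<omega> \<in> orbits" "line (\<omega> 0) = line y" for y \<omega>
  proof -
    have "\<forall>j\<in>{..<n}. lin_form (Y j) (\<omega> (int j)) \<noteq> 0"
      using nz that by blast
    then show ?thesis by (simp add: frame)
  qed
  show "local_form (int n) z (mono_W K \<sigma> n \<xi> (int n))"
  proof (rule local_formI)
    show "smooth0 z (\<lambda>\<omega>. mono_W K \<sigma> n \<xi> (int n) \<omega> / frame (int n) Y' \<omega>)"
    proof (rule smooth0I[OF UV])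
      show "smooth_on (U \<inter> V) g" by (rule smooth_on_subset[OF U(1) UV(1) _ U(3)]) simp
      fix y \<omega> assume y: "y \<in> U \<inter> V" "\<omega> \<in> orbits" "line (\<omega> 0) = line y"
      then show "mono_W K \<sigma> n \<xi> (int n) \<omega> / frame (int n) Y' \<omega> = g y"
        using mono[of y \<omega>] nz[of y \<omega>] by simp
    qed
    show "near z (\<lambda>\<omega>. mono_W K \<sigma> n \<xi> (int n) \<omega>
        = mono_W K \<sigma> n \<xi> (int n) \<omega> / frame (int n) Y' \<omega> * frame (int n) Y' \<omega>)"
      by (rule nearI[OF UV]) (use nz in simp)
  qed
qed

text \<open>The converse: f is evaluated on one unit orbit for each line and extended multilinearly.
  The choice of phases does not matter, since by the local form f scales as the frame does.\<close>

lemma homogeneous_section: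
  assumes "homogeneous (int n) f"
  obtains \<xi> where "\<xi> \<in> smooth_sections K \<sigma> n" "mono_W K \<sigma> n \<xi> (int n) = f"
proof -
  define rep where "rep p = (SOME \<omega>. \<omega> \<in> orbits \<and> line (\<omega> 0) = p)" for p
  have rep: "rep p \<in> orbits" "line (rep p 0) = p" if "p \<in> K" for p
    using someI_ex[of "\<lambda>\<omega>. \<omega> \<in> orbits \<and> line (\<omega> 0) = p"] orbit_exists[OF that]
    unfolding rep_def by blast+
  \<comment> \<open>The product of the coordinates of the entries of \<open>vs\<close> with respect
    to the unit vectors of the chosen orbit, as \<open>member\<close> confirms.\<close>
  define coef where "coef p vs = (\<Prod>j<n. Q (vs ! j) (conj_vec (rep p (int j))))" for p vs
  define \<xi> where "\<xi> p vs = (if p \<in> K \<and> vs \<in> orbit_tuples \<sigma> n p then coef p vs * f (rep p) else 0)"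
    for p vs
  have member: "v = Q v (conj_vec (rep p (int j))) *s rep p (int j)"
    if p: "p \<in> K" and v: "v \<in> (\<sigma> ^^ j) p" for p v j
  proof -
    have "v \<in> line (rep p (int j))"
      using v orbit_funpow[OF rep(1)[OF p]] rep(2)[OF p] by simp
    then obtain c where c: "v = c *s rep p (int j)" by (auto simp: line_def)
    have "Q v (conj_vec (rep p (int j))) = c"
      unfolding c using orbit_unit[OF rep(1)[OF p]] Q_commute Q_scale_right by (metis mult.right_neutral)
    then show ?thesis using c by simp
  qed
  have form: "\<exists>U g Y. open U \<and> z \<in> U \<and> smooth_on U g \<and>
      (\<forall>j. \<exists>v\<in>(\<sigma> ^^ j) (line z). Q (Y (int j)) v \<noteq> 0) \<and>
      (\<forall>y\<in>U. \<forall>\<omega>\<in>orbits. line (\<omega> 0) = line y \<longrightarrow> f \<omega> = g y * frame (int n) Y \<omega>)"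
    if z: "z \<noteq> 0" "line z \<in> K" for z
  proof -
    \<comment> \<open>A smooth section must be written with forms that are nonzero over z, so f is
      put into a nonvanishing frame.\<close>
    obtain Y where Y: "\<And>j. near z (\<lambda>\<omega>. Q (Y j) (\<omega> j) \<noteq> 0)"
      "\<And>j a. smooth0 z (\<lambda>\<omega>. Q a (\<omega> j) / Q (Y j) (\<omega> j))"
      by (rule good_frame_exists[OF z]) (rule that)
    have "local_form (int n) z f" using assms z unfolding homogeneous_def by simp
    from local_form_in_frame[OF Y this] obtain h
      where h: "smooth0 z h" "near z (\<lambda>\<omega>. f \<omega> = h \<omega> * frame (int n) Y \<omega>)"
      by (elim exE conjE)
    obtain U g where U: "open U" "z \<in> U" "smooth_on U g"
      and g: "\<forall>y\<in>U. \<forall>\<omega>\<in>orbits. line (\<omega> 0) = line y \<longrightarrow> h \<omega> = g y"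
      using h(1) unfolding smooth0_def by (elim exE conjE) (rule that)
    obtain V where V: "open V" "z \<in> V" and f: "\<forall>y\<in>V. \<forall>\<omega>\<in>orbits. line (\<omega> 0) = line y
        \<longrightarrow> f \<omega> = h \<omega> * frame (int n) Y \<omega>"
      using h(2) unfolding near_def by (elim exE conjE) (rule that)
    have UV: "open (U \<inter> V)" "z \<in> U \<inter> V" using U V by auto
    have "smooth_on (U \<inter> V) g" by (rule smooth_on_subset[OF U(1) UV(1) _ U(3)]) simp
    moreover have "\<exists>v\<in>(\<sigma> ^^ j) (line z). Q (Y (int j)) v \<noteq> 0" for j
    proof -
      obtain W where W: "open W" "z \<in> W"
        "\<forall>y\<in>W. \<forall>\<omega>\<in>orbits. line (\<omega> 0) = line y \<longrightarrow> Q (Y (int j)) (\<omega> (int j)) \<noteq> 0"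
        using Y(1)[of "int j"] unfolding near_def by (elim exE conjE) (rule that)
      have "Q (Y (int j)) (rep (line z) (int j)) \<noteq> 0"
        using W(2,3) rep[OF z(2)] by blast
      moreover have "rep (line z) (int j) \<in> (\<sigma> ^^ j) (line z)"
        using orbit_funpow[OF rep(1)[OF z(2)], of j] rep(2)[OF z(2)] self_in_line by metis
      ultimately show ?thesis by (rule bexI)
    qed
    moreover have "\<forall>y\<in>U \<inter> V. \<forall>\<omega>\<in>orbits. line (\<omega> 0) = line y
        \<longrightarrow> f \<omega> = g y * frame (int n) Y \<omega>"
      using f g by (metis IntD1 IntD2)
    ultimately show ?thesis using UV by (intro exI conjI allI)
  qed
  have "\<xi> \<in> sections K \<sigma> n"
    unfolding sections_def
  proof (intro CollectI conjI allI ballI impI)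
    show "\<xi> p vs = 0" if "\<not> (p \<in> K \<and> vs \<in> orbit_tuples \<sigma> n p)" for p vs
      using that by (auto simp: \<xi>_def)
    fix p vs j c assume p: "p \<in> K" and vs: "vs \<in> orbit_tuples \<sigma> n p" and j: "j < n"
    have "c *s (vs ! j) \<in> (\<sigma> ^^ j) p"
    proof -
      have "(\<sigma> ^^ j) p = line (rep p (int j))"
        using orbit_funpow[OF rep(1)[OF p], of j] rep(2)[OF p] by simp
      moreover have "vs ! j \<in> (\<sigma> ^^ j) p" using vs j by (simp add: orbit_tuples_def)
      ultimately show ?thesis by (auto simp: line_def vector_smult_assoc)
    qed
    then have vs': "vs[j := c *s vs ! j] \<in> orbit_tuples \<sigma> n p"
      using vs j by (auto simp: orbit_tuples_def nth_list_update)
    have len: "length vs = n" using vs by (simp add: orbit_tuples_def)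
    have "Q (vs[j := c *s vs ! j] ! i) w = (if i = j then c else 1) * Q (vs ! i) w" if "i < n" for i w
      using that len j by (simp add: nth_list_update Q_def sum_distrib_left mult_ac)
    then have "coef p (vs[j := c *s vs ! j])
        = (\<Prod>i<n. (if i = j then c else 1) * Q (vs ! i) (conj_vec (rep p (int i))))"
      unfolding coef_def by (intro prod.cong refl) simp
    also have "\<dots> = c * coef p vs"
      unfolding prod.distrib coef_def using j by (simp add: prod.delta)
    finally show "\<xi> p (vs[j := c *s vs ! j]) = c * \<xi> p vs"
      using p vs vs' by (simp add: \<xi>_def)
  qed
  moreover have "\<exists>U g Y. open U \<and> z \<in> U \<and> smooth_on U g \<and>
         (\<forall>j<n. Y j \<in> gen_span \<and> (\<exists>v\<in>(\<sigma> ^^ j) (line z). lin_form (Y j) v \<noteq> 0)) \<and>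
         (\<forall>y\<in>U. y \<noteq> 0 \<and> line y \<in> K \<longrightarrow>
           (\<forall>vs\<in>orbit_tuples \<sigma> n (line y).
             \<xi> (line y) vs = g y * (\<Prod>j<n. lin_form (Y j) (vs ! j))))"
    if z: "z \<noteq> 0 \<and> line z \<in> K" for z
  proof -
    obtain U g Y where U: "open U" "z \<in> U" "smooth_on U g"
      and Y: "\<forall>j. \<exists>v\<in>(\<sigma> ^^ j) (line z). Q (Y (int j)) v \<noteq> 0"
      and f: "\<forall>y\<in>U. \<forall>\<omega>\<in>orbits. line (\<omega> 0) = line y \<longrightarrow> f \<omega> = g y * frame (int n) Y \<omega>"
      using form[OF conjunct1[OF z] conjunct2[OF z]] by (elim exE conjE) (rule that)
    have "\<xi> (line y) vs = g y * (\<Prod>j<n. lin_form (form_of (Y (int j))) (vs ! j))"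
      if y: "y \<in> U" "line y \<in> K" and vs: "vs \<in> orbit_tuples \<sigma> n (line y)" for y vs
    proof -
      let ?\<omega> = "rep (line y)"
      have "Q (Y (int j)) (vs ! j)
          = Q (vs ! j) (conj_vec (?\<omega> (int j))) * Q (Y (int j)) (?\<omega> (int j))" if "j < n" for j
      proof -
        have "vs ! j \<in> (\<sigma> ^^ j) (line y)" using vs that by (simp add: orbit_tuples_def)
        then show ?thesis using member[OF y(2)] Q_scale_right by metis
      qed
      then have "(\<Prod>j<n. Q (Y (int j)) (vs ! j)) = coef (line y) vs * frame (int n) Y ?\<omega>"
        unfolding coef_def frame_nat prod.distrib[symmetric] by (intro prod.cong refl) simp
      moreover have "f ?\<omega> = g y * frame (int n) Y ?\<omega>"
        using f y rep[OF y(2)] by simp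
      ultimately show ?thesis
        using y(2) vs by (simp add: \<xi>_def lin_form_form_of)
    qed
    moreover have "form_of (Y (int j)) \<in> gen_span \<and>
        (\<exists>v\<in>(\<sigma> ^^ j) (line z). lin_form (form_of (Y (int j))) v \<noteq> 0)" for j
      using Y by (simp add: form_of_in_gen_span lin_form_form_of)
    ultimately show ?thesis
      using U by (intro exI[of _ U] exI[of _ g] exI[of _ "\<lambda>j. form_of (Y (int j))"]) simp
  qed
  ultimately have "\<xi> \<in> smooth_sections K \<sigma> n" unfolding smooth_sections_def by simp
  moreover have "mono_W K \<sigma> n \<xi> (int n) \<omega> = f \<omega>" for \<omega>
  proof (cases "\<omega> \<in> orbits")
    case False
    then show ?thesis using assms by (simp add: mono_W_def homogeneous_def)
  next
    case True
    let ?p = "line (\<omega> 0)"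
    have p: "?p \<in> K" by (rule orbit_in_K[OF True])
    obtain U g Y where "\<omega> 0 \<in> U"
      and f: "\<forall>y\<in>U. \<forall>\<omega>\<in>orbits. line (\<omega> 0) = line y \<longrightarrow> f \<omega> = g y * frame (int n) Y \<omega>"
      using form[OF orbit_nonzero[OF True] p] by (elim exE conjE) (rule that)
    then have f: "f \<omega> = g (\<omega> 0) * frame (int n) Y \<omega>"
      "f (rep ?p) = g (\<omega> 0) * frame (int n) Y (rep ?p)"
      using True rep[OF p] by blast+
    \<comment> \<open>An arbitrary orbit over the same line differs from the chosen one by scalars;
      the frame picks up exactly the factor \<open>coef\<close>, and so does f.\<close>
    have "Q (Y (int j)) (\<omega> (int j))
        = Q (\<omega> (int j)) (conj_vec (rep ?p (int j))) * Q (Y (int j)) (rep ?p (int j))" for j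
    proof -
      have "\<omega> (int j) \<in> (\<sigma> ^^ j) ?p" using orbit_funpow[OF True, of j] self_in_line by metis
      then show ?thesis using member[OF p] Q_scale_right by metis
    qed
    then have "frame (int n) Y \<omega>
        = (\<Prod>j<n. Q (\<omega> (int j)) (conj_vec (rep ?p (int j)))) * frame (int n) Y (rep ?p)"
      unfolding frame_nat prod.distrib[symmetric] by (intro prod.cong refl)
    then show ?thesis
      using True p f orbit_segment[OF True, of n] by (simp add: mono_W_def \<xi>_def coef_def)
  qed
  ultimately show thesis using that by blast
qed

section \<open>The algebra operations, degree by degree\<close>

abbreviation CP :: "cp_elem star_algebra" where
  "CP \<equiv> crossed_product K \<sigma>"

abbreviation CP_mult (infixl "\<star>" 70) where
  "a \<star> b \<equiv> a \<otimes>\<^bsub>CP\<^esub> b"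

lemma CP_simps:
  "carrier CP = cp_carrier K \<sigma>" "\<zero>\<^bsub>CP\<^esub> = (\<lambda>d \<omega>. 0)" "\<one>\<^bsub>CP\<^esub> = mono_W K \<sigma> 0 (fun_section K (\<lambda>p. 1))"
  "a \<oplus>\<^bsub>CP\<^esub> b = (\<lambda>d \<omega>. a d \<omega> + b d \<omega>)" "c \<odot>\<^bsub>CP\<^esub> a = (\<lambda>d \<omega>. c * a d \<omega>)"
  "adj CP a = (\<lambda>d \<omega>. cnj (a (- d) (shift d \<omega>)))"
  "a \<star> b = (\<lambda>d \<omega>. \<Sum>k | a k \<omega> \<noteq> 0. a k \<omega> * b (d - k) (shift k \<omega>))"
  by (simp_all add: crossed_product_def)

definition smooth_element :: "cp_elem \<Rightarrow> bool" where
  "smooth_element a \<longleftrightarrow> (\<exists>F. finite F \<and> (\<forall>d. d \<notin> F \<longrightarrow> a d = (\<lambda>\<omega>. 0))) \<and> (\<forall>d. homogeneous d (a d))"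

lemma smooth_elementD:
  assumes "smooth_element a"
  shows "homogeneous d (a d)" "\<exists>F. finite F \<and> (\<forall>d. d \<notin> F \<longrightarrow> a d = (\<lambda>\<omega>. 0))"
  using assms unfolding smooth_element_def by simp_all

lemma smooth_elementI:
  assumes "finite F" "\<And>d. d \<notin> F \<Longrightarrow> a d = (\<lambda>\<omega>. 0)" "\<And>d. homogeneous d (a d)"
  shows "smooth_element a"
  using assms unfolding smooth_element_def by blast

lemma smooth_element_add:
  assumes "smooth_element a" "smooth_element b"
  shows "smooth_element (\<lambda>d \<omega>. a d \<omega> + b d \<omega>)"
proof -
  obtain F where F: "finite F" "\<forall>d. d \<notin> F \<longrightarrow> a d = (\<lambda>\<omega>. 0)" using smooth_elementD(2)[OF assms(1)] by blast
  obtain G where G: "finite G" "\<forall>d. d \<notin> G \<longrightarrow> b d = (\<lambda>\<omega>. 0)" using smooth_elementD(2)[OF assms(2)] by blast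
  show ?thesis
    by (rule smooth_elementI[of "F \<union> G"])
       (use F G assms in \<open>auto intro: homogeneous_add smooth_elementD\<close>)
qed

lemma smooth_element_adj:
  assumes "smooth_element a"
  shows "smooth_element (\<lambda>d \<omega>. cnj (a (- d) (shift d \<omega>)))"
proof -
  obtain F where F: "finite F" "\<forall>d. d \<notin> F \<longrightarrow> a d = (\<lambda>\<omega>. 0)" using smooth_elementD(2)[OF assms] by blast
  show ?thesis
  proof (rule smooth_elementI[of "uminus ` F"])
    show "(\<lambda>\<omega>. cnj (a (- d) (shift d \<omega>))) = (\<lambda>\<omega>. 0)" if "d \<notin> uminus ` F" for d
    proof -
      have "- d \<notin> F" using that by force
      then show ?thesis using F(2) by simp
    qed
    show "homogeneous d (\<lambda>\<omega>. cnj (a (- d) (shift d \<omega>)))" for d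
      using homogeneous_adj[OF smooth_elementD(1)[OF assms, of "- d"]] by simp
  qed (use F in simp)
qed

lemma smooth_element_mono_W:
  assumes "\<xi> \<in> smooth_sections K \<sigma> n"
  shows "smooth_element (mono_W K \<sigma> n \<xi>)"
proof (rule smooth_elementI[of "{int n}"])
  show "homogeneous d (mono_W K \<sigma> n \<xi> d)" for d
  proof (cases "d = int n")
    case False
    then have "mono_W K \<sigma> n \<xi> d = (\<lambda>\<omega>. 0)" by (simp add: mono_W_def)
    then show ?thesis using homogeneous_zero by simp
  qed (use homogeneous_mono_W[OF assms] in simp)
qed (simp_all add: mono_W_def)

lemma mono_Wstar_eq: "mono_Wstar K \<sigma> n \<eta> = (\<lambda>d \<omega>. cnj (mono_W K \<sigma> n \<eta> (- d) (shift d \<omega>)))"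
  using adj_mono_W[OF proj bij, of n \<eta>] by (simp add: CP_simps)

lemma smooth_element_mono_Wstar:
  "\<eta> \<in> smooth_sections K \<sigma> n \<Longrightarrow> smooth_element (mono_Wstar K \<sigma> n \<eta>)"
  unfolding mono_Wstar_eq by (rule smooth_element_adj[OF smooth_element_mono_W])

text \<open>Products of monomials are awkward to write as monomials again, while homogeneous
  components are closed under products and adjoints. That they come from monomials is shown by
  splitting off one degree at a time.\<close>

lemma cp_carrier_iff: "a \<in> cp_carrier K \<sigma> \<longleftrightarrow> smooth_element a"
proof
  assume "a \<in> cp_carrier K \<sigma>"
  then show "smooth_element a"
  proof induction
    case zero
    then show ?case by (rule smooth_elementI[of "{}"]) (simp_all add: homogeneous_zero)
  qed (simp_all add: smooth_element_add smooth_element_mono_W smooth_element_mono_Wstar)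
next
  assume a: "smooth_element a"
  then obtain F where F: "finite F" "\<forall>d. d \<notin> F \<longrightarrow> a d = (\<lambda>\<omega>. 0)"
    using smooth_elementD(2) by blast
  have "\<forall>d. homogeneous d (a d)" using a smooth_elementD(1) by blast
  with F show "a \<in> cp_carrier K \<sigma>"
  proof (induction F arbitrary: a rule: finite_induct)
    case empty
    then have "a = (\<lambda>d \<omega>. 0)" by (simp add: fun_eq_iff)
    then show ?case by (simp add: cp_carrier.zero)
  next
    case (insert e F)
    define b where "b = a(e := (\<lambda>\<omega>. 0))"
    have "b \<in> cp_carrier K \<sigma>"
      by (rule insert.IH) (use insert.prems in \<open>auto simp: b_def homogeneous_zero\<close>)
    have e: "homogeneous e (a e)" using insert.prems by blast
    show ?case
    proof (cases "0 \<le> e")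
      case True
      then obtain n where n: "e = int n" by (metis nonneg_eq_int)
      obtain \<xi> where \<xi>: "\<xi> \<in> smooth_sections K \<sigma> n" "mono_W K \<sigma> n \<xi> (int n) = a e"
        by (rule homogeneous_section[OF e[unfolded n]]) (use n in blast)
      have "a d \<omega> = mono_W K \<sigma> n \<xi> d \<omega> + b d \<omega>" for d \<omega>
      proof (cases "d = e")
        case True
        then show ?thesis using \<xi>(2) n by (simp add: b_def)
      qed (simp add: b_def mono_W_def n)
      then have "a = (\<lambda>d \<omega>. mono_W K \<sigma> n \<xi> d \<omega> + b d \<omega>)" by (intro ext)
      then show ?thesis using cp_carrier.add_mono_W[OF \<xi>(1) \<open>b \<in> _\<close>] by simp
    next
      case False
      then obtain n where n: "e = - int n" by (metis int_cases2 nonneg_int_cases nle_le of_nat_0_le_iff)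
      \<comment> \<open>A negative degree is reduced to a positive one: \<eta> is the section of the
        adjoint of this component.\<close>
      have "homogeneous (int n) (\<lambda>\<omega>. cnj (a e (shift (int n) \<omega>)))"
        using homogeneous_adj[OF e] n by simp
      then obtain \<eta> where \<eta>: "\<eta> \<in> smooth_sections K \<sigma> n"
        "mono_W K \<sigma> n \<eta> (int n) = (\<lambda>\<omega>. cnj (a e (shift (int n) \<omega>)))"
        by (rule homogeneous_section) blast
      have "a d \<omega> = mono_Wstar K \<sigma> n \<eta> d \<omega> + b d \<omega>" for d \<omega>
      proof (cases "d = e")
        case True
        then show ?thesis using \<eta>(2) n by (simp add: b_def mono_Wstar_eq shift_shift)
      qed (simp add: b_def mono_Wstar_def n)
      then have "a = (\<lambda>d \<omega>. mono_Wstar K \<sigma> n \<eta> d \<omega> + b d \<omega>)" by (intro ext)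
      then show ?thesis using cp_carrier.add_mono_Wstar[OF \<eta>(1) \<open>b \<in> _\<close>] by simp
    qed
  qed
qed

text \<open>The sum that defines the product runs over the degrees that are nonzero at the given
  orbit. A finite set independent of the orbit lets such sums be compared, reindexed and
  exchanged.\<close>

definition supported :: "int set \<Rightarrow> cp_elem \<Rightarrow> bool" where
  "supported F a \<longleftrightarrow> finite F \<and> (\<forall>k. k \<notin> F \<longrightarrow> a k = (\<lambda>\<omega>. 0))"

lemma supportedD: "supported F a \<Longrightarrow> finite F" "supported F a \<Longrightarrow> k \<notin> F \<Longrightarrow> a k = (\<lambda>\<omega>. 0)"
  by (simp_all add: supported_def)

lemma supportedI: "finite F \<Longrightarrow> (\<And>k. k \<notin> F \<Longrightarrow> a k = (\<lambda>\<omega>. 0)) \<Longrightarrow> supported F a"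
  by (simp add: supported_def)

lemma mult_finite:
  assumes "supported F a"
  shows "(a \<star> b) d \<omega> = (\<Sum>k\<in>F. a k \<omega> * b (d - k) (shift k \<omega>))"
  unfolding CP_simps by (rule sum.mono_neutral_left) (use supportedD[OF assms] in \<open>auto dest: fun_cong\<close>)

lemma carrier_support:
  assumes "a \<in> carrier CP"
  obtains F where "supported F a"
  using assms smooth_elementD(2) unfolding CP_simps cp_carrier_iff supported_def by blast

lemma carrier_off_orbits: "a \<in> carrier CP \<Longrightarrow> \<omega> \<notin> orbits \<Longrightarrow> a d \<omega> = 0"
  using smooth_elementD(1) unfolding CP_simps cp_carrier_iff homogeneous_def by blast

lemma mult_support:
  assumes "supported F a" "supported G b" "d \<notin> (\<lambda>(k, e). k + e) ` (F \<times> G)"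
  shows "(a \<star> b) d = (\<lambda>\<omega>. 0)"
proof
  fix \<omega>
  have b: "b (d - k) = (\<lambda>\<omega>. 0)" if "k \<in> F" for k
  proof (rule supportedD(2)[OF assms(2)], rule notI)
    assume "d - k \<in> G"
    then have "(k, d - k) \<in> F \<times> G" using that by simp
    then have "k + (d - k) \<in> (\<lambda>(k, e). k + e) ` (F \<times> G)" by (metis (no_types, lifting) case_prod_conv imageI)
    then show False using assms(3) by simp
  qed
  then show "(a \<star> b) d \<omega> = 0"
    unfolding mult_finite[OF assms(1)] by (intro sum.neutral ballI) (simp add: b)
qed

lemma mult_closed:
  assumes "a \<in> carrier CP" "b \<in> carrier CP"
  shows "a \<star> b \<in> carrier CP"
proof -
  obtain F where F: "supported F a" using carrier_support[OF assms(1)] by blast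
  obtain G where G: "supported G b" using carrier_support[OF assms(2)] by blast
  have a: "homogeneous d (a d)" and b: "homogeneous d (b d)" for d
    using assms smooth_elementD(1) unfolding CP_simps cp_carrier_iff by blast+
  have "smooth_element (a \<star> b)"
  proof (rule smooth_elementI[of "(\<lambda>(k, e). k + e) ` (F \<times> G)"])
    show "(a \<star> b) d = (\<lambda>\<omega>. 0)" if "d \<notin> (\<lambda>(k, e). k + e) ` (F \<times> G)" for d
      by (rule mult_support[OF F G that])
    fix d
    have "homogeneous d (\<lambda>\<omega>. a k \<omega> * b (d - k) (shift k \<omega>))" for k
      using homogeneous_mult[OF a[of k] b[of "d - k"]] by simp
    then have "homogeneous d (\<lambda>\<omega>. \<Sum>k\<in>F. a k \<omega> * b (d - k) (shift k \<omega>))"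
      by (rule homogeneous_sum)
    moreover have "(a \<star> b) d = (\<lambda>\<omega>. \<Sum>k\<in>F. a k \<omega> * b (d - k) (shift k \<omega>))"
      by (intro ext mult_finite[OF F])
    ultimately show "homogeneous d ((a \<star> b) d)" by simp
  qed (use F G in \<open>simp add: supported_def\<close>)
  then show ?thesis by (simp only: CP_simps(1) cp_carrier_iff)
qed

lemma CP_mult_assoc:
  assumes "a \<in> carrier CP" "b \<in> carrier CP" "c \<in> carrier CP"
  shows "(a \<star> b) \<star> c = a \<star> (b \<star> c)"
proof (intro ext)
  fix d \<omega>
  obtain F where F: "supported F a" using carrier_support[OF assms(1)] by blast
  obtain G where G: "supported G b" using carrier_support[OF assms(2)] by blast
  let ?H = "(\<lambda>(k, e). k + e) ` (F \<times> G)"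
  have H: "finite ?H" using F G by (simp add: supported_def)
  have "((a \<star> b) \<star> c) d \<omega> = (\<Sum>m\<in>?H. (a \<star> b) m \<omega> * c (d - m) (shift m \<omega>))"
    by (rule mult_finite[OF supportedI[OF H mult_support[OF F G]]])
  also have "\<dots> = (\<Sum>m\<in>?H. \<Sum>k\<in>F. a k \<omega> * b (m - k) (shift k \<omega>) * c (d - m) (shift m \<omega>))"
    unfolding mult_finite[OF F] sum_distrib_right ..
  also have "\<dots> = (\<Sum>k\<in>F. \<Sum>m\<in>?H. a k \<omega> * b (m - k) (shift k \<omega>) * c (d - m) (shift m \<omega>))"
    by (rule sum.swap)
  also have "\<dots> = (\<Sum>k\<in>F. a k \<omega> * (b \<star> c) (d - k) (shift k \<omega>))"
  proof (rule sum.cong[OF refl])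
    fix k assume k: "k \<in> F"
    \<comment> \<open>For fixed k only the degrees m = k + e with e in \<open>G\<close> contribute,
      and the inner sum becomes the product of b and c.\<close>
    have sub: "(+) k ` G \<subseteq> ?H" using k by force
    have "(\<Sum>m\<in>?H. a k \<omega> * b (m - k) (shift k \<omega>) * c (d - m) (shift m \<omega>))
        = (\<Sum>m\<in>(+) k ` G. a k \<omega> * b (m - k) (shift k \<omega>) * c (d - m) (shift m \<omega>))"
    proof (rule sum.mono_neutral_right[OF H sub], rule ballI)
      fix m assume "m \<in> ?H - (+) k ` G"
      then have "m - k \<notin> G" by (metis DiffD2 add.commute diff_add_cancel imageI)
      then show "a k \<omega> * b (m - k) (shift k \<omega>) * c (d - m) (shift m \<omega>) = 0"
        using supportedD(2)[OF G] by simp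
    qed
    also have "\<dots> = (\<Sum>e\<in>G. a k \<omega> * b e (shift k \<omega>) * c (d - (k + e)) (shift (k + e) \<omega>))"
      by (subst sum.reindex) simp_all
    also have "\<dots> = a k \<omega> * (b \<star> c) (d - k) (shift k \<omega>)"
      unfolding mult_finite[OF G] sum_distrib_left
      by (intro sum.cong refl) (simp add: shift_shift algebra_simps)
    finally show "(\<Sum>m\<in>?H. a k \<omega> * b (m - k) (shift k \<omega>) * c (d - m) (shift m \<omega>))
        = a k \<omega> * (b \<star> c) (d - k) (shift k \<omega>)" .
  qed
  also have "\<dots> = (a \<star> (b \<star> c)) d \<omega>"
    by (rule mult_finite[OF F, symmetric])
  finally show "((a \<star> b) \<star> c) d \<omega> = (a \<star> (b \<star> c)) d \<omega>" .
qed

lemma CP_adj_mult: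
  assumes "a \<in> carrier CP" "b \<in> carrier CP"
  shows "adj CP (a \<star> b) = adj CP b \<star> adj CP a"
proof (intro ext)
  fix d \<omega>
  obtain F where F: "supported F a" using carrier_support[OF assms(1)] by blast
  obtain G where G: "supported G b" using carrier_support[OF assms(2)] by blast
  \<comment> \<open>Large enough to contain the degrees of the adjoint of b and, moved by d, those
    of a: the substitution of k - d for k then matches both sides over one index set.\<close>
  define M where "M = uminus ` G \<union> (\<lambda>k. k + d) ` F"
  have M: "finite M" "finite ((\<lambda>k. k - d) ` M)" using F G by (simp_all add: M_def supported_def)
  have b': "supported M (adj CP b)"
  proof (rule supportedI[OF M(1)])
    fix k assume "k \<notin> M"
    then have "- k \<notin> G" unfolding M_def by force
    then show "adj CP b k = (\<lambda>\<omega>. 0)" using supportedD(2)[OF G] by (simp add: CP_simps)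
  qed
  have a': "supported ((\<lambda>k. k - d) ` M) a"
  proof (rule supportedI[OF M(2)], rule supportedD(2)[OF F], rule notI)
    fix k assume k: "k \<notin> (\<lambda>k. k - d) ` M" "k \<in> F"
    then have "k + d \<in> M" unfolding M_def by blast
    then have "(k + d) - d \<in> (\<lambda>k. k - d) ` M" by (rule imageI)
    then show False using k(1) by simp
  qed
  have "adj CP (a \<star> b) d \<omega>
      = cnj (\<Sum>k\<in>(\<lambda>k. k - d) ` M. a k (shift d \<omega>) * b (- d - k) (shift k (shift d \<omega>)))"
    unfolding CP_simps(6) mult_finite[OF a'] ..
  also have "\<dots> = (\<Sum>k\<in>M. cnj (b (- k) (shift k \<omega>)) * cnj (a (k - d) (shift d \<omega>)))"
    by (subst sum.reindex) (simp_all add: inj_on_def shift_shift mult_ac)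
  also have "\<dots> = (adj CP b \<star> adj CP a) d \<omega>"
    unfolding mult_finite[OF b'] by (simp add: CP_simps(6) shift_shift)
  finally show "adj CP (a \<star> b) d \<omega> = (adj CP b \<star> adj CP a) d \<omega>" .
qed

lemma CP_one: "\<one>\<^bsub>CP\<^esub> = (\<lambda>d \<omega>. if d = 0 \<and> \<omega> \<in> orbits then 1 else 0)"
  by (auto simp: CP_simps mono_W_def fun_section_def fun_eq_iff orbit_in_K)

lemma CP_one_closed: "\<one>\<^bsub>CP\<^esub> \<in> carrier CP"
  unfolding CP_simps(1) cp_carrier_iff
proof (rule smooth_elementI[of "{0}"])
  fix d
  show "homogeneous d (\<one>\<^bsub>CP\<^esub> d)"
  proof (cases "d = 0")
    case True
    have "local_form 0 z (\<lambda>\<omega>. if \<omega> \<in> orbits then 1 else 0)" for z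
      by (rule local_formI[OF smooth0_const[of _ 1]], rule nearI[OF open_UNIV]) simp_all
    then show ?thesis using True by (simp add: CP_one homogeneous_def)
  qed (simp add: CP_one homogeneous_zero)
qed (simp_all add: CP_one)

text \<open>The unit is the indicator of the unit orbits in degree 0; it acts as the identity
  because elements of the carrier vanish off the unit orbits.\<close>

lemma CP_one_mult:
  assumes "a \<in> carrier CP"
  shows "\<one>\<^bsub>CP\<^esub> \<star> a = a" "a \<star> \<one>\<^bsub>CP\<^esub> = a"
proof -
  show "\<one>\<^bsub>CP\<^esub> \<star> a = a"
  proof (intro ext)
    fix d \<omega>
    have "(\<one>\<^bsub>CP\<^esub> \<star> a) d \<omega> = (\<Sum>k\<in>{0}. \<one>\<^bsub>CP\<^esub> k \<omega> * a (d - k) (shift k \<omega>))"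
      by (rule mult_finite) (simp add: CP_one supported_def)
    then show "(\<one>\<^bsub>CP\<^esub> \<star> a) d \<omega> = a d \<omega>"
      using carrier_off_orbits[OF assms, of \<omega> d] by (simp add: CP_one)
  qed
  obtain F where F: "supported F a" using carrier_support[OF assms] by blast
  show "a \<star> \<one>\<^bsub>CP\<^esub> = a"
  proof (intro ext)
    fix d \<omega>
    \<comment> \<open>Adding d guarantees that the only term that can be nonzero, k = d, belongs to
      the sum.\<close>
    have F': "supported (insert d F) a" using F by (simp add: supported_def)
    have "(a \<star> \<one>\<^bsub>CP\<^esub>) d \<omega>
        = (\<Sum>k\<in>insert d F. if k = d then a d \<omega> * (if \<omega> \<in> orbits then 1 else 0) else 0)"
      unfolding mult_finite[OF F'] by (intro sum.cong refl) (auto simp: CP_one)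
    also have "\<dots> = a d \<omega> * (if \<omega> \<in> orbits then 1 else 0)"
      using supportedD(1)[OF F'] by simp
    finally show "(a \<star> \<one>\<^bsub>CP\<^esub>) d \<omega> = a d \<omega>"
      using carrier_off_orbits[OF assms, of \<omega> d] by simp
  qed
qed

lemma CP_add_closed: "a \<in> carrier CP \<Longrightarrow> b \<in> carrier CP \<Longrightarrow> a \<oplus>\<^bsub>CP\<^esub> b \<in> carrier CP"
  unfolding CP_simps(1,4) cp_carrier_iff by (rule smooth_element_add)

lemma CP_smult_closed: "a \<in> carrier CP \<Longrightarrow> c \<odot>\<^bsub>CP\<^esub> a \<in> carrier CP"
proof -
  assume a: "a \<in> carrier CP"
  obtain F where F: "supported F a" using carrier_support[OF a] by blast
  have "homogeneous d (a d)" for d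
    using a smooth_elementD(1) unfolding CP_simps cp_carrier_iff by blast
  then show ?thesis
    unfolding CP_simps(1,5) cp_carrier_iff
    by (intro smooth_elementI[OF supportedD(1)[OF F]])
       (simp_all add: supportedD(2)[OF F] homogeneous_scale)
qed

lemma CP_distrib:
  assumes "a \<in> carrier CP" "b \<in> carrier CP" "c \<in> carrier CP"
  shows "(a \<oplus>\<^bsub>CP\<^esub> b) \<star> c = a \<star> c \<oplus>\<^bsub>CP\<^esub> b \<star> c"
    "c \<star> (a \<oplus>\<^bsub>CP\<^esub> b) = c \<star> a \<oplus>\<^bsub>CP\<^esub> c \<star> b"
proof -
  obtain F where F: "supported F a" using carrier_support[OF assms(1)] by blast
  obtain G where G: "supported G b" using carrier_support[OF assms(2)] by blast
  obtain H where H: "supported H c" using carrier_support[OF assms(3)] by blast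
  have "((a \<oplus>\<^bsub>CP\<^esub> b) \<star> c) d \<omega> = (a \<star> c) d \<omega> + (b \<star> c) d \<omega>" for d \<omega>
  proof -
    have "((a \<oplus>\<^bsub>CP\<^esub> b) \<star> c) d \<omega>
        = (\<Sum>k\<in>F \<union> G. (a \<oplus>\<^bsub>CP\<^esub> b) k \<omega> * c (d - k) (shift k \<omega>))"
      by (rule mult_finite) (use F G in \<open>simp add: CP_simps(4) supported_def\<close>)
    moreover have "(a \<star> c) d \<omega> = (\<Sum>k\<in>F \<union> G. a k \<omega> * c (d - k) (shift k \<omega>))"
      by (rule mult_finite) (use F G in \<open>simp add: supported_def\<close>)
    moreover have "(b \<star> c) d \<omega> = (\<Sum>k\<in>F \<union> G. b k \<omega> * c (d - k) (shift k \<omega>))"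
      by (rule mult_finite) (use F G in \<open>simp add: supported_def\<close>)
    ultimately show ?thesis by (simp add: CP_simps(4) algebra_simps sum.distrib)
  qed
  then show "(a \<oplus>\<^bsub>CP\<^esub> b) \<star> c = a \<star> c \<oplus>\<^bsub>CP\<^esub> b \<star> c"
    by (intro ext) (simp only: CP_simps(4))
  show "c \<star> (a \<oplus>\<^bsub>CP\<^esub> b) = c \<star> a \<oplus>\<^bsub>CP\<^esub> c \<star> b"
    by (intro ext) (simp only: CP_simps(4) mult_finite[OF H] distrib_left sum.distrib)
qed

lemma CP_smult_mult:
  assumes "a \<in> carrier CP" "b \<in> carrier CP"
  shows "(c \<odot>\<^bsub>CP\<^esub> a) \<star> b = c \<odot>\<^bsub>CP\<^esub> (a \<star> b)"
    "a \<star> (c \<odot>\<^bsub>CP\<^esub> b) = c \<odot>\<^bsub>CP\<^esub> (a \<star> b)"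
proof -
  obtain F where F: "supported F a" using carrier_support[OF assms(1)] by blast
  have "((c \<odot>\<^bsub>CP\<^esub> a) \<star> b) d \<omega> = c * (a \<star> b) d \<omega>" for d \<omega>
  proof -
    have "((c \<odot>\<^bsub>CP\<^esub> a) \<star> b) d \<omega> = (\<Sum>k\<in>F. (c \<odot>\<^bsub>CP\<^esub> a) k \<omega> * b (d - k) (shift k \<omega>))"
      by (rule mult_finite) (use F in \<open>simp add: CP_simps(5) supported_def\<close>)
    then show ?thesis by (simp add: mult_finite[OF F] CP_simps(5) sum_distrib_left mult_ac)
  qed
  then show "(c \<odot>\<^bsub>CP\<^esub> a) \<star> b = c \<odot>\<^bsub>CP\<^esub> (a \<star> b)"
    by (intro ext) (simp only: CP_simps(5))
  show "a \<star> (c \<odot>\<^bsub>CP\<^esub> b) = c \<odot>\<^bsub>CP\<^esub> (a \<star> b)"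
    by (intro ext) (simp only: CP_simps(5) mult_finite[OF F] sum_distrib_left mult.left_commute)
qed

lemma CP_ring: "ring CP"
proof (rule ringI)
  show "abelian_group CP"
  proof (rule abelian_groupI)
    show "\<exists>b\<in>carrier CP. b \<oplus>\<^bsub>CP\<^esub> a = \<zero>\<^bsub>CP\<^esub>" if "a \<in> carrier CP" for a
      by (rule bexI[OF _ CP_smult_closed[OF that, of "-1"]]) (simp add: CP_simps)
    show "a \<oplus>\<^bsub>CP\<^esub> b \<in> carrier CP" if "a \<in> carrier CP" "b \<in> carrier CP" for a b
      using that by (rule CP_add_closed)
    show "\<zero>\<^bsub>CP\<^esub> \<in> carrier CP" by (simp add: CP_simps cp_carrier.zero)
  qed (simp_all add: CP_simps(2,4) add_ac)
  show "Group.monoid CP"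
    by (rule Group.monoidI) (simp_all add: mult_closed CP_one_closed CP_mult_assoc CP_one_mult)
qed (simp_all only: CP_distrib)

lemma CP_star_algebra: "unital_star_algebra CP"
proof -
  interpret ring CP by (rule CP_ring)
  show ?thesis
  proof
    show "adj CP a \<in> carrier CP" if "a \<in> carrier CP" for a
      using that smooth_element_adj unfolding CP_simps(1,6) cp_carrier_iff by blast
    show "adj CP (a \<star> b) = adj CP b \<star> adj CP a"
      if "a \<in> carrier CP" "b \<in> carrier CP" for a b
      using that by (rule CP_adj_mult)
    show "(c \<odot>\<^bsub>CP\<^esub> a) \<star> b = c \<odot>\<^bsub>CP\<^esub> (a \<star> b)"
      "a \<star> (c \<odot>\<^bsub>CP\<^esub> b) = c \<odot>\<^bsub>CP\<^esub> (a \<star> b)"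
      if "a \<in> carrier CP" "b \<in> carrier CP" for a b c
      using that by (rule CP_smult_mult)+
  qed (simp_all only: CP_smult_closed, simp_all add: CP_simps(4-6) shift_shift algebra_simps)
qed

end

section \<open>The universal property of presented \<open>*\<close>-algebras\<close>

lemma free_alg_expand: "a = (\<Sum>w\<in>Poly_Mapping.keys a. Poly_Mapping.single w (Poly_Mapping.lookup a w))"
  for a :: free_alg
proof (rule poly_mapping_eqI)
  fix v
  have "Poly_Mapping.lookup (\<Sum>w\<in>Poly_Mapping.keys a. Poly_Mapping.single w (Poly_Mapping.lookup a w)) v
      = (\<Sum>w\<in>Poly_Mapping.keys a. if w = v then Poly_Mapping.lookup a v else 0)"
    unfolding lookup_sum by (intro sum.cong refl) (simp add: lookup_single when_def)
  also have "\<dots> = Poly_Mapping.lookup a v"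
    by (simp add: in_keys_iff)
  finally show "Poly_Mapping.lookup a v = Poly_Mapping.lookup
      (\<Sum>w\<in>Poly_Mapping.keys a. Poly_Mapping.single w (Poly_Mapping.lookup a w)) v" ..
qed

lemma free_alg_induct [case_names zero single add]:
  assumes "P 0" "\<And>w c. P (Poly_Mapping.single w c)" "\<And>a b. P a \<Longrightarrow> P b \<Longrightarrow> P (a + b)"
  shows "P (a :: free_alg)"
proof -
  have "P (\<Sum>w\<in>F. Poly_Mapping.single w (Poly_Mapping.lookup a w))" if "finite F" for F
    using that by (induction F rule: finite_induct) (simp_all add: assms)
  from this[OF finite_keys[of a]] show ?thesis
    using free_alg_expand[of a] by simp
qed

lemma lookup_free_adj: "Poly_Mapping.lookup (free_adj a) w = cnj (Poly_Mapping.lookup a (rev w))"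
proof -
  have "Poly_Mapping.lookup (free_adj a) w
      = (\<Sum>v\<in>Poly_Mapping.keys a. if v = rev w then cnj (Poly_Mapping.lookup a (rev w)) else 0)"
    unfolding free_adj_def lookup_sum
    by (intro sum.cong refl) (auto simp: lookup_single when_def)
  then show ?thesis by (simp add: in_keys_iff)
qed

lemma free_adj_add: "free_adj (a + b) = free_adj a + free_adj b"
  by (rule poly_mapping_eqI) (simp add: lookup_free_adj lookup_add)

lemma free_adj_zero [simp]: "free_adj 0 = 0"
  by (rule poly_mapping_eqI) (simp add: lookup_free_adj)

lemma free_adj_diff: "free_adj (a - b) = free_adj a - free_adj b"
  by (rule poly_mapping_eqI) (simp add: lookup_free_adj lookup_minus)

lemma free_adj_scl: "free_adj (scl c a) = scl (cnj c) (free_adj a)"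
  by (rule poly_mapping_eqI) (simp add: lookup_free_adj lookup_scl)

lemma free_adj_free_adj [simp]: "free_adj (free_adj a) = a"
  by (rule poly_mapping_eqI) (simp add: lookup_free_adj)

lemma free_adj_single: "free_adj (Poly_Mapping.single w c) = Poly_Mapping.single (rev w) (cnj c)"
  by (rule poly_mapping_eqI) (auto simp: lookup_free_adj lookup_single when_def)

lemma free_adj_mult: "free_adj (a * b) = free_adj b * free_adj a"
proof (induction a rule: free_alg_induct)
  case (single w c)
  show ?case
  proof (induction b rule: free_alg_induct)
    case (single v d)
    show ?case by (simp add: mult_single free_adj_single plus_list_def mult.commute)
  qed (simp_all add: free_adj_add distrib_left distrib_right)
qed (simp_all add: free_adj_add distrib_left distrib_right)

lemma scl_add: "scl c (a + b) = scl c a + scl c b"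
  by (rule poly_mapping_eqI) (simp add: lookup_scl lookup_add algebra_simps)

lemma scl_diff: "scl c (a - b) = scl c a - scl c b"
  by (rule poly_mapping_eqI) (simp add: lookup_scl lookup_minus algebra_simps)

lemma scl_add_left: "scl (c + d) a = scl c a + scl d a"
  by (rule poly_mapping_eqI) (simp add: lookup_scl lookup_add algebra_simps)

lemma scl_scl: "scl c (scl d a) = scl (c * d) a"
  by (rule poly_mapping_eqI) (simp add: lookup_scl)

lemma scl_zero_right [simp]: "scl c 0 = 0"
  by (rule poly_mapping_eqI) (simp add: lookup_scl)

lemma scl_single: "scl c (Poly_Mapping.single w d) = Poly_Mapping.single w (c * d)"
  by (rule poly_mapping_eqI) (simp add: lookup_scl lookup_single when_def)

lemma diff_conv_scl: "a - b = a + scl (- 1) b"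
  by (rule poly_mapping_eqI) (simp add: lookup_scl lookup_add lookup_minus)

lemma mult_scl:
  shows scl_mult_left: "scl c a * b = scl c (a * b)"
    and scl_mult_right: "a * scl c b = scl c (a * b)"
proof -
  show "scl c a * b = scl c (a * b)"
  proof (induction a rule: free_alg_induct)
    case (single w d)
    show ?case
      by (induction b rule: free_alg_induct)
         (simp_all add: scl_single mult_single scl_add distrib_left mult_ac)
  qed (simp_all add: scl_add distrib_right)
  show "a * scl c b = scl c (a * b)"
  proof (induction a rule: free_alg_induct)
    case (single w d)
    show ?case
      by (induction b rule: free_alg_induct)
         (simp_all add: scl_single mult_single scl_add distrib_left mult_ac)
  qed (simp_all add: scl_add distrib_right)
qed

text \<open>Writes scaling as a two-sided product, under which \<open>star_ideal\<close> is closed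
  by definition; so the ideal is a complex subspace.\<close>

lemma scl_conv_mult: "scl c a = scl c 1 * a * 1"
  by (simp add: scl_mult_left)

lemma star_ideal_scl: "a \<in> star_ideal S \<Longrightarrow> scl c a \<in> star_ideal S"
  by (subst scl_conv_mult) (rule star_ideal.mult)

lemma star_ideal_diff: "a \<in> star_ideal S \<Longrightarrow> b \<in> star_ideal S \<Longrightarrow> a - b \<in> star_ideal S"
  unfolding diff_conv_scl by (intro star_ideal.add star_ideal_scl)

lemma star_ideal_mult_left: "a \<in> star_ideal S \<Longrightarrow> b * a \<in> star_ideal S"
  using star_ideal.mult[of a S b 1] by simp

lemma star_ideal_mult_right: "a \<in> star_ideal S \<Longrightarrow> a * b \<in> star_ideal S"
  using star_ideal.mult[of a S 1 b] by simp

lemma mem_cls: "b \<in> cls S a \<longleftrightarrow> b - a \<in> star_ideal S"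
  by (simp add: cls_def)

lemma self_mem_cls: "a \<in> cls S a"
  by (simp add: mem_cls star_ideal.zero)

lemma cls_eq_iff: "cls S a = cls S b \<longleftrightarrow> a - b \<in> star_ideal S"
proof
  assume "cls S a = cls S b"
  then show "a - b \<in> star_ideal S" using self_mem_cls[of a S] by (simp add: mem_cls)
next
  assume ab: "a - b \<in> star_ideal S"
  have "c - a \<in> star_ideal S \<longleftrightarrow> c - b \<in> star_ideal S" for c
    using star_ideal.add[OF _ ab, of "c - a"] star_ideal_diff[OF _ ab, of "c - b"] by auto
  then show "cls S a = cls S b" by (auto simp: mem_cls)
qed

text \<open>The operations of \<open>presented_alg\<close> are unions over all representatives. Once
  the resulting class does not depend on them, this evaluates the union.\<close>

lemma UN_const_value:
  assumes "X \<noteq> {}" "\<And>a. a \<in> X \<Longrightarrow> f a = c"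
  shows "(\<Union>a\<in>X. f a) = c"
  using assms by auto

lemma cls_nonempty: "cls S a \<noteq> {}"
  using self_mem_cls by blast

section \<open>Operations on classes\<close>

context
  fixes S :: "free_alg set"
begin

abbreviation PA :: "free_alg set star_algebra" where
  "PA \<equiv> presented_alg S"

lemma PA_carrier: "carrier PA = range (cls S)"
  by (simp add: presented_alg_def)

lemma PA_one: "\<one>\<^bsub>PA\<^esub> = cls S 1" and PA_zero: "\<zero>\<^bsub>PA\<^esub> = cls S 0"
  by (simp_all add: presented_alg_def)

lemma PA_add: "cls S a \<oplus>\<^bsub>PA\<^esub> cls S b = cls S (a + b)"
proof -
  have "cls S (a' + b') = cls S (a + b)" if "a' \<in> cls S a" "b' \<in> cls S b" for a' b'
  proof -
    have "(a' - a) + (b' - b) \<in> star_ideal S" using that by (intro star_ideal.add) (simp_all add: mem_cls)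
    then show ?thesis by (simp add: cls_eq_iff algebra_simps)
  qed
  then show ?thesis
    unfolding presented_alg_def by (simp add: UN_const_value[OF cls_nonempty] cls_nonempty)
qed

lemma PA_mult: "cls S a \<otimes>\<^bsub>PA\<^esub> cls S b = cls S (a * b)"
proof -
  have "cls S (a' * b') = cls S (a * b)" if "a' \<in> cls S a" "b' \<in> cls S b" for a' b'
  proof -
    have "(a' - a) * b' + a * (b' - b) \<in> star_ideal S"
      using that by (intro star_ideal.add star_ideal_mult_left star_ideal_mult_right) (simp_all add: mem_cls)
    then show ?thesis by (simp add: cls_eq_iff algebra_simps)
  qed
  then show ?thesis
    unfolding presented_alg_def by (simp add: UN_const_value[OF cls_nonempty] cls_nonempty)
qed

lemma PA_smult: "c \<odot>\<^bsub>PA\<^esub> cls S a = cls S (scl c a)"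
proof -
  have "cls S (scl c a') = cls S (scl c a)" if "a' \<in> cls S a" for a'
    using that star_ideal_scl[of "a' - a" S c] by (simp add: cls_eq_iff mem_cls scl_diff)
  then show ?thesis
    unfolding presented_alg_def by (simp add: UN_const_value[OF cls_nonempty] cls_nonempty)
qed

lemma PA_adj: "adj PA (cls S a) = cls S (free_adj a)"
proof -
  have "cls S (free_adj a') = cls S (free_adj a)" if "a' \<in> cls S a" for a'
    using that star_ideal.adj[of "a' - a" S] by (simp add: cls_eq_iff mem_cls free_adj_diff)
  then show ?thesis
    unfolding presented_alg_def by (simp add: UN_const_value[OF cls_nonempty] cls_nonempty)
qed

lemmas PA_ops = PA_one PA_zero PA_add PA_mult PA_smult PA_adj

lemma PA_ring: "ring PA"
proof (rule ringI)
  show "abelian_group PA"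
  proof (rule abelian_groupI)
    show "\<exists>Y\<in>carrier PA. Y \<oplus>\<^bsub>PA\<^esub> X = \<zero>\<^bsub>PA\<^esub>" if X: "X \<in> carrier PA" for X
    proof -
      from X obtain a where "X = cls S a" by (auto simp: PA_carrier)
      then show ?thesis
        by (intro bexI[of _ "cls S (- a)"]) (simp_all add: PA_carrier PA_ops)
    qed
  qed (auto simp: PA_carrier PA_ops add_ac)
  show "Group.monoid PA"
    by (rule Group.monoidI) (auto simp: PA_carrier PA_ops mult.assoc)
qed (auto simp: PA_carrier PA_ops distrib_left distrib_right)

lemma PA_star_algebra: "unital_star_algebra PA"
proof -
  interpret ring PA by (rule PA_ring)
  show ?thesis
    by standard
       (auto simp: PA_carrier PA_ops scl_add scl_add_left scl_scl scl_mult_left scl_mult_right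
         free_adj_add free_adj_scl free_adj_mult)
qed

end

lemma single_Cons: "Poly_Mapping.single (\<mu> # w) 1 = gen \<mu> * Poly_Mapping.single w 1"
  by (simp add: gen_def mult_single plus_list_def)

lemma single_Nil: "Poly_Mapping.single [] 1 = (1 :: free_alg)"
  using single_one[where 'a = "4 list"] by (simp add: zero_list_def)

text \<open>Agreement passes from letters to words by multiplicativity and from words to everything
  by linearity.\<close>

lemma star_hom_eq_on_generators:
  assumes "unital_star_hom (presented_alg S) B \<theta>" "unital_star_hom (presented_alg S) B \<theta>'"
    and gen: "\<And>\<mu>. \<theta> (cls S (gen \<mu>)) = \<theta>' (cls S (gen \<mu>))"
  shows "\<theta> (cls S a) = \<theta>' (cls S a)"
proof -
  interpret h: unital_star_hom "presented_alg S" B \<theta> by fact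
  interpret h': unital_star_hom "presented_alg S" B \<theta>' by fact
  have carrier: "cls S b \<in> carrier (presented_alg S)" for b by (simp add: PA_carrier)
  have mult: "\<theta> (cls S (b * c)) = \<theta> (cls S b) \<otimes>\<^bsub>B\<^esub> \<theta> (cls S c)"
    "\<theta>' (cls S (b * c)) = \<theta>' (cls S b) \<otimes>\<^bsub>B\<^esub> \<theta>' (cls S c)" for b c
    using ring_hom_mult[OF h.hom_ring carrier carrier, of b c]
      ring_hom_mult[OF h'.hom_ring carrier carrier, of b c] by (simp_all add: PA_ops)
  have add: "\<theta> (cls S (b + c)) = \<theta> (cls S b) \<oplus>\<^bsub>B\<^esub> \<theta> (cls S c)"
    "\<theta>' (cls S (b + c)) = \<theta>' (cls S b) \<oplus>\<^bsub>B\<^esub> \<theta>' (cls S c)" for b c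
    using ring_hom_add[OF h.hom_ring carrier carrier, of b c]
      ring_hom_add[OF h'.hom_ring carrier carrier, of b c] by (simp_all add: PA_ops)
  have scl: "\<theta> (cls S (scl c b)) = c \<odot>\<^bsub>B\<^esub> \<theta> (cls S b)"
    "\<theta>' (cls S (scl c b)) = c \<odot>\<^bsub>B\<^esub> \<theta>' (cls S b)" for b c
    using h.hom_smult[OF carrier, of c b] h'.hom_smult[OF carrier, of c b] by (simp_all add: PA_ops)
  have one: "\<theta> (cls S 1) = \<theta>' (cls S 1)"
    using ring_hom_one[OF h.hom_ring] ring_hom_one[OF h'.hom_ring] by (simp add: PA_ops)
  have monomial: "\<theta> (cls S (Poly_Mapping.single w 1)) = \<theta>' (cls S (Poly_Mapping.single w 1))" for w
    by (induction w) (simp_all add: single_Nil one single_Cons mult gen)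
  show ?thesis
  proof (induction a rule: free_alg_induct)
    case zero
    \<comment> \<open>0 is treated as the multiple 0 of 1, so agreement at 1 suffices.\<close>
    show ?case using scl[of 0 1] one by simp
  next
    case (single w c)
    have "Poly_Mapping.single w c = scl c (Poly_Mapping.single w 1)" by (simp add: scl_single)
    then show ?case by (simp add: scl monomial)
  qed (simp add: add)
qed

section \<open>Evaluation of noncommutative polynomials at self-adjoint elements\<close>

context unital_star_algebra
begin

lemma smult_zero_left: "x \<in> carrier A \<Longrightarrow> 0 \<odot> x = \<zero>"
proof -
  assume x: "x \<in> carrier A"
  have c: "0 \<odot> x \<in> carrier A" by (rule smult_closed[OF x])
  have "0 \<odot> x \<oplus> 0 \<odot> x = 0 \<odot> x" using smult_l_distr[OF x, of 0 0] by simp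
  then show ?thesis using c by (simp add: add.r_cancel_one')
qed

lemma smult_zero_right: "c \<odot> \<zero> = \<zero>"
  using smult_assoc[OF one_closed, of c 0] smult_zero_left[OF one_closed] by simp

lemma smult_left_commute: "x \<in> carrier A \<Longrightarrow> c \<odot> (d \<odot> x) = d \<odot> (c \<odot> x)"
  using smult_assoc[of x c d] smult_assoc[of x d c] by (simp add: mult.commute)

lemma adj_zero: "adj A \<zero> = \<zero>"
  using adj_smult[OF one_closed, of 0] smult_zero_left[OF one_closed]
    smult_zero_left[OF adj_closed[OF one_closed]] by simp

text \<open>Not among the axioms: it comes from the reversal of products together with
  involutivity.\<close>

lemma adj_one: "adj A \<one> = \<one>"
proof -
  have "adj A \<one> = adj A \<one> \<otimes> adj A (adj A \<one>)"
    using adj_adj[OF one_closed] adj_closed[OF one_closed] by simp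
  also have "\<dots> = adj A (adj A \<one> \<otimes> \<one>)"
    using adj_mult[OF adj_closed[OF one_closed] one_closed] by simp
  also have "\<dots> = \<one>" using adj_adj[OF one_closed] adj_closed[OF one_closed] by simp
  finally show ?thesis .
qed

end

text \<open>Self-adjointness of the \<open>x \<mu>\<close> makes evaluation compatible with
  \<open>free_adj\<close>, which reverses a word and leaves its letters alone.\<close>

locale star_generators = unital_star_algebra A for A (structure) +
  fixes x :: "4 \<Rightarrow> 'a"
  assumes x_closed: "x \<mu> \<in> carrier A" and x_adj: "adj A (x \<mu>) = x \<mu>"
begin

primrec word :: "4 list \<Rightarrow> 'a" where
  "word [] = \<one>"
| "word (\<mu> # w) = x \<mu> \<otimes> word w"

definition lift :: "free_alg \<Rightarrow> 'a" where
  "lift a = (\<Oplus>w\<in>Poly_Mapping.keys a. Poly_Mapping.lookup a w \<odot> word w)"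

lemma word_closed [simp]: "word w \<in> carrier A"
  by (induction w) (simp_all add: x_closed)

lemma word_append: "word (v @ w) = word v \<otimes> word w"
  by (induction v) (simp_all add: x_closed m_assoc)

lemma word_rev: "word (rev w) = adj A (word w)"
  by (induction w) (simp_all add: adj_one word_append adj_mult x_closed x_adj)

lemma lift_superset:
  assumes "finite F" "Poly_Mapping.keys a \<subseteq> F"
  shows "lift a = (\<Oplus>w\<in>F. Poly_Mapping.lookup a w \<odot> word w)"
  unfolding lift_def
  by (rule add.finprod_mono_neutral_cong_left)
     (use assms in \<open>auto simp: in_keys_iff smult_zero_left smult_closed\<close>)

lemma lift_closed [simp]: "lift a \<in> carrier A"
  unfolding lift_def by (rule finsum_closed) (simp add: smult_closed)

lemma lift_add: "lift (a + b) = lift a \<oplus> lift b"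
proof -
  let ?F = "Poly_Mapping.keys a \<union> Poly_Mapping.keys b"
  have "lift (a + b) = (\<Oplus>w\<in>?F. Poly_Mapping.lookup (a + b) w \<odot> word w)"
    by (rule lift_superset[OF _ keys_add]) simp
  also have "\<dots> = (\<Oplus>w\<in>?F. Poly_Mapping.lookup a w \<odot> word w \<oplus> Poly_Mapping.lookup b w \<odot> word w)"
    by (rule finsum_cong') (auto simp: lookup_add smult_l_distr smult_closed)
  also have "\<dots> = (\<Oplus>w\<in>?F. Poly_Mapping.lookup a w \<odot> word w)
      \<oplus> (\<Oplus>w\<in>?F. Poly_Mapping.lookup b w \<odot> word w)"
    by (rule finsum_addf) (auto simp: smult_closed)
  also have "\<dots> = lift a \<oplus> lift b"
    using lift_superset[of ?F a] lift_superset[of ?F b] by simp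
  finally show ?thesis .
qed

lemma lift_zero [simp]: "lift 0 = \<zero>"
  by (simp add: lift_def)

lemma lift_single: "lift (Poly_Mapping.single w c) = c \<odot> word w"
  using lift_superset[of "{w}" "Poly_Mapping.single w c"] by (simp add: smult_closed)

lemma lift_scl: "lift (scl c a) = c \<odot> lift a"
proof (induction a rule: free_alg_induct)
  case zero
  show ?case by (simp add: smult_zero_right)
qed (simp_all add: scl_single lift_single smult_assoc scl_add lift_add smult_r_distr)

lemma lift_mult: "lift (a * b) = lift a \<otimes> lift b"
proof (induction a rule: free_alg_induct)
  case (single w c)
  show ?case
  proof (induction b rule: free_alg_induct)
    case (single v d)
    show ?case
      by (simp add: mult_single lift_single plus_list_def word_append smult_mult_left
          smult_mult_right smult_closed smult_assoc smult_left_commute[of _ c d])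
  qed (simp_all add: distrib_left lift_add r_distr)
qed (simp_all add: distrib_right lift_add l_distr)

lemma lift_adj: "lift (free_adj a) = adj A (lift a)"
proof (induction a rule: free_alg_induct)
  case zero
  show ?case by (simp add: adj_zero)
qed (simp_all add: free_adj_single lift_single adj_smult word_rev free_adj_add lift_add adj_add)

lemma lift_one [simp]: "lift 1 = \<one>"
  using lift_single[of "[]" 1] by (simp add: single_Nil smult_one)

lemma lift_gen [simp]: "lift (gen \<mu>) = x \<mu>"
  by (simp add: gen_def lift_single x_closed smult_one)

lemma lift_star_ideal:
  assumes "\<And>s. s \<in> S \<Longrightarrow> lift s = \<zero>" "a \<in> star_ideal S"
  shows "lift a = \<zero>"
  using assms(2)
proof induction
  case (adj a)
  then show ?case using lift_adj[of a] lift_adj[of 0] by simp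
qed (simp_all add: assms(1) lift_add lift_mult)

lemma presented_alg_universal:
  assumes "\<And>s. s \<in> S \<Longrightarrow> lift s = \<zero>"
  shows "\<exists>\<theta>. \<theta> \<in> extensional (carrier (presented_alg S)) \<and>
    unital_star_hom (presented_alg S) A \<theta> \<and> (\<forall>a. \<theta> (cls S a) = lift a)"
proof -
  \<comment> \<open>By \<open>lift_star_ideal\<close> the value does not depend on the chosen
    representative; the restriction to the carrier fixes the values elsewhere, so that uniqueness
    can hold.\<close>
  define \<theta> where "\<theta> = restrict (\<lambda>X. lift (SOME a. X = cls S a)) (carrier (presented_alg S))"
  have lift_eq: "lift a = lift b" if "cls S a = cls S b" for a b
  proof -
    have "a - b \<in> star_ideal S" using that by (simp add: cls_eq_iff)
    then have "lift (a - b) = \<zero>" by (rule lift_star_ideal[rotated]) (rule assms)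
    then have "lift (b + (a - b)) = lift b" by (simp only: lift_add lift_closed r_zero)
    then show ?thesis by simp
  qed
  have \<theta>: "\<theta> (cls S a) = lift a" for a
  proof -
    have "cls S a = cls S (SOME b. cls S a = cls S b)" by (rule someI[of _ a]) simp
    then have "lift (SOME b. cls S a = cls S b) = lift a" by (rule lift_eq[OF sym])
    then show ?thesis unfolding \<theta>_def by (simp add: PA_carrier)
  qed
  interpret P: unital_star_algebra "presented_alg S" by (rule PA_star_algebra)
  have "\<theta> \<in> ring_hom (presented_alg S) A"
    by (rule ring_hom_memI) (auto simp: PA_carrier PA_ops \<theta> lift_mult lift_add)
  then have "unital_star_hom (presented_alg S) A \<theta>"
    by unfold_locales (auto simp: PA_carrier PA_ops \<theta> lift_scl lift_adj)
  then show ?thesis using \<theta> by (intro exI[of _ \<theta>]) (simp add: \<theta>_def)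
qed

end

section \<open>The homomorphism\<close>

lemma annihilated_zero: "annihilated \<phi> (\<lambda>\<mu> \<nu>. 0)"
  by (rule annihilatedI) simp

lemma annihilated_scale:
  assumes "annihilated \<phi> t"
  shows "annihilated \<phi> (\<lambda>\<mu> \<nu>. c * t \<mu> \<nu>)"
proof (rule annihilatedI)
  fix k l m :: 4 assume "(k, l, m) \<in> cyc"
  note d = annihilatedD[OF assms this]
  have "S_coef \<phi> k * (c * t 0 k) = c * (S_coef \<phi> k * t 0 k)"
    "S_coef \<phi> k * (c * t k 0) = c * (S_coef \<phi> k * t k 0)" by simp_all
  then show "S_coef \<phi> k * (c * t 0 k) = \<i> * (C_coef \<phi> l * (c * t l m) - C_coef \<phi> m * (c * t m l)) \<and>
      S_coef \<phi> k * (c * t k 0) = \<i> * (C_coef \<phi> m * (c * t l m) - C_coef \<phi> l * (c * t m l))"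
    unfolding d by (simp add: algebra_simps)
qed

text \<open>The coefficients are real. Conjugation replaces \<i> by - \<i>, transposition exchanges
  the two conditions of each triple, and together they restore the original system.\<close>

lemma annihilated_adjoint:
  assumes "annihilated \<phi> t"
  shows "annihilated \<phi> (\<lambda>\<mu> \<nu>. cnj (t \<nu> \<mu>))"
proof (rule annihilatedI)
  fix k l m :: 4 assume "(k, l, m) \<in> cyc"
  note d = annihilatedD[OF assms this]
  have real: "cnj (S_coef \<phi> \<mu>) = S_coef \<phi> \<mu>" "cnj (C_coef \<phi> \<mu>) = C_coef \<phi> \<mu>" for \<mu>
    by (simp_all add: S_coef_def C_coef_def)
  have "S_coef \<phi> k * cnj (t k 0) = cnj (S_coef \<phi> k * t k 0)"
    "S_coef \<phi> k * cnj (t 0 k) = cnj (S_coef \<phi> k * t 0 k)" by (simp_all add: real)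
  then show "S_coef \<phi> k * cnj (t k 0)
        = \<i> * (C_coef \<phi> l * cnj (t m l) - C_coef \<phi> m * cnj (t l m)) \<and>
      S_coef \<phi> k * cnj (t 0 k)
        = \<i> * (C_coef \<phi> m * cnj (t m l) - C_coef \<phi> l * cnj (t l m))"
    unfolding d by (simp add: real algebra_simps)
qed

lemma Q_axis: "Q (axis \<mu> 1) v = v $ \<mu>"
proof -
  have "axis \<mu> 1 $ \<nu> * v $ \<nu> = (if \<nu> = \<mu> then v $ \<mu> else 0)" for \<nu>
    by (simp add: axis_def)
  then show ?thesis by (simp add: Q_def)
qed

context smooth_dynamics
begin

text \<open>The image of \<open>x\<^sup>\<mu>\<close>, that is \<open>(X\<^sup>\<mu> W + W\<^sup>* (X\<^sup>\<mu>)\<^sup>*) / sqrt 2\<close>.\<close>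

definition theta_gen :: "4 \<Rightarrow> cp_elem" where
  "theta_gen \<mu> d \<omega> = (if \<omega> \<notin> orbits then 0 else if d = 1 then of_real (1 / sqrt 2) * \<omega> 0 $ \<mu>
     else if d = - 1 then of_real (1 / sqrt 2) * cnj (\<omega> (- 1) $ \<mu>) else 0)"

text \<open>The coordinate is itself a frame of degree 1 with a constant coefficient;
  \<open>local_form\<close> tolerates its zeros.\<close>

lemma homogeneous_coordinate: "homogeneous 1 (\<lambda>\<omega>. if \<omega> \<notin> orbits then 0 else c * \<omega> 0 $ \<mu>)"
  unfolding homogeneous_def
proof (intro conjI allI impI)
  fix z :: "complex^4"
  have "frame 1 (\<lambda>_. axis \<mu> 1) \<omega> = \<omega> 0 $ \<mu>" for \<omega>
    using frame_nat[of 1 "\<lambda>_. axis \<mu> 1" \<omega>] by (simp add: Q_axis)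
  then show "local_form 1 z (\<lambda>\<omega>. if \<omega> \<notin> orbits then 0 else c * \<omega> 0 $ \<mu>)"
    by (intro local_formI[where Y = "\<lambda>_. axis \<mu> 1", OF smooth0_const[of _ c]] nearI[OF open_UNIV]) simp_all
qed simp

lemma theta_gen_supported: "supported {1, - 1} (theta_gen \<mu>)"
  by (rule supportedI) (auto simp: theta_gen_def)

lemma theta_gen_closed: "theta_gen \<mu> \<in> carrier CP"
  unfolding CP_simps(1) cp_carrier_iff
proof (rule smooth_elementI[OF supportedD[OF theta_gen_supported]])
  let ?f = "\<lambda>\<omega>. if \<omega> \<notin> orbits then 0 else of_real (1 / sqrt 2) * \<omega> 0 $ \<mu>"
  fix d :: int
  consider "d = 1" | "d = - 1" | "d \<noteq> 1" "d \<noteq> - 1" by blast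
  then show "homogeneous d (theta_gen \<mu> d)"
  proof cases
    case 1
    then have "theta_gen \<mu> d = ?f" by (auto simp: theta_gen_def fun_eq_iff)
    then show ?thesis using homogeneous_coordinate[of "of_real (1 / sqrt 2)" \<mu>] 1 by simp
  next
    case 2
    then have "theta_gen \<mu> d = (\<lambda>\<omega>. cnj (?f (shift (- 1) \<omega>)))"
      by (auto simp: theta_gen_def fun_eq_iff shift_at)
    then show ?thesis
      using homogeneous_adj[OF homogeneous_coordinate[of "of_real (1 / sqrt 2)" \<mu>]] 2 by simp
  next
    case 3
    then have "theta_gen \<mu> d = (\<lambda>\<omega>. 0)" by (auto simp: theta_gen_def fun_eq_iff)
    then show ?thesis using homogeneous_zero by simp
  qed
qed

lemma theta_gen_adj: "adj CP (theta_gen \<mu>) = theta_gen \<mu>"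
  by (auto simp: CP_simps(6) theta_gen_def fun_eq_iff shift_at)

lemma star_generators_theta: "star_generators CP theta_gen"
  by (intro star_generators.intro CP_star_algebra star_generators_axioms.intro theta_gen_closed
      theta_gen_adj)

text \<open>The right factor is taken at the orbit shifted by the degree of the left one. In degree
  0 the products \<open>W W\<^sup>*\<close> and \<open>W\<^sup>* W\<close> contribute, at the places
  0 and -1.\<close>

lemma theta_gen_mult:
  "(theta_gen \<mu> \<star> theta_gen \<nu>) d \<omega> = (if \<omega> \<notin> orbits then 0 else 1 / 2 *
     (if d = 2 then \<omega> 0 $ \<mu> * \<omega> 1 $ \<nu>
      else if d = 0 then \<omega> 0 $ \<mu> * cnj (\<omega> 0 $ \<nu>) + cnj (\<omega> (- 1) $ \<mu>) * \<omega> (- 1) $ \<nu>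
      else if d = - 2 then cnj (\<omega> (- 1) $ \<mu>) * cnj (\<omega> (- 2) $ \<nu>) else 0))"
proof -
  have half: "complex_of_real (1 / sqrt 2) * complex_of_real (1 / sqrt 2) = 1 / 2"
    by (simp add: of_real_mult[symmetric] del: of_real_mult)
  have half': "complex_of_real (1 / sqrt 2) * x * (complex_of_real (1 / sqrt 2) * y) = 1 / 2 * (x * y)"
    for x y unfolding half[symmetric] by (simp only: mult_ac)
  show ?thesis
    unfolding mult_finite[OF theta_gen_supported]
    by (cases "\<omega> \<in> orbits"; cases "d = 2"; cases "d = 0"; cases "d = - 2")
       (simp_all add: theta_gen_def shift_at half' distrib_left del: of_real_divide)
qed

text \<open>Both terms are linear in \<open>Y\<close>: the conjugated coefficients that
  \<open>free_adj\<close> produces are conjugated back in \<open>mono_Wstar\<close>.\<close>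

lemma theta_gen_formula:
  assumes "\<And>\<mu>. Poly_Mapping.lookup Y [\<mu>] = c \<mu>"
  shows "mono_W K \<sigma> 1 (form_section K Y) d \<omega> + mono_Wstar K \<sigma> 1 (form_section K (free_adj Y)) d \<omega>
    = of_real (sqrt 2) * (\<Sum>\<mu>\<in>UNIV. c \<mu> * theta_gen \<mu> d \<omega>)"
proof (cases "\<omega> \<in> orbits")
  case False
  then show ?thesis by (simp add: mono_W_def mono_Wstar_def theta_gen_def)
next
  case True
  have K: "line (\<omega> j) \<in> K" for j by (rule orbit_in_K[OF True])
  have cancel: "complex_of_real (sqrt 2) * (\<Sum>\<mu>\<in>UNIV. c \<mu> * (of_real (1 / sqrt 2) * f \<mu>))
      = (\<Sum>\<mu>\<in>UNIV. c \<mu> * f \<mu>)" for f :: "4 \<Rightarrow> complex"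
    unfolding sum_distrib_left by (intro sum.cong refl) (simp add: field_simps)
  show ?thesis
  proof (cases "d = 1 \<or> d = - 1")
    case False
    then show ?thesis using True by (simp add: mono_W_def mono_Wstar_def theta_gen_def)
  next
    case d: True
    show ?thesis
    proof (cases "d = 1")
      case True
      then show ?thesis
        using \<open>\<omega> \<in> orbits\<close> K self_in_line cancel[of "\<lambda>\<mu>. \<omega> 0 $ \<mu>"]
        by (simp add: mono_W_def mono_Wstar_def theta_gen_def form_section_def lin_form_def assms
            del: of_real_divide)
    next
      case False
      with d have "d = - 1" by simp
      then show ?thesis
        using \<open>\<omega> \<in> orbits\<close> K self_in_line cancel[of "\<lambda>\<mu>. cnj (\<omega> (- 1) $ \<mu>)"]
        by (simp add: mono_W_def mono_Wstar_def theta_gen_def form_section_def lin_form_def assms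
            lookup_free_adj del: of_real_divide)
    qed
  qed
qed

end

text \<open>At a fixed orbit and degree the relations are conditions on a matrix of numbers, checked
  separately in each degree that occurs and trivial in the others.\<close>

lemma theta_gen_annihilated:
  assumes gen: "generic \<phi>" "\<phi> 0 = 0" and "smooth_dynamics K (char_aut \<phi>)" and K: "K \<subseteq> F_curve \<phi>"
  shows "annihilated \<phi> (\<lambda>\<mu> \<nu>. (smooth_dynamics.theta_gen K (char_aut \<phi>) \<mu>
      \<otimes>\<^bsub>crossed_product K (char_aut \<phi>)\<^esub> smooth_dynamics.theta_gen K (char_aut \<phi>) \<nu>) d \<omega>)"
    (is "annihilated \<phi> ?P")
    and "(\<Sum>\<mu>\<in>UNIV. (smooth_dynamics.theta_gen K (char_aut \<phi>) \<mu>
      \<otimes>\<^bsub>crossed_product K (char_aut \<phi>)\<^esub> smooth_dynamics.theta_gen K (char_aut \<phi>) \<mu>) d \<omega>)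
      = \<one>\<^bsub>crossed_product K (char_aut \<phi>)\<^esub> d \<omega>"
    (is "?T = _")
proof -
  interpret smooth_dynamics K "char_aut \<phi>" by fact
  have "annihilated \<phi> ?P \<and> ?T = \<one>\<^bsub>CP\<^esub> d \<omega>"
  proof (cases "\<omega> \<in> orbits")
    case False
    then show ?thesis by (simp add: theta_gen_mult annihilated_zero CP_one)
  next
    case True
    have rel: "related \<phi> (\<omega> j) (\<omega> (j + 1))" "Q (\<omega> j) (\<omega> (j + 1)) = 0" for j
    proof -
      have "on_curve \<phi> (\<omega> j)"
        using orbit_in_K[OF True, of j] K orbit_nonzero[OF True] by (intro line_in_F_curve) auto
      then show "related \<phi> (\<omega> j) (\<omega> (j + 1))" "Q (\<omega> j) (\<omega> (j + 1)) = 0"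
        using char_aut_related[OF gen _ orbit_step[OF True, of j, symmetric] orbit_nonzero[OF True]]
        by simp_all
    qed
    have unit: "(\<Sum>\<mu>\<in>UNIV. \<omega> j $ \<mu> * cnj (\<omega> j $ \<mu>)) = 1" for j
      using orbit_unit[OF True, of j] by (simp add: Q_def conj_vec_def)
    consider "d = 2" | "d = 0" | "d = - 2" | "d \<noteq> 2" "d \<noteq> 0" "d \<noteq> - 2" by blast
    then show ?thesis
    proof cases
      case 1
      have "?T = 1 / 2 * Q (\<omega> 0) (\<omega> 1)"
        unfolding Q_def sum_distrib_left by (intro sum.cong refl) (simp add: theta_gen_mult True 1)
      then show ?thesis
        using annihilated_scale[OF rel(1)[of 0], of "1 / 2"] rel(2)[of 0]
        by (simp add: theta_gen_mult True 1 CP_one)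
    next
      case 2
      let ?t = "\<lambda>\<mu> \<nu>. \<omega> (- 1) $ \<mu> * \<omega> 0 $ \<nu>"
      let ?t' = "\<lambda>\<mu> \<nu>. cnj (?t \<nu> \<mu>)"
      have t: "annihilated \<phi> ?t" using rel(1)[of "- 1"] by simp
      have tr: "(\<Sum>\<mu>\<in>UNIV. ?t \<mu> \<mu>) = 0" using rel(2)[of "- 1"] by (simp add: Q_def)
      have "(\<Sum>\<mu>\<in>UNIV. ?t' \<mu> \<mu>) = cnj (\<Sum>\<mu>\<in>UNIV. ?t \<mu> \<mu>)" by simp
      then have "annihilated \<phi> (\<lambda>\<mu> \<nu>. \<Sum>\<rho>\<in>UNIV. ?t \<nu> \<rho> * ?t' \<rho> \<mu> + ?t' \<nu> \<rho> * ?t \<rho> \<mu>)"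
        by (intro annihilated_jordan_product[OF gen t annihilated_adjoint[OF t] tr]) (simp add: tr)
      moreover have "(\<Sum>\<rho>\<in>UNIV. ?t \<nu> \<rho> * ?t' \<rho> \<mu> + ?t' \<nu> \<rho> * ?t \<rho> \<mu>)
          = \<omega> 0 $ \<mu> * cnj (\<omega> 0 $ \<nu>) + cnj (\<omega> (- 1) $ \<mu>) * \<omega> (- 1) $ \<nu>" for \<mu> \<nu>
      proof -
        \<comment> \<open>In either product the contraction over \<rho> leaves the squared norm of a
          unit vector, which is 1; this is where the hermitian metric of the bundle enters.\<close>
        have "(\<Sum>\<rho>\<in>UNIV. ?t \<nu> \<rho> * ?t' \<rho> \<mu> + ?t' \<nu> \<rho> * ?t \<rho> \<mu>)
            = \<omega> (- 1) $ \<nu> * cnj (\<omega> (- 1) $ \<mu>) * (\<Sum>\<rho>\<in>UNIV. \<omega> 0 $ \<rho> * cnj (\<omega> 0 $ \<rho>))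
            + cnj (\<omega> 0 $ \<nu>) * \<omega> 0 $ \<mu> * (\<Sum>\<rho>\<in>UNIV. \<omega> (- 1) $ \<rho> * cnj (\<omega> (- 1) $ \<rho>))"
          unfolding sum_distrib_left sum.distrib[symmetric]
          by (intro sum.cong refl) (simp add: mult_ac)
        then show ?thesis unfolding unit by (simp add: mult_ac)
      qed
      ultimately have "annihilated \<phi> (\<lambda>\<mu> \<nu>. \<omega> 0 $ \<mu> * cnj (\<omega> 0 $ \<nu>) + cnj (\<omega> (- 1) $ \<mu>) * \<omega> (- 1) $ \<nu>)"
        by simp
      from annihilated_scale[OF this, of "1 / 2"] have "annihilated \<phi> ?P"
        by (simp add: theta_gen_mult True 2)
      moreover have "?T = 1 / 2 * ((\<Sum>\<mu>\<in>UNIV. \<omega> 0 $ \<mu> * cnj (\<omega> 0 $ \<mu>))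
          + (\<Sum>\<mu>\<in>UNIV. \<omega> (- 1) $ \<mu> * cnj (\<omega> (- 1) $ \<mu>)))"
        unfolding sum.distrib[symmetric] sum_distrib_left
        by (intro sum.cong refl) (simp add: theta_gen_mult True 2 mult.commute)
      then have "?T = 1" unfolding unit by simp
      ultimately show ?thesis using True 2 by (simp add: CP_one)
    next
      case 3
      \<comment> \<open>Degree -2 is the conjugate transpose of the situation in degree 2, at the
        places -2 and -1.\<close>
      have "?T = 1 / 2 * cnj (Q (\<omega> (- 2)) (\<omega> (- 1)))"
        unfolding Q_def cnj_sum sum_distrib_left
        by (intro sum.cong refl) (simp add: theta_gen_mult True 3)
      then show ?thesis
        using annihilated_scale[OF annihilated_adjoint[OF rel(1)[of "- 2"]], of "1 / 2"] rel(2)[of "- 2"]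
        by (simp add: theta_gen_mult True 3 CP_one mult.commute)
    next
      case 4
      then show ?thesis using True by (simp add: theta_gen_mult annihilated_zero CP_one)
    qed
  qed
  then show "annihilated \<phi> ?P" "?T = \<one>\<^bsub>CP\<^esub> d \<omega>" by simp_all
qed

theorem corollary11p9:
  fixes \<phi> :: "4 \<Rightarrow> real" and K :: "(complex^4) set set"
  assumes "\<phi> 0 = 0"
    and "generic \<phi>"
    and "K \<subseteq> F_curve \<phi>"
    and "compactin proj_topology K"
    and "char_aut \<phi> ` K = K"
  shows "\<exists>!\<theta>. \<theta> \<in> extensional (carrier (C_alg_S3 \<phi>)) \<and>
    unital_star_hom (C_alg_S3 \<phi>) (crossed_product K (char_aut \<phi>)) \<theta> \<and>
    (\<forall>Y\<in>gen_span.
       of_real (sqrt 2) \<odot>\<^bsub>crossed_product K (char_aut \<phi>)\<^esub> \<theta> (cls (S3_relators \<phi>) Y) =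
         mono_W K (char_aut \<phi>) 1 (form_section K Y)
           \<oplus>\<^bsub>crossed_product K (char_aut \<phi>)\<^esub>
         mono_Wstar K (char_aut \<phi>) 1 (form_section K (free_adj Y)))"
proof -
  have dyn: "smooth_dynamics K (char_aut \<phi>)"
    by (rule smooth_dynamics_char_aut[OF assms(2,1,3,5)])
  then interpret smooth_dynamics K "char_aut \<phi>" .
  interpret G: star_generators CP theta_gen by (rule star_generators_theta)
  let ?S = "S3_relators \<phi>"
  note ann = theta_gen_annihilated(1)[OF assms(2,1) dyn assms(3)]
  note sphere = theta_gen_annihilated(2)[OF assms(2,1) dyn assms(3)]
  have lift_diff: "G.lift (a - b) d \<omega> = G.lift a d \<omega> - G.lift b d \<omega>" for a b d \<omega>
    unfolding diff_conv_scl G.lift_add G.lift_scl by (simp add: CP_simps)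
  have lift_sum: "G.lift (\<Sum>i\<in>I. f i) d \<omega> = (\<Sum>i\<in>I. G.lift (f i) d \<omega>)" for f and I :: "4 set" and d \<omega>
    by (induction I rule: infinite_finite_induct) (simp_all add: G.lift_add CP_simps(2,4))
  have lift_zero: "G.lift s = \<zero>\<^bsub>CP\<^esub>" if s: "s \<in> ?S" for s
  proof -
    have "G.lift s d \<omega> = 0" for d \<omega>
    proof (cases "s = (\<Sum>\<mu>\<in>UNIV. gen \<mu> ^ 2) - 1")
      case True
      have "G.lift s d \<omega> = (\<Sum>\<mu>\<in>UNIV. (theta_gen \<mu> \<otimes>\<^bsub>CP\<^esub> theta_gen \<mu>) d \<omega>) - \<one>\<^bsub>CP\<^esub> d \<omega>"
        unfolding True lift_diff lift_sum by (simp add: power2_eq_square G.lift_mult)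
      then show ?thesis using sphere by simp
    next
      case False
      then have "s \<in> R4_relators \<phi>" using s by (simp add: S3_relators_def)
      then obtain k l m where klm: "(k, l, m) \<in> cyc" and
        "s = scl (of_real (sin (\<phi> k))) (gen 0 * gen k + gen k * gen 0)
            - scl (\<i> * of_real (cos (\<phi> l - \<phi> m))) (gen l * gen m - gen m * gen l) \<or>
         s = scl (of_real (cos (\<phi> k))) (gen 0 * gen k - gen k * gen 0)
            - scl (\<i> * of_real (sin (\<phi> l - \<phi> m))) (gen l * gen m + gen m * gen l)"
        unfolding R4_relators_cyc by auto
      moreover have "of_real (sin (\<phi> k)) * ((theta_gen 0 \<otimes>\<^bsub>CP\<^esub> theta_gen k) d \<omega> + (theta_gen k \<otimes>\<^bsub>CP\<^esub> theta_gen 0) d \<omega>)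
          = \<i> * of_real (cos (\<phi> l - \<phi> m)) * ((theta_gen l \<otimes>\<^bsub>CP\<^esub> theta_gen m) d \<omega> - (theta_gen m \<otimes>\<^bsub>CP\<^esub> theta_gen l) d \<omega>) \<and>
        of_real (cos (\<phi> k)) * ((theta_gen 0 \<otimes>\<^bsub>CP\<^esub> theta_gen k) d \<omega> - (theta_gen k \<otimes>\<^bsub>CP\<^esub> theta_gen 0) d \<omega>)
          = \<i> * of_real (sin (\<phi> l - \<phi> m)) * ((theta_gen l \<otimes>\<^bsub>CP\<^esub> theta_gen m) d \<omega> + (theta_gen m \<otimes>\<^bsub>CP\<^esub> theta_gen l) d \<omega>)"
        using iffD1[OF annihilated_iff_relations[of \<phi>, OF assms(2,1)] ann[of d \<omega>]] klm by auto
      ultimately show ?thesis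
        by (auto simp: lift_diff G.lift_scl G.lift_add G.lift_mult CP_simps(4,5))
    qed
    then show ?thesis by (simp add: CP_simps(2) fun_eq_iff)
  qed
  obtain \<theta> where \<theta>: "\<theta> \<in> extensional (carrier (presented_alg ?S))"
    "unital_star_hom (presented_alg ?S) CP \<theta>" "\<forall>a. \<theta> (cls ?S a) = G.lift a"
    using G.presented_alg_universal[OF lift_zero] by blast
  have span: "G.lift (\<Sum>\<mu>\<in>UNIV. scl (c \<mu>) (gen \<mu>)) d \<omega> = (\<Sum>\<mu>\<in>UNIV. c \<mu> * theta_gen \<mu> d \<omega>)"
    for c :: "4 \<Rightarrow> complex" and d \<omega>
    unfolding lift_sum by (simp add: G.lift_scl CP_simps(5))
  have formula: "of_real (sqrt 2) \<odot>\<^bsub>CP\<^esub> G.lift Y = mono_W K (char_aut \<phi>) 1 (form_section K Y)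
      \<oplus>\<^bsub>CP\<^esub> mono_Wstar K (char_aut \<phi>) 1 (form_section K (free_adj Y))" if "Y \<in> gen_span" for Y
  proof -
    obtain c where Y: "Y = (\<Sum>\<mu>\<in>UNIV. scl (c \<mu>) (gen \<mu>))"
      using \<open>Y \<in> gen_span\<close> unfolding gen_span_def by blast
    have "Poly_Mapping.lookup Y [\<mu>] = c \<mu>" for \<mu> unfolding Y by (rule lookup_form_sum)
    from theta_gen_formula[OF this] show ?thesis
      unfolding CP_simps(4,5) by (intro ext) (simp add: Y span)
  qed
  have gen_in_span: "gen \<mu> \<in> gen_span" for \<mu>
  proof -
    have "(\<Sum>\<nu>\<in>UNIV. scl (if \<nu> = \<mu> then 1 else 0) (gen \<nu>)) = (\<Sum>\<nu>\<in>UNIV. if \<nu> = \<mu> then gen \<mu> else 0)"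
      by (intro sum.cong refl) simp
    then have "gen \<mu> = (\<Sum>\<nu>\<in>UNIV. scl (if \<nu> = \<mu> then 1 else 0) (gen \<nu>))" by simp
    then show ?thesis unfolding gen_span_def by (rule range_eqI[where x = "\<lambda>\<nu>. if \<nu> = \<mu> then 1 else 0"])
  qed
  have unique: "\<theta>' = \<theta>" if \<theta>': "\<theta>' \<in> extensional (carrier (presented_alg ?S))"
    "unital_star_hom (presented_alg ?S) CP \<theta>'"
    "\<forall>Y\<in>gen_span. of_real (sqrt 2) \<odot>\<^bsub>CP\<^esub> \<theta>' (cls ?S Y) = mono_W K (char_aut \<phi>) 1 (form_section K Y)
      \<oplus>\<^bsub>CP\<^esub> mono_Wstar K (char_aut \<phi>) 1 (form_section K (free_adj Y))" for \<theta>'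
  proof -
    \<comment> \<open>The formula on \<open>gen_span\<close> prescribes the values on generators up
      to the factor sqrt 2, which can be cancelled in each component.\<close>
    have "\<theta>' (cls ?S (gen \<mu>)) = \<theta> (cls ?S (gen \<mu>))" for \<mu>
    proof -
      have "of_real (sqrt 2) \<odot>\<^bsub>CP\<^esub> \<theta>' (cls ?S (gen \<mu>)) = of_real (sqrt 2) \<odot>\<^bsub>CP\<^esub> \<theta> (cls ?S (gen \<mu>))"
        unfolding \<theta>'(3)[rule_format, OF gen_in_span] \<theta>(3)[rule_format]
          formula[OF gen_in_span] ..
      then show ?thesis by (simp add: CP_simps(5) fun_eq_iff)
    qed
    then have "\<theta>' (cls ?S a) = \<theta> (cls ?S a)" for a
      by (rule star_hom_eq_on_generators[OF \<theta>'(2) \<theta>(2)])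
    then show ?thesis
      by (intro extensionalityI[OF \<theta>'(1) \<theta>(1)]) (auto simp: PA_carrier)
  qed
  show ?thesis
    unfolding C_alg_S3_def
    by (rule ex1I[of _ \<theta>], intro conjI ballI \<theta>(1,2), simp only: \<theta>(3) formula,
        elim conjE, rule unique)
qed

end
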